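(* Let $K$ be a number field and $D\in K[X]$ a non-square polynomial of even degree $2d$ whose leading coefficient is a square in $K$; fix a square root $\sqrt D\in K((X^{-1}))$. Let $(p_m,q_m)$ be the canonical convergents of $\sqrt D$ and put $n=\deg q_m$. Then $$h_{\mathrm{proj}}(p_m)\le\Big((n+1)d+\tfrac32(n^2+n)\Big)\big(\log4+2\log(2d)+h_{\mathrm{proj}}(D)\big),$$ $$h_{\mathrm{proj}}(q_m)\le\Big(nd+\tfrac12(3n^2+n)\Big)\big(\log4+2\log(2d)+h_{\mathrm{proj}}(D)\big).$$
   Context: $K((X^{-1}))$: Laurent series $\sum_{n\le N}t_nX^n$, $\operatorname{ord}(\sum_{n\le N}t_nX^n)=-N$ if $t_N\ne0$; $\lfloor\alpha\rfloor$ is the unique polynomial with $\operatorname{ord}(\alpha-\lfloor\alpha\rfloor)>0$. Continued fraction: $\alpha_0=\alpha$, $\alpha_{n+1}=1/(\alpha_n-\lfloor\alpha_n\rfloor)$, $a_n=\lfloor\alpha_n\rfloor$; canonical convergents $p_{-1}=1,q_{-1}=0,p_0=a_0,q_0=1$, $p_n=a_np_{n-1}+p_{n-2}$, $q_n=a_nq_{n-1}+q_{n-2}$. For a nonzero polynomial $f=\sum_{i=0}^nc_iX^i\in K[X]$, $h_{\mathrm{proj}}(f)=\sum_{v\in M_K}\log\max_i|c_i|_v$ is the absolute logarithmic projective Weil height of $(c_n:\dots:c_0)$, with absolute values normalised so that the product formula holds. *)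

theory Defs
  imports "HOL-Computational_Algebra.Computational_Algebra" "HOL-Analysis.Analysis"
begin

definition number_field :: "'a::field_char_0 itself \<Rightarrow> bool" where
  "number_field _ \<longleftrightarrow> (\<exists>B :: 'a set. finite B \<and>
      (\<forall>x::'a. \<exists>c. x = (\<Sum>b\<in>B. of_rat (c b) * b)))"

definition complex_embeddings :: "('a::field_char_0 \<Rightarrow> complex) set" where
  "complex_embeddings = {\<sigma>. (\<forall>x y. \<sigma> (x + y) = \<sigma> x + \<sigma> y \<and> \<sigma> (x * y) = \<sigma> x * \<sigma> y) \<and> \<sigma> 1 = 1}"

definition alg_int :: "'a::field_char_0 \<Rightarrow> bool" where
  "alg_int x \<longleftrightarrow> (\<exists>p :: int poly. lead_coeff p = 1 \<and> poly (map_poly of_int p) x = 0)"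

definition ring_of_integers :: "'a::field_char_0 set" where
  "ring_of_integers = {x. alg_int x}"

definition gen_ideal :: "'a::field_char_0 list \<Rightarrow> 'a set" where
  "gen_ideal xs = {(\<Sum>i<length xs. r i * xs ! i) | r. \<forall>i. r i \<in> ring_of_integers}"

definition ideal_norm :: "'a::field_char_0 set \<Rightarrow> nat" where
  "ideal_norm I = card {{y \<in> ring_of_integers. y - x \<in> I} | x. x \<in> ring_of_integers}"

text \<open>Height of a projective point with algebraic-integer coordinates: archimedean places
  via the complex embeddings (each place v counted with its local degree), non-archimedean
  places via the norm of the ideal generated by the coordinates.\<close>
definition height_integral :: "'a::field_char_0 list \<Rightarrow> real" where
  "height_integral xs =
     ((\<Sum>\<sigma>\<in>complex_embeddings. ln (Max ((\<lambda>c. cmod (\<sigma> c)) ` set xs)))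
       - ln (real (ideal_norm (gen_ideal xs)))) / real (card (complex_embeddings :: ('a \<Rightarrow> complex) set))"

text \<open>Absolute logarithmic projective Weil height of (x_0 : ... : x_n): first clear
  denominators by a positive integer (the height is invariant under scaling).\<close>
definition proj_height :: "'a::field_char_0 list \<Rightarrow> real" where
  "proj_height xs = height_integral (map (\<lambda>x. of_nat (LEAST m::nat. m > 0 \<and>
       (\<forall>y\<in>set xs. alg_int (of_nat m * y))) * x) xs)"

definition h_proj :: "'a::field_char_0 poly \<Rightarrow> real" where
  "h_proj f = proj_height (coeffs f)"

text \<open>K((X^{-1})) is represented as formal Laurent series in Y = X^{-1}: the coefficient of
  X^n is the Y-coefficient of index -n.  Then ord is the Y-subdegree.\<close>
definition poly_to_fls :: "'a::field poly \<Rightarrow> 'a fls" where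
  "poly_to_fls f = (\<Sum>i\<le>degree f. fls_const (coeff f i) * fls_X_inv ^ i)"

definition lfloor :: "'a::field fls \<Rightarrow> 'a poly" where
  "lfloor \<alpha> = Poly (map (\<lambda>i. fls_nth \<alpha> (- int i)) [0..<nat (- fls_subdegree \<alpha>) + 1])"

fun cf_alpha :: "'a::field fls \<Rightarrow> nat \<Rightarrow> 'a fls" where
  "cf_alpha \<alpha> 0 = \<alpha>"
| "cf_alpha \<alpha> (Suc n) = inverse (cf_alpha \<alpha> n - poly_to_fls (lfloor (cf_alpha \<alpha> n)))"

definition cf_a :: "'a::field fls \<Rightarrow> nat \<Rightarrow> 'a poly" where
  "cf_a \<alpha> n = lfloor (cf_alpha \<alpha> n)"

text \<open>Shifted indexing: cf_p \<alpha> (m+1) = p_m, cf_p \<alpha> 0 = p_{-1}; likewise for q.\<close>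
fun cf_p :: "'a::field fls \<Rightarrow> nat \<Rightarrow> 'a poly" where
  "cf_p \<alpha> 0 = 1"
| "cf_p \<alpha> (Suc 0) = cf_a \<alpha> 0"
| "cf_p \<alpha> (Suc (Suc n)) = cf_a \<alpha> (Suc n) * cf_p \<alpha> (Suc n) + cf_p \<alpha> n"

fun cf_q :: "'a::field fls \<Rightarrow> nat \<Rightarrow> 'a poly" where
  "cf_q \<alpha> 0 = 0"
| "cf_q \<alpha> (Suc 0) = 1"
| "cf_q \<alpha> (Suc (Suc n)) = cf_a \<alpha> (Suc n) * cf_q \<alpha> (Suc n) + cf_q \<alpha> n"

end

theory Submission
  imports "HOL-Computational_Algebra.Field_as_Ring" "Jordan_Normal_Form.Char_Poly" Defs
begin

text \<open>
  Write \<open>\<surd>D = \<gamma> X^d (1 + t\<^sub>1/X + t\<^sub>2/X\<^sup>2 + \<dots>)\<close>. The denominator \<open>q\<close> of degree \<open>n\<close> spans the kernel of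
  the \<open>n \<times> (n+1)\<close> Hankel matrix of the coefficients \<open>t\<close>, so up to one common factor the coefficients of
  \<open>q\<close> and \<open>p\<close> are determinants of this matrix extended by one more row. After scaling, let \<open>D\<close> have integral
  coefficients generating the ideal \<open>I\<close>, with leading coefficient \<open>b\<close>. Then \<open>(4b)^r t\<^sub>r\<close> lies in \<open>I^r\<close>, and at
  every complex embedding it is bounded by \<open>(8d max|D\<^sub>i|)^r\<close>. Hence, for a suitable exponent \<open>M\<close>, the determinants
  scaled by \<open>(4b)^M\<close> lie in \<open>I^M\<close> and are at most \<open>(n+1)! (8d max|D\<^sub>i|)^M\<close>.

  To turn this into heights one needs that the norm of \<open>I^M\<close> is at least the \<open>M\<close>-th power of the norm of \<open>I\<close>
  (which follows from the invertibility of \<open>I\<close>, that is, from the Gauss lemma of Kronecker and Dedekind for algebraic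
  integers), and that the norm of a principal ideal is the product of the conjugates of its generator, which makes
  the height invariant under scaling.
\<close>

section \<open>Algebraic integers\<close>

text \<open>The height is read from complex embeddings and from indices in the ring of integers,
  while a number field is given only by a finite spanning set; hence the long preparation on
  conjugates, integrality and indices. An infinite quotient has \<open>card\<close> 0, so finiteness
  must be proved before the logarithm of an index means anything. The bounds are uniform because the
  problem is weighted: \<open>t r\<close> has weight \<open>r\<close>, and the Hankel entry in row
  \<open>i\<close>, column \<open>j\<close> has weight \<open>d + i + j\<close>. The sum of
  \<open>i + \<pi> i\<close> does not depend on the permutation \<open>\<pi>\<close>, so one
  exponent serves all Leibniz terms: \<open>n d + n^2 + n\<close> for \<open>q\<close> and
  \<open>(n + 1) d + n^2 + n\<close> for \<open>p\<close>. The base \<open>8 d\<close> is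
  \<open>4 (2 d)\<close>: the 4 clears the denominators \<open>2 b\<close> of the square root
  recursion, and \<open>2 d\<close> counts the coefficients of \<open>D\<close> below the leading
  one. The factorial \<open>(n + 1)!\<close> is at most \<open>2^(n^2 + n)\<close>. The factor
  \<open>log 4 + 2 log (2 d) + h(D)\<close> exceeds \<open>log (8 d) + h(D)\<close> by
  \<open>log (2 d)\<close>; for \<open>q\<close> this surplus pays for the factorial, for
  \<open>p\<close> the difference between \<open>3/2 (n^2 + n)\<close> and \<open>n^2 + n\<close>
  does.\<close>

interpretation Z: Modules.module "\<lambda>(k::int) (x::'a::field_char_0). of_int k * x"
  by unfold_locales (simp_all add: algebra_simps)

lemma alg_int_iff_algebraic_int: "alg_int x \<longleftrightarrow> algebraic_int x"
  unfolding alg_int_def algebraic_int_altdef_ipoly by blast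

text \<open>\<open>x\<close> is an eigenvalue of the integer matrix \<open>A\<close>, where
  \<open>v k \<noteq> 0\<close> makes \<open>v\<close> a genuine eigenvector; the characteristic
  polynomial of \<open>A\<close> is monic and integral.\<close>

lemma alg_int_eigen:
  fixes x :: "'a::field_char_0" and v :: "nat \<Rightarrow> 'a" and A :: "nat \<Rightarrow> nat \<Rightarrow> int"
  assumes eq: "\<And>i. i < n \<Longrightarrow> x * v i = (\<Sum>j<n. of_int (A i j) * v j)"
    and k: "k < n" "v k \<noteq> 0"
  shows "alg_int x"
proof -
  define M where "M = Matrix.mat n n (\<lambda>(i,j). A i j)"
  define N :: "'a mat" where "N = map_mat of_int M"
  have M: "M \<in> carrier_mat n n" and N: "N \<in> carrier_mat n n"
    by (auto simp: M_def N_def)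
  have "eigenvector N (Matrix.vec n v) x"
    unfolding eigenvector_def
  proof (intro conjI)
    show "Matrix.vec n v \<in> carrier_vec (dim_row N)" using N by auto
    show "Matrix.vec n v \<noteq> 0\<^sub>v (dim_row N)"
    proof
      assume "Matrix.vec n v = 0\<^sub>v (dim_row N)"
      then have "vec_index (Matrix.vec n v) k = vec_index (0\<^sub>v (dim_row N)) k" by simp
      then show False using k N by simp
    qed
    show "N *\<^sub>v Matrix.vec n v = x \<cdot>\<^sub>v Matrix.vec n v"
    proof (rule eq_vecI)
      show "dim_vec (N *\<^sub>v Matrix.vec n v) = dim_vec (x \<cdot>\<^sub>v Matrix.vec n v)" using N by simp
      fix i assume "i < dim_vec (x \<cdot>\<^sub>v Matrix.vec n v)"
      then have i: "i < n" by simp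
      show "vec_index (N *\<^sub>v Matrix.vec n v) i = vec_index (x \<cdot>\<^sub>v Matrix.vec n v) i"
        using i eq[OF i] N
        by (simp add: N_def M_def scalar_prod_def atLeast0LessThan)
    qed
  qed
  then have "eigenvalue N x" unfolding eigenvalue_def by blast
  then have "poly (char_poly N) x = 0" using eigenvalue_root_char_poly[OF N] by blast
  moreover have "char_poly N = map_poly of_int (char_poly M)"
    unfolding N_def by (rule of_int_hom.char_poly_hom[OF M])
  moreover have "lead_coeff (char_poly M) = 1" using degree_monic_char_poly[OF M] by simp
  ultimately show ?thesis unfolding alg_int_def by metis
qed

text \<open>Integrality is tested on finitely generated Z-modules: the elements stabilising the span
  of \<open>S\<close> are closed under sums and products, so no explicit polynomials are needed for
  these.\<close>

definition zstable :: "'a::field_char_0 set \<Rightarrow> 'a \<Rightarrow> bool" where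
  "zstable S x \<longleftrightarrow> (\<forall>b\<in>S. x * b \<in> Z.span S)"

lemma zstable_span:
  assumes "zstable S x" "y \<in> Z.span S"
  shows "x * y \<in> Z.span S"
  using assms(2)
proof (induction rule: Z.span_induct_alt)
  case base
  then show ?case by (simp add: Z.span_zero)
next
  case (step c b y)
  have "x * (of_int c * b + y) = of_int c * (x * b) + x * y" by (simp add: algebra_simps)
  then show ?case using step assms(1) unfolding zstable_def by (simp add: Z.span_add Z.span_scale)
qed

lemma zstable_add: "zstable S x \<Longrightarrow> zstable S y \<Longrightarrow> zstable S (x + y)"
  unfolding zstable_def by (simp add: distrib_right Z.span_add)

lemma zstable_mult: "zstable S x \<Longrightarrow> zstable S y \<Longrightarrow> zstable S (x * y)"
  unfolding zstable_def[of S y] zstable_def[of S "x*y"] by (simp add: mult.assoc zstable_span)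

text \<open>Expanding \<open>x * b\<close> in the generators gives an integer matrix with eigenvalue
  \<open>x\<close>; the generator 1 supplies the nonzero entry of the eigenvector.\<close>

lemma alg_int_if_zstable:
  assumes fin: "finite S" and one: "1 \<in> S" and st: "zstable S x"
  shows "alg_int x"
proof -
  obtain v where v: "bij_betw v {..<card S} S"
    using fin ex_bij_betw_nat_finite[of S] by (auto simp: atLeast0LessThan)
  have "\<exists>a. x * v i = (\<Sum>j<card S. of_int (a j) * v j)" if "i < card S" for i
  proof -
    have "v i \<in> S" using v that by (auto simp: bij_betw_def)
    then have "x * v i \<in> Z.span S" using st unfolding zstable_def by blast
    then obtain u where "x * v i = (\<Sum>b\<in>S. of_int (u b) * b)"
      using Z.span_finite[OF fin] by auto
    then have "x * v i = (\<Sum>j<card S. of_int (u (v j)) * v j)"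
      using sum.reindex_bij_betw[OF v, of "\<lambda>b. of_int (u b) * b"] by simp
    then show ?thesis by (intro exI[of _ "u \<circ> v"]) simp
  qed
  then obtain A where A: "\<And>i. i < card S \<Longrightarrow> x * v i = (\<Sum>j<card S. of_int (A i j) * v j)"
    by metis
  obtain k where "k < card S" "v k = 1"
  proof -
    have "1 \<in> v ` {..<card S}" using one v by (simp add: bij_betw_def)
    then show thesis using that by auto
  qed
  then show ?thesis using alg_int_eigen[of "card S" x v A k] A by simp
qed

text \<open>The new generators are \<open>b * \<rho> ^ i\<close> with \<open>i < degree P\<close>.
  Multiplication by \<open>\<rho>\<close> overflows only at the top power, where the monic relation
  applies and its coefficients stabilise \<open>S\<close>. This is the tower step behind
  transitivity of integrality.\<close>

lemma zstable_extend:
  fixes \<rho> :: "'a::field_char_0"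
  assumes fin: "finite S" and one: "1 \<in> S"
    and P: "lead_coeff P = 1" "poly P \<rho> = 0" "\<And>i. zstable S (coeff P i)"
  obtains S' where "finite S'" "1 \<in> S'" "zstable S' \<rho>" "\<And>x. zstable S x \<Longrightarrow> zstable S' x"
proof -
  define k where "k = degree P"
  have k0: "k > 0"
  proof (rule ccontr)
    assume "\<not> k > 0"
    then obtain c where "P = [:c:]" using degree_eq_zeroE[of P] k_def by auto
    then show False using P by simp
  qed
  define S' where "S' = (\<lambda>(b,i). b * \<rho> ^ i) ` (S \<times> {..<k})"
  have incl: "y * \<rho> ^ i \<in> Z.span S'" if "y \<in> Z.span S" "i < k" for y i
    using that(1)
  proof (induction rule: Z.span_induct_alt)
    case base
    then show ?case by (simp add: Z.span_zero)
  next
    case (step c b y)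
    have "b * \<rho> ^ i \<in> S'" unfolding S'_def using step that by auto
    then have "of_int c * (b * \<rho>^i) + y * \<rho>^i \<in> Z.span S'"
      using step.IH Z.span_add Z.span_scale Z.span_base by blast
    then show ?case by (simp add: algebra_simps)
  qed
  have st: "zstable S' x" if "zstable S x" for x
    unfolding zstable_def
  proof
    fix z assume "z \<in> S'"
    then obtain b i where z: "z = b * \<rho> ^ i" "b \<in> S" "i < k" unfolding S'_def by auto
    have "x * b \<in> Z.span S" using that z unfolding zstable_def by blast
    then show "x * z \<in> Z.span S'" using incl[of "x*b" i] z by (simp add: mult.assoc)
  qed
  have top: "\<rho> ^ k = (\<Sum>i<k. - coeff P i * \<rho> ^ i)"
  proof -
    have "0 = (\<Sum>i\<le>k. coeff P i * \<rho> ^ i)" using P(2) by (simp add: poly_altdef k_def)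
    also have "\<dots> = (\<Sum>i<k. coeff P i * \<rho> ^ i) + \<rho> ^ k"
      using P(1) by (simp add: k_def lessThan_Suc_atMost[symmetric])
    finally show ?thesis by (simp add: sum_negf add_eq_0_iff)
  qed
  have "zstable S' \<rho>"
    unfolding zstable_def
  proof
    fix z assume "z \<in> S'"
    then obtain b i where z: "z = b * \<rho> ^ i" "b \<in> S" "i < k" unfolding S'_def by auto
    show "\<rho> * z \<in> Z.span S'"
    proof (cases "Suc i < k")
      case True
      then have "b * \<rho> ^ Suc i \<in> S'" unfolding S'_def using z by (intro image_eqI[of _ _ "(b, Suc i)"]) auto
      moreover have "\<rho> * z = b * \<rho> ^ Suc i" by (simp add: z algebra_simps)
      ultimately show ?thesis by (metis Z.span_base)
    next
      case False
      then have "Suc i = k" using z by simp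
      then have "\<rho> * z = b * \<rho> ^ k" using z by (auto simp: algebra_simps)
      also have "\<dots> = (\<Sum>i<k. - ((coeff P i * b) * \<rho> ^ i))"
        unfolding top by (simp add: sum_distrib_left algebra_simps)
      also have "\<dots> \<in> Z.span S'"
        using P(3) z(2) unfolding zstable_def by (intro Z.span_sum Z.span_neg incl) auto
      finally show ?thesis .
    qed
  qed
  moreover have "finite S'" unfolding S'_def using fin by simp
  moreover have "1 \<in> S'" unfolding S'_def using one k0 by (auto intro!: image_eqI[of _ _ "(1,0)"])
  ultimately show ?thesis using that st by blast
qed

lemma zstable_of_int: "zstable S (of_int c)"
  unfolding zstable_def by (auto intro: Z.span_scale Z.span_base)

text \<open>A common module for all of \<open>T\<close>, built by adjoining one element at a time;
  it is what allows different algebraic integers to be added and multiplied.\<close>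

lemma alg_ints_zstable:
  assumes "finite T" "\<And>t. t \<in> T \<Longrightarrow> alg_int t"
  shows "\<exists>S. finite S \<and> 1 \<in> S \<and> (\<forall>t\<in>T. zstable S (t::'a::field_char_0))"
  using assms
proof (induction rule: finite_induct)
  case empty
  show ?case by (intro exI[of _ "{1}"]) auto
next
  case (insert t T)
  then obtain S where S: "finite S" "1 \<in> S" "\<forall>t\<in>T. zstable S t" by auto
  obtain p :: "int poly" where p: "lead_coeff p = 1" "poly (map_poly of_int p) t = 0"
    using insert.prems unfolding alg_int_def by auto
  obtain S' where "finite S'" "1 \<in> S'" "zstable S' t" "\<And>x. zstable S x \<Longrightarrow> zstable S' x"
  proof (rule zstable_extend)
    show "lead_coeff (map_poly of_int p :: 'a poly) = 1" using p by (simp add: coeff_map_poly degree_map_poly)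
    show "zstable S (coeff (map_poly of_int p) i)" for i by (simp add: coeff_map_poly zstable_of_int)
  qed (use S p in auto)
  then show ?case using S by blast
qed

lemma alg_int_add: "alg_int x \<Longrightarrow> alg_int y \<Longrightarrow> alg_int (x + y)"
  proof -
  assume "alg_int x" "alg_int y"
  then obtain S where S: "finite S" "1 \<in> S" "\<forall>t\<in>{x,y}. zstable S t"
    using alg_ints_zstable[of "{x,y}"] by fastforce
  then have "zstable S (x + y)" by (intro zstable_add) auto
  then show ?thesis using S alg_int_if_zstable by blast
qed

lemma alg_int_mult: "alg_int x \<Longrightarrow> alg_int y \<Longrightarrow> alg_int (x * y)"
  proof -
  assume "alg_int x" "alg_int y"
  then obtain S where S: "finite S" "1 \<in> S" "\<forall>t\<in>{x,y}. zstable S t"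
    using alg_ints_zstable[of "{x,y}"] by fastforce
  then have "zstable S (x * y)" by (intro zstable_mult) auto
  then show ?thesis using S alg_int_if_zstable by blast
qed

lemma alg_int_of_int [simp]: "alg_int (of_int k)"
  by (rule alg_int_if_zstable[of "{1}"]) (auto simp: zstable_of_int)

lemma alg_int_of_nat [simp]: "alg_int (of_nat k)"
  using alg_int_of_int[of "int k"] by simp

lemma alg_int_0 [simp]: "alg_int 0" and alg_int_1 [simp]: "alg_int 1"
  using alg_int_of_int[of 0] alg_int_of_int[of 1] by simp_all

lemma alg_int_uminus: "alg_int x \<Longrightarrow> alg_int (- x)"
  using alg_int_mult[OF alg_int_of_int[of "-1"], of x] by simp

lemma alg_int_diff: "alg_int x \<Longrightarrow> alg_int y \<Longrightarrow> alg_int (x - y)"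
  using alg_int_add[of x "- y"] alg_int_uminus by fastforce

lemma alg_int_sum: "(\<And>i. i \<in> A \<Longrightarrow> alg_int (f i)) \<Longrightarrow> alg_int (sum f A)"
  by (induction A rule: infinite_finite_induct) (auto intro: alg_int_add)

lemma alg_int_power: "alg_int x \<Longrightarrow> alg_int (x ^ n)"
  by (induction n) (auto intro: alg_int_mult)

lemma alg_int_root_monic:
  assumes P: "lead_coeff P = 1" "poly P \<rho> = 0" "\<And>i. alg_int (coeff P i)"
  shows "alg_int (\<rho>::'a::field_char_0)"
proof -
  have "alg_int t" if "t \<in> set (coeffs P)" for t
    using that P(3) by (auto simp: coeffs_def split: if_splits)
  then obtain S where S: "finite S" "1 \<in> S" "\<forall>t\<in>set (coeffs P). zstable S t"
    using alg_ints_zstable[of "set (coeffs P)"] by auto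
  have "zstable S (coeff P i)" for i
  proof (cases "i \<le> degree P \<and> P \<noteq> 0")
    case True
    then have "coeff P i \<in> set (coeffs P)" by (metis coeff_in_coeffs)
    then show ?thesis using S by blast
  next
    case False
    then have "coeff P i = 0" by (auto simp: coeff_eq_0)
    then show ?thesis using zstable_of_int[of S 0] by simp
  qed
  then obtain S' where "finite S'" "1 \<in> S'" "zstable S' \<rho>"
    using zstable_extend[OF S(1,2) P(1,2)] by metis
  then show ?thesis using alg_int_if_zstable by blast
qed

text \<open>With \<open>n = degree F\<close> and leading coefficient \<open>a\<close>, the
  polynomial \<open>a^(n-1) F(X/a)\<close> is monic with integral coefficients and has the root
  \<open>a \<rho>\<close>; it appears below as \<open>R\<close>.\<close>

lemma alg_int_lead_coeff_root:
  fixes F :: "'a::field_char_0 poly"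
  assumes F: "\<And>i. alg_int (coeff F i)" and root: "poly F \<rho> = 0" and deg: "degree F > 0"
  shows "alg_int (lead_coeff F * \<rho>)"
proof -
  define n where "n = degree F"
  define a where "a = lead_coeff F"
  define R where "R = monom 1 n + (\<Sum>i<n. monom (coeff F i * a ^ (n - 1 - i)) i)"
  have cR: "coeff R i = (if i = n then 1 else if i < n then coeff F i * a ^ (n - 1 - i) else 0)" for i
    unfolding R_def by (simp add: coeff_sum)
  have dR: "degree R = n"
    by (rule antisym[OF degree_le le_degree]) (auto simp: cR)
  have a: "alg_int a" unfolding a_def by (rule F)
  have "a * poly R (a * \<rho>) = (\<Sum>i\<le>n. a * (coeff R i * (a * \<rho>) ^ i))"
    by (simp add: poly_altdef dR sum_distrib_left)
  also have "\<dots> = (\<Sum>i\<le>n. a ^ n * (coeff F i * \<rho> ^ i))"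
  proof (rule sum.cong[OF refl])
    fix i assume i: "i \<in> {..n}"
    show "a * (coeff R i * (a * \<rho>) ^ i) = a ^ n * (coeff F i * \<rho> ^ i)"
    proof (cases "i = n")
      case True
      then show ?thesis by (simp add: cR power_mult_distrib a_def n_def)
    next
      case False
      then have "i < n" using i by simp
      then have "n = (n - 1 - i) + 1 + i" by simp
      then have "a ^ n = a ^ (n - 1 - i) * a * a ^ i" by (metis power_add power_one_right)
      then show ?thesis using \<open>i < n\<close> by (simp add: cR power_mult_distrib)
    qed
  qed
  also have "\<dots> = a ^ n * poly F \<rho>" by (simp add: poly_altdef n_def sum_distrib_left)
  finally have "a * poly R (a * \<rho>) = 0" using root by simp
  moreover have "a \<noteq> 0" using deg unfolding a_def by auto
  ultimately have r: "poly R (a * \<rho>) = 0" by simp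
  have lead: "lead_coeff R = 1" by (simp add: dR cR)
  have "alg_int (coeff R i)" for i unfolding cR using F a by (auto intro: alg_int_mult alg_int_power)
  from alg_int_root_monic[OF lead r this] show ?thesis unfolding a_def .
qed

lemma alg_int_of_rat: "alg_int (of_rat r :: 'a::field_char_0) \<Longrightarrow> r \<in> \<int>"
proof -
  assume "alg_int (of_rat r :: 'a)"
  then have "(of_rat r :: 'a) \<in> \<int>"
    unfolding alg_int_iff_algebraic_int by (rule rational_algebraic_int_is_int) simp
  then obtain k where "(of_rat r :: 'a) = of_int k" by (elim Ints_cases)
  then have "(of_rat r :: 'a) = of_rat (of_int k)" by simp
  then have "r = of_int k" by (simp only: of_rat_eq_iff)
  then show ?thesis by simp
qed

section \<open>Primitive elements\<close>

interpretation Q: vector_space "\<lambda>(r::rat) (x::'a::field_char_0). of_rat r * x"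
  by unfold_locales (simp_all add: algebra_simps of_rat_add of_rat_mult)

text \<open>Dependence counted with repetition: two equal members cancel with coefficients 1 and -1,
  and an injective family has too large an image to be independent.\<close>

lemma (in vector_space) dependent_family:
  assumes T: "finite T" "f ` I \<subseteq> span T" and I: "finite I" "card T < card I"
  obtains c where "\<exists>i\<in>I. c i \<noteq> 0" "(\<Sum>i\<in>I. scale (c i) (f i)) = 0"
proof (cases "inj_on f I")
  case True
  have "dependent (f ` I)"
    using independent_span_bound[OF T(1) _ T(2)] card_image[OF True] I by force
  then obtain u where u: "\<exists>v\<in>f ` I. u v \<noteq> 0" "(\<Sum>v\<in>f ` I. scale (u v) v) = 0"
    using dependent_finite I by auto
  then show ?thesis
    by (intro that[of "u \<circ> f"]) (auto simp: sum.reindex[OF True])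
next
  case False
  then obtain i j where ij: "i \<in> I" "j \<in> I" "i \<noteq> j" "f i = f j" unfolding inj_on_def by auto
  let ?c = "\<lambda>k. if k = i then 1 else if k = j then - 1 else 0"
  have "(\<Sum>k\<in>I. scale (?c k) (f k)) = (\<Sum>k\<in>{i,j}. scale (?c k) (f k))"
    using ij I by (intro sum.mono_neutral_right) auto
  also have "\<dots> = 0" using ij by simp
  finally show ?thesis using ij by (intro that[of ?c]) auto
qed

section \<open>Rational polynomials at a field element, and minimal polynomials\<close>

definition rat_eval :: "rat poly \<Rightarrow> 'a::field_char_0 \<Rightarrow> 'a" where
  "rat_eval p x = poly (map_poly of_rat p) x"

lemma rat_eval_0 [simp]: "rat_eval 0 x = 0"
  and rat_eval_1 [simp]: "rat_eval 1 x = 1"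
  and rat_eval_pCons [simp]: "rat_eval (pCons a p) x = of_rat a + x * rat_eval p x"
  unfolding rat_eval_def by (simp_all add: of_rat_hom.map_poly_pCons_hom)

lemma rat_eval_add: "rat_eval (p + q) x = rat_eval p x + rat_eval q x"
  unfolding rat_eval_def by (simp add: map_poly_add of_rat_add)

lemma rat_eval_smult: "rat_eval (Polynomial.smult a p) x = of_rat a * rat_eval p x"
  by (induction p) (auto simp: of_rat_mult algebra_simps)

lemma rat_eval_minus: "rat_eval (- p) x = - rat_eval p x"
  using rat_eval_smult[of "-1" p x] by (simp add: of_rat_minus)

lemma rat_eval_diff: "rat_eval (p - q) x = rat_eval p x - rat_eval q x"
  using rat_eval_add[of p "- q" x] by (simp add: rat_eval_minus)

lemma rat_eval_mult: "rat_eval (p * q) x = rat_eval p x * rat_eval q x"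
  by (induction p) (auto simp: rat_eval_add rat_eval_smult algebra_simps)

lemma rat_eval_sum: "rat_eval (\<Sum>i\<in>A. f i) x = (\<Sum>i\<in>A. rat_eval (f i) x)"
  by (induction A rule: infinite_finite_induct) (auto simp: rat_eval_add)

lemma rat_eval_monom: "rat_eval (monom a i) x = of_rat a * x ^ i"
  unfolding rat_eval_def by (simp add: map_poly_monom poly_monom)

lemma rat_eval_pcompose: "rat_eval (pcompose p q) x = rat_eval p (rat_eval q x)"
  by (induction p) (auto simp: pcompose_pCons rat_eval_add rat_eval_mult)

lemma rat_eval_altdef: "rat_eval p x = (\<Sum>i\<le>degree p. of_rat (coeff p i) * x ^ i)"
  unfolding rat_eval_def by (simp add: poly_altdef degree_map_poly coeff_map_poly)

text \<open>The \<open>card B + 1\<close> powers of \<open>x\<close> with exponent at most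
  \<open>card B\<close> lie in the span of \<open>B\<close>, hence are dependent.\<close>

lemma number_field_algebraic:
  fixes x :: "'a::field_char_0"
  assumes "number_field TYPE('a)"
  shows "\<exists>p. p \<noteq> 0 \<and> rat_eval p x = 0"
proof -
  obtain B :: "'a set" where B: "finite B" "\<And>x. \<exists>c. x = (\<Sum>b\<in>B. of_rat (c b) * b)"
    using assms unfolding number_field_def by auto
  have "(\<lambda>i. x ^ i) ` {..card B} \<subseteq> Q.span B"
  proof
    fix y show "y \<in> Q.span B" using B(2)[of y] Q.span_finite[OF B(1)] by auto
  qed
  then obtain c where c: "\<exists>i\<in>{..card B}. c i \<noteq> 0" "(\<Sum>i\<le>card B. of_rat (c i) * x ^ i) = 0"
    using Q.dependent_family[OF B(1), of "\<lambda>i. x ^ i" "{..card B}"] by auto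
  define p where "p = (\<Sum>i\<le>card B. monom (c i) i)"
  have "coeff p i = (if i \<le> card B then c i else 0)" for i
    unfolding p_def by (simp add: coeff_sum)
  then have "p \<noteq> 0" using c(1) by (metis atMost_iff coeff_0)
  moreover have "rat_eval p x = 0" unfolding p_def by (simp add: rat_eval_sum rat_eval_monom c)
  ultimately show ?thesis by blast
qed

definition is_min_poly :: "rat poly \<Rightarrow> 'a::field_char_0 \<Rightarrow> bool" where
  "is_min_poly p x \<longleftrightarrow> lead_coeff p = 1 \<and> rat_eval p x = 0 \<and>
     (\<forall>q. q \<noteq> 0 \<and> rat_eval q x = 0 \<longrightarrow> degree p \<le> degree q)"

lemma ex_min_poly:
  assumes "q \<noteq> 0" "rat_eval q x = 0"
  obtains p where "is_min_poly p x"
proof -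
  define P where "P = (\<lambda>q. q \<noteq> 0 \<and> rat_eval q x = 0)"
  obtain r where r: "P r" "\<And>q. P q \<Longrightarrow> degree r \<le> degree q"
    using ex_has_least_nat[of P q degree] assms unfolding P_def by blast
  define p where "p = Polynomial.smult (inverse (lead_coeff r)) r"
  have "r \<noteq> 0" using r P_def by simp
  then have "lead_coeff p = 1" "degree p = degree r" "rat_eval p x = 0"
    using r unfolding p_def P_def by (simp_all add: rat_eval_smult)
  then show ?thesis using that[of p] r unfolding is_min_poly_def P_def by auto
qed

lemma min_poly_dvd_iff:
  assumes "is_min_poly p x"
  shows "rat_eval q x = 0 \<longleftrightarrow> p dvd q"
proof
  assume q: "rat_eval q x = 0"
  have "p \<noteq> 0" using assms unfolding is_min_poly_def by auto
  have "q mod p = q - q div p * p" by (simp add: minus_div_mult_eq_mod)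
  then have rz: "rat_eval (q mod p) x = 0"
    using q assms unfolding is_min_poly_def by (simp add: rat_eval_diff rat_eval_mult)
  have "q mod p = 0"
  proof (rule ccontr)
    assume nz: "q mod p \<noteq> 0"
    then have "degree p \<le> degree (q mod p)"
      using assms rz unfolding is_min_poly_def by blast
    then show False using degree_mod_less[OF \<open>p \<noteq> 0\<close>, of q] nz by simp
  qed
  then show "p dvd q" by (simp add: dvd_eq_mod_eq_0)
next
  assume "p dvd q"
  then show "rat_eval q x = 0"
    using assms unfolding is_min_poly_def by (auto simp: rat_eval_mult)
qed

lemma min_poly_nonzero: "is_min_poly p x \<Longrightarrow> p \<noteq> 0"
  unfolding is_min_poly_def by auto

lemma min_poly_degree_pos: 
  assumes "is_min_poly p x" shows "degree p > 0"
proof (rule ccontr)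
  assume "\<not> degree p > 0"
  then obtain c where c: "p = [:c:]" using degree_eq_zeroE[of p] by auto
  then show False using assms unfolding is_min_poly_def by auto
qed

text \<open>Write \<open>p = g h\<close> with \<open>g\<close> the gcd. The factor \<open>g\<close>
  cannot vanish at \<open>x\<close>, since \<open>p\<close> would then divide
  \<open>pderiv p\<close>, which is nonzero of smaller degree; so \<open>h\<close> vanishes at
  \<open>x\<close>, \<open>p\<close> divides \<open>h\<close>, and \<open>g\<close> is
  constant.\<close>

lemma min_poly_coprime_pderiv:
  assumes "is_min_poly p x" shows "coprime p (pderiv p)"
proof -
  define g where "g = gcd p (pderiv p)"
  obtain h where h: "p = g * h" unfolding g_def by (meson gcd_dvd1 dvdE)
  have p0: "p \<noteq> 0" using min_poly_nonzero assms by blast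
  have d0: "pderiv p \<noteq> 0" using min_poly_degree_pos[OF assms] by (simp add: pderiv_eq_0_iff)
  have "rat_eval g x * rat_eval h x = 0"
    using assms h unfolding is_min_poly_def by (metis rat_eval_mult)
  moreover have "rat_eval g x \<noteq> 0"
  proof
    assume "rat_eval g x = 0"
    then have "p dvd pderiv p" using min_poly_dvd_iff[OF assms] unfolding g_def
      by (meson dvd_trans gcd_dvd2)
    then have "degree p \<le> degree (pderiv p)" using d0 by (rule dvd_imp_degree_le)
    then show False using min_poly_degree_pos[OF assms] by (simp add: degree_pderiv)
  qed
  ultimately have "p dvd h" using min_poly_dvd_iff[OF assms] by simp
  moreover have "h \<noteq> 0" "g \<noteq> 0" using h p0 by auto
  ultimately have "degree g = 0"
    using dvd_imp_degree_le[of p h] h by (simp add: degree_mult_eq)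
  then have "is_unit g" using \<open>g \<noteq> 0\<close> by (simp add: is_unit_iff_degree)
  then show ?thesis unfolding g_def using is_unit_gcd by blast
qed

lemma coprime_rat_eval:
  assumes "coprime p q" "rat_eval p x = 0" shows "rat_eval q x \<noteq> 0"
proof
  assume "rat_eval q x = 0"
  obtain u v where "u * p + v * q = 1"
    using assms(1) bezout_coefficients_fst_snd[of p q] by (metis coprime_iff_gcd_eq_1)
  then have "rat_eval (u * p + v * q) x = 1" by simp
  then show False using assms(2) \<open>rat_eval q x = 0\<close> by (simp add: rat_eval_add rat_eval_mult)
qed

lemma min_poly_card_roots:
  assumes "is_min_poly p (x::'a::field_char_0)"
  shows "card {z::complex. rat_eval p z = 0} = degree p"
proof -
  let ?P = "map_poly of_rat p :: complex poly"
  have "rsquarefree ?P"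
    unfolding rsquarefree_roots of_rat_hom.map_poly_pderiv[symmetric] rat_eval_def[symmetric]
    using coprime_rat_eval[OF min_poly_coprime_pderiv[OF assms]] by blast
  moreover have "?P \<noteq> 0" using min_poly_nonzero[OF assms] by simp
  ultimately show ?thesis
    using rsquarefree_card_degree[of ?P] unfolding rat_eval_def by (simp add: degree_map_poly)
qed

lemma finite_rat_roots: "p \<noteq> 0 \<Longrightarrow> finite {z::'a::field_char_0. rat_eval p z = 0}"
  unfolding rat_eval_def by (rule poly_roots_finite) simp

text \<open>Writing the minimal polynomial as \<open>a + X r\<close>, minimality forces
  \<open>a \<noteq> 0\<close>, and then \<open>- r(x) / a\<close> is the inverse.\<close>

lemma rat_eval_inverse:
  fixes x :: "'a::field_char_0"
  assumes "q \<noteq> 0" "rat_eval q x = 0"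
  shows "\<exists>p. inverse x = rat_eval p x"
proof (cases "x = 0")
  case True
  then show ?thesis by (intro exI[of _ 0]) simp
next
  case False
  obtain p where p: "is_min_poly p x" using ex_min_poly[OF assms] .
  obtain a r where ar: "p = pCons a r" by (cases p) auto
  have "r \<noteq> 0" using min_poly_degree_pos[OF p] ar by auto
  have "a \<noteq> 0"
  proof
    assume "a = 0"
    then have "rat_eval r x = 0" using p ar False unfolding is_min_poly_def by auto
    then have "degree p \<le> degree r" using p \<open>r \<noteq> 0\<close> unfolding is_min_poly_def by blast
    then show False using ar \<open>r \<noteq> 0\<close> by simp
  qed
  have "of_rat a + x * rat_eval r x = 0" using p ar unfolding is_min_poly_def by auto
  then have "x * rat_eval r x = - of_rat a" by (simp add: add_eq_0_iff)
  then have "x * (of_rat (- inverse a) * rat_eval r x) = of_rat (- inverse a) * (- of_rat a)"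
    by (metis mult.left_commute)
  also have "\<dots> = of_rat (inverse a * a)" by (simp only: of_rat_mult of_rat_minus mult_minus_left mult_minus_right minus_minus)
  also have "\<dots> = 1" using \<open>a \<noteq> 0\<close> by simp
  finally have "inverse x = rat_eval (Polynomial.smult (- inverse a) r) x"
    unfolding rat_eval_smult by (rule inverse_unique)
  then show ?thesis by blast
qed

text \<open>Each reduction step subtracts a monomial multiple of the monic \<open>m\<close>, which
  stays inside the subring \<open>R\<close>. The intended \<open>R\<close> is the field generated by
  a candidate for a primitive element.\<close>

lemma coeffs_closed_mod:
  fixes m p :: "'a::field poly"
  assumes R: "0 \<in> R" "\<And>a b. a \<in> R \<Longrightarrow> b \<in> R \<Longrightarrow> a - b \<in> R" "\<And>a b. a \<in> R \<Longrightarrow> b \<in> R \<Longrightarrow> a * b \<in> R"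
    and m: "lead_coeff m = 1" "\<And>i. coeff m i \<in> R" and p: "\<And>i. coeff p i \<in> R"
  shows "coeff (p mod m) i \<in> R"
  using p
proof (induction "degree p" arbitrary: p rule: less_induct)
  case less
  show ?case
  proof (cases "degree p < degree m")
    case True
    then show ?thesis using less.prems by (simp add: mod_poly_less)
  next
    case False
    define p' where "p' = p - monom (lead_coeff p) (degree p - degree m) * m"
    have c: "coeff p' i = coeff p i - (if i < degree p - degree m then 0 else lead_coeff p * coeff m (i - (degree p - degree m)))" for i
      unfolding p'_def by (simp add: coeff_monom_mult)
    have cR: "coeff p' i \<in> R" for i
      unfolding c using less.prems m R by auto
    have mod: "p' mod m = p mod m" unfolding p'_def by (metis mod_mult_self4 diff_add_cancel mult.commute mod_add_self2 mod_mult_self1 add.commute)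
    have "degree p' < degree p \<or> p' = 0"
    proof (rule disjCI)
      assume nz: "p' \<noteq> 0"
      have "degree p' \<le> degree p"
      proof (rule degree_le, intro allI impI)
        fix i assume "degree p < i"
        then show "coeff p' i = 0" using False by (simp add: c coeff_eq_0)
      qed
      moreover have "coeff p' (degree p) = 0" using False m by (simp add: c)
      ultimately show "degree p' < degree p" using nz by (metis leading_coeff_0_iff nat_less_le)
    qed
    then show ?thesis
    proof
      assume "degree p' < degree p"
      then show ?thesis using less.hyps cR mod by metis
    next
      assume "p' = 0"
      then show ?thesis using mod R(1) by (metis coeff_0 mod_0)
    qed
  qed
qed

text \<open>Finiteness of \<open>S\<close> is what makes the pigeonhole argument for primitive
  elements possible. A nonconstant divisor of least degree is prime; any divisor of \<open>G\<close>
  that it does not divide is already a divisor of the cofactor.\<close>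

lemma finite_prime_divisors:
  fixes G :: "'a::field poly"
  assumes "G \<noteq> 0"
  shows "\<exists>S. finite S \<and> (\<forall>\<pi>\<in>S. prime_elem \<pi>) \<and> (\<forall>u. u dvd G \<and> degree u > 0 \<longrightarrow> (\<exists>\<pi>\<in>S. \<pi> dvd u))"
  using assms
proof (induction "degree G" arbitrary: G rule: less_induct)
  case less
  show ?case
  proof (cases "degree G = 0")
    case True
    then show ?thesis using dvd_imp_degree_le[OF _ less.prems] by (intro exI[of _ "{}"]) fastforce
  next
    case False
    define P where "P = (\<lambda>u. u dvd G \<and> degree u > 0)"
    obtain \<pi> where pi: "P \<pi>" "\<And>q. P q \<Longrightarrow> degree \<pi> \<le> degree q"
      using ex_has_least_nat[of P G degree] False unfolding P_def by auto
    have pi0: "\<pi> \<noteq> 0" using pi less.prems unfolding P_def by auto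
    have "irreducible \<pi>"
    proof (rule irreducibleI)
      show "\<pi> \<noteq> 0" by fact
      show "\<not> is_unit \<pi>" using pi pi0 unfolding P_def by (simp add: is_unit_iff_degree)
      fix a b assume ab: "\<pi> = a * b"
      then have nz: "a \<noteq> 0" "b \<noteq> 0" using pi0 by auto
      have deg: "degree \<pi> = degree a + degree b" using ab nz by (simp add: degree_mult_eq)
      have "a dvd G" using ab pi unfolding P_def by (metis dvd_mult_left)
      then have "degree a = 0 \<or> degree b = 0" using pi(2)[of a] deg unfolding P_def by linarith
      then show "is_unit a \<or> is_unit b" using nz by (simp add: is_unit_iff_degree)
    qed
    then have prime: "prime_elem \<pi>" by (rule field_poly_irreducible_imp_prime)
    obtain G2 where G2: "G = \<pi> * G2" using pi unfolding P_def by (auto elim: dvdE)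
    have "G2 \<noteq> 0" using G2 less.prems by auto
    then have "degree G2 < degree G" using G2 pi pi0 unfolding P_def by (simp add: degree_mult_eq)
    then obtain S where "finite S \<and> (\<forall>\<pi>\<in>S. prime_elem \<pi>) \<and>
        (\<forall>u. u dvd G2 \<and> degree u > 0 \<longrightarrow> (\<exists>\<pi>\<in>S. \<pi> dvd u))"
      using less.hyps[OF _ \<open>G2 \<noteq> 0\<close>] by auto
    then have Pi: "finite S" "\<forall>\<pi>\<in>S. prime_elem \<pi>"
        "\<And>u. u dvd G2 \<Longrightarrow> degree u > 0 \<Longrightarrow> (\<exists>\<pi>\<in>S. \<pi> dvd u)" by auto
    have "\<exists>\<pi>'\<in>insert \<pi> S. \<pi>' dvd u" if u: "u dvd G" "degree u > 0" for u
    proof (cases "\<pi> dvd u")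
      case False
      have "u dvd \<pi> * G2" using u G2 by simp
      then obtain w where w: "\<pi> * G2 = u * w" by (rule dvdE)
      then have "\<pi> dvd w" using False prime by (metis dvd_triv_left prime_elem_dvd_mult_iff)
      then obtain w' where "w = \<pi> * w'" by (rule dvdE)
      then have "G2 = u * w'" using w pi0 by (metis mult.left_commute mult_cancel_left)
      then show ?thesis using Pi(3)[of u] u by auto
    qed auto
    then show ?thesis using Pi prime by (intro exI[of _ "insert \<pi> S"]) auto
  qed
qed

lemma poly_mod_sum: "(\<Sum>i\<in>A. f i) mod (m::'a::field poly) = (\<Sum>i\<in>A. f i mod m)"
  by (induction A rule: infinite_finite_induct) (auto simp: poly_mod_add_left)

text \<open>Modulo \<open>\<pi>\<close>, \<open>F(t Y)\<close> is a polynomial in \<open>t\<close>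
  with coefficients \<open>C i mod \<pi>\<close>. Infinitely many zeros \<open>t\<close> make every
  coefficient vanish, and the top one is \<open>Y ^ degree F\<close>.\<close>

lemma dvd_pcompose_infinite:
  fixes F Y \<pi> :: "'a::field_char_0 poly"
  assumes inf: "infinite T" and dvd: "\<And>t. t \<in> T \<Longrightarrow> \<pi> dvd pcompose F (Polynomial.smult (of_nat t) Y)"
    and F: "lead_coeff F = 1"
  shows "\<pi> dvd Y ^ degree F"
proof -
  define C where "C i = Polynomial.smult (coeff F i) (Y ^ i)" for i
  have exp: "pcompose F (Polynomial.smult s Y) = (\<Sum>i\<le>degree F. Polynomial.smult (s ^ i) (C i))" for s
    unfolding pcompose_altdef poly_altdef C_def
    by (intro sum.cong) (auto simp: degree_map_poly coeff_map_poly smult_power)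
  have "coeff (C i mod \<pi>) j = 0" if i: "i \<le> degree F" for i j
  proof -
    define r where "r = (\<Sum>i\<le>degree F. monom (coeff (C i mod \<pi>) j) i)"
    have "poly r (of_nat t) = 0" if "t \<in> T" for t
    proof -
      have "0 = pcompose F (Polynomial.smult (of_nat t) Y) mod \<pi>" using dvd[OF that] by simp
      also have "\<dots> = (\<Sum>i\<le>degree F. Polynomial.smult (of_nat t ^ i) (C i mod \<pi>))"
        unfolding exp poly_mod_sum by (simp add: mod_smult_left)
      finally have "coeff (\<Sum>i\<le>degree F. Polynomial.smult (of_nat t ^ i) (C i mod \<pi>)) j = 0" by simp
      then show ?thesis unfolding r_def by (simp add: poly_sum poly_monom coeff_sum mult.commute)
    qed
    then have "of_nat ` T \<subseteq> {x. poly r x = 0}" by auto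
    moreover have "infinite (of_nat ` T :: 'a set)"
      using inf by (simp add: finite_image_iff inj_on_def)
    ultimately have "infinite {x. poly r x = 0}" using finite_subset by blast
    then have "r = 0" using poly_roots_finite[of r] by blast
    then have "coeff r i = 0" by simp
    then show ?thesis using i unfolding r_def by (simp add: coeff_sum)
  qed
  then have "coeff (C (degree F) mod \<pi>) j = coeff 0 j" for j by simp
  then have "C (degree F) mod \<pi> = 0" by (rule poly_eqI)
  then have "\<pi> dvd C (degree F)" by (simp only: mod_eq_0_iff_dvd)
  then show ?thesis using F unfolding C_def by simp
qed

text \<open>
  Otherwise the minimal polynomial of \<open>\<beta>\<close> over each field \<open>\<rat>(\<alpha> + t\<beta>)\<close> has degree at least 2; it divides the minimal
  polynomial \<open>g\<close> of \<open>\<beta>\<close> over the rationals as well as \<open>f(\<alpha> + t(\<beta> - X))\<close>. Some prime factor \<open>\<pi>\<close> of \<open>g/(X - \<beta>)\<close> divides the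
  latter for infinitely many \<open>t\<close>, hence it divides the top coefficient \<open>(\<beta> - X)^deg f\<close> with respect to \<open>t\<close>, although
  \<open>g\<close> has no multiple roots.
\<close>

lemma primitive_element_pair:
  fixes \<alpha> \<beta> :: "'a::field_char_0"
  assumes alg: "\<And>x::'a. \<exists>p. p \<noteq> 0 \<and> rat_eval p x = 0"
  shows "\<exists>t p q. \<alpha> = rat_eval p (\<alpha> + of_nat t * \<beta>) \<and> \<beta> = rat_eval q (\<alpha> + of_nat t * \<beta>)"
proof (rule ccontr)
  assume neg: "\<not> ?thesis"
  define \<theta> where "\<theta> t = \<alpha> + of_nat t * \<beta>" for t
  \<comment> \<open>\<open>R t\<close> is the field generated by \<open>\<theta> t\<close> over the
    rationals; closure under inverses comes from algebraicity.\<close>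
  define R where "R t = range (\<lambda>p. rat_eval p (\<theta> t))" for t
  have R_rat: "of_rat r \<in> R t" for r t
    unfolding R_def by (intro image_eqI[of _ _ "[:r:]"]) auto
  have R_th: "\<theta> t \<in> R t" for t
    unfolding R_def by (intro image_eqI[of _ _ "[:0,1:]"]) auto
  have R_add: "a + b \<in> R t" and R_diff: "a - b \<in> R t" and R_mult: "a * b \<in> R t"
    if "a \<in> R t" "b \<in> R t" for a b t
    using that unfolding R_def by (auto simp flip: rat_eval_add rat_eval_diff rat_eval_mult)
  have R_inv: "inverse a \<in> R t" if "a \<in> R t" for a t
  proof -
    obtain p where "inverse a = rat_eval p a" using alg[of a] rat_eval_inverse by blast
    then show ?thesis using that unfolding R_def by (auto simp flip: rat_eval_pcompose)
  qed
  have R_nat: "of_nat k \<in> R t" for k t using R_rat[of "of_nat k" t] by simp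
  have notin: "\<beta> \<notin> R t" for t
  proof
    assume b: "\<beta> \<in> R t"
    then have "\<theta> t - of_nat t * \<beta> \<in> R t" using R_diff R_mult R_th R_nat by blast
    then have "\<alpha> \<in> R t" by (simp add: \<theta>_def)
    then show False using neg b unfolding R_def \<theta>_def by blast
  qed
  obtain f where f: "is_min_poly f \<alpha>" using alg[of \<alpha>] ex_min_poly by blast
  obtain g where g: "is_min_poly g \<beta>" using alg[of \<beta>] ex_min_poly by blast
  define F :: "'a poly" where "F = map_poly of_rat f"
  define G :: "'a poly" where "G = map_poly of_rat g"
  have F1: "lead_coeff F = 1" using f unfolding F_def is_min_poly_def by (simp add: degree_map_poly coeff_map_poly)
  have G1: "lead_coeff G = 1" using g unfolding G_def is_min_poly_def by (simp add: degree_map_poly coeff_map_poly)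
  have Fa: "poly F \<alpha> = 0" using f unfolding F_def is_min_poly_def rat_eval_def by simp
  have Gb: "poly G \<beta> = 0" using g unfolding G_def is_min_poly_def rat_eval_def by simp
  then obtain H where H: "G = [:-\<beta>, 1:] * H" unfolding poly_eq_0_iff_dvd by (rule dvdE)
  \<comment> \<open>The derivative of \<open>G\<close> at \<open>\<beta>\<close> equals
    \<open>H(\<beta>)\<close>, so simplicity of the root means that \<open>H\<close> does not vanish
    there.\<close>
  have "poly (pderiv G) \<beta> \<noteq> 0"
    using coprime_rat_eval[OF min_poly_coprime_pderiv[OF g]] g
    unfolding G_def is_min_poly_def rat_eval_def of_rat_hom.map_poly_pderiv by blast
  then have Hb: "poly H \<beta> \<noteq> 0" unfolding H by (simp add: pderiv_diff pderiv_smult pderiv_pCons)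
  then have H0: "H \<noteq> 0" by auto
  have ex_u: "\<exists>u. degree u > 0 \<and> u dvd H \<and> u dvd pcompose F [:\<theta> t, - of_nat t:]" for t
  proof -
    \<comment> \<open>Among the polynomials satisfying \<open>P\<close>, one of least degree is the
      minimal polynomial of \<open>\<beta>\<close> over \<open>R t\<close>. Its quotient
      \<open>u\<close> by \<open>X - \<beta>\<close> is not constant because
      \<open>\<beta> \<notin> R t\<close>.\<close>
    define P where "P m \<longleftrightarrow> lead_coeff m = 1 \<and> (\<forall>i. coeff m i \<in> R t) \<and> poly m \<beta> = 0" for m
    have "P G" unfolding P_def using G1 Gb R_rat by (auto simp: G_def coeff_map_poly)
    then obtain m where m: "P m" "\<And>q. P q \<Longrightarrow> degree m \<le> degree q"
      using ex_has_least_nat[of P G degree] by blast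
    have dvd: "m dvd p" if p: "\<And>i. coeff p i \<in> R t" "poly p \<beta> = 0" for p
    proof (rule ccontr)
      assume "\<not> m dvd p"
      define r where "r = p mod m"
      have r0: "r \<noteq> 0" using \<open>\<not> m dvd p\<close> unfolding r_def by (simp add: mod_eq_0_iff_dvd)
      have "m \<noteq> 0" using m unfolding P_def by auto
      have rR: "coeff r i \<in> R t" for i
        unfolding r_def
      proof (rule coeffs_closed_mod)
        show "0 \<in> R t" using R_nat[of 0 t] by simp
        show "lead_coeff m = 1" "coeff m i \<in> R t" for i using m(1) unfolding P_def by auto
      qed (rule R_diff R_mult p(1); assumption?)+
      have "poly r \<beta> = 0"
      proof -
        have "r = p - p div m * m" unfolding r_def by (simp add: minus_div_mult_eq_mod)
        then show ?thesis using p m unfolding P_def by simp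
      qed
      then have "P (Polynomial.smult (inverse (lead_coeff r)) r)"
        unfolding P_def using r0 rR R_inv R_mult by simp
      then have "degree m \<le> degree r" using m(2)[of "Polynomial.smult (inverse (lead_coeff r)) r"] r0 by simp
      moreover have "degree r < degree m"
        using degree_mod_less[OF \<open>m \<noteq> 0\<close>, of p] r0 unfolding r_def by simp
      ultimately show False by simp
    qed
    have "[:-\<beta>, 1:] dvd m" using m(1) poly_eq_0_iff_dvd unfolding P_def by blast
    then obtain u where u: "m = [:-\<beta>, 1:] * u" by (rule dvdE)
    have u0: "u \<noteq> 0" using u m(1) unfolding P_def by auto
    have "degree u > 0"
    proof (rule ccontr)
      assume "\<not> degree u > 0"
      then obtain c where c: "u = [:c:]" using degree_eq_zeroE[of u] by auto
      have "c = 1" using m(1) u0 unfolding P_def u c by simp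
      then have "coeff m 0 = - \<beta>" unfolding u c by simp
      then have "- \<beta> \<in> R t" using m(1) unfolding P_def by metis
      then have "of_nat 0 - (- \<beta>) \<in> R t" using R_diff R_nat by blast
      then show False using notin by simp
    qed
    moreover have "u dvd H"
    proof -
      have "m dvd G" using dvd[of G] Gb R_rat by (auto simp: G_def coeff_map_poly)
      then show ?thesis unfolding u H dvd_mult_cancel_left by simp
    qed
    moreover have "u dvd pcompose F [:\<theta> t, - of_nat t:]"
    proof -
      have "coeff (pcompose F [:\<theta> t, - of_nat t:]) i \<in> R t" for i
        unfolding F_def
      proof (induction f arbitrary: i)
        case 0
        then show ?case using R_nat[of 0 t] by simp
      next
        case (pCons a p)
        have z: "0 \<in> R t" using R_nat[of 0 t] by simp
        have "coeff (pcompose (map_poly of_rat (pCons a p)) [:\<theta> t, - of_nat t:]) i =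
          (if i = 0 then of_rat a else 0) + (\<theta> t * coeff (pcompose (map_poly of_rat p) [:\<theta> t, - of_nat t:]) i
           + (0 - of_nat t) * (if i = 0 then 0 else coeff (pcompose (map_poly of_rat p) [:\<theta> t, - of_nat t:]) (i - 1)))"
          by (cases i) (auto simp: of_rat_hom.map_poly_pCons_hom pcompose_pCons)
        also have "\<dots> \<in> R t"
        proof (intro R_add R_mult R_diff)
          show "(if i = 0 then of_rat a else 0) \<in> R t" using R_rat z by simp
          show "(if i = 0 then 0 else coeff (pcompose (map_poly of_rat p) [:\<theta> t, - of_nat t:]) (i - 1)) \<in> R t"
            using pCons.IH[of "i - 1"] z by simp
        qed (rule R_th pCons.IH z R_nat)+
        finally show ?case .
      qed
      moreover have "poly (pcompose F [:\<theta> t, - of_nat t:]) \<beta> = 0"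
        using Fa by (simp add: poly_pcompose \<theta>_def algebra_simps)
      ultimately have "m dvd pcompose F [:\<theta> t, - of_nat t:]" using dvd by blast
      then show ?thesis unfolding u using dvd_mult_right by blast
    qed
    ultimately show ?thesis by blast
  qed
  then have "\<exists>u. \<forall>t. degree (u t) > 0 \<and> u t dvd H \<and> u t dvd pcompose F [:\<theta> t, - of_nat t:]"
    by (intro choice allI)
  then obtain u where u: "\<And>t. degree (u t) > 0" "\<And>t. u t dvd H"
      "\<And>t. u t dvd pcompose F [:\<theta> t, - of_nat t:]" by blast
  obtain S where S: "finite S" "\<forall>\<pi>\<in>S. prime_elem \<pi>" "\<forall>u. u dvd H \<and> degree u > 0 \<longrightarrow> (\<exists>\<pi>\<in>S. \<pi> dvd u)"
    using finite_prime_divisors[OF H0] by (elim exE conjE)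
  have "\<exists>\<pi>. \<pi> \<in> S \<and> \<pi> dvd u t" for t
    using S(3)[rule_format, of "u t"] u(1)[of t] u(2)[of t] by blast
  then have "\<exists>\<pi>. \<forall>t. \<pi> t \<in> S \<and> \<pi> t dvd u t" by (intro choice allI)
  then obtain \<pi> where pi: "\<And>t. \<pi> t \<in> S" "\<And>t. \<pi> t dvd u t" by blast
  have "finite (\<pi> ` UNIV)" using pi(1) S(1) by (meson finite_subset image_subsetI)
  then obtain t0 where t0: "infinite {t \<in> UNIV. \<pi> t = \<pi> t0}"
    using pigeonhole_infinite[of UNIV \<pi>] by auto
  define Y :: "'a poly" where "Y = [:\<beta>, -1:]"
  have "\<pi> t0 dvd Y ^ degree (pcompose F [:\<alpha>, 1:])"
  proof (rule dvd_pcompose_infinite[OF t0])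
    fix t assume "t \<in> {t \<in> UNIV. \<pi> t = \<pi> t0}"
    then have "\<pi> t0 dvd pcompose F [:\<theta> t, - of_nat t:]" using pi(2)[of t] u(3)[of t] by (auto intro: dvd_trans)
    \<comment> \<open>Both sides are \<open>F\<close> at
      \<open>\<alpha> + t (\<beta> - X) = \<theta> t - t X\<close>.\<close>
    moreover have "pcompose (pcompose F [:\<alpha>, 1:]) (Polynomial.smult (of_nat t) Y) = pcompose F [:\<theta> t, - of_nat t:]"
      by (simp add: pcompose_assoc[symmetric] pcompose_pCons Y_def \<theta>_def)
    ultimately show "\<pi> t0 dvd pcompose (pcompose F [:\<alpha>, 1:]) (Polynomial.smult (of_nat t) Y)" by simp
  next
    show "lead_coeff (pcompose F [:\<alpha>, 1:]) = 1" by (subst lead_coeff_comp) (use F1 in auto)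
  qed
  then have "\<pi> t0 dvd Y" using S(2) pi(1) prime_elem_dvd_power by blast
  \<comment> \<open>\<open>Y\<close> is linear, so the prime \<open>\<pi> t0\<close> is a constant
    multiple of it and vanishes at \<open>\<beta>\<close>; being a divisor of \<open>H\<close>, it
    must not.\<close>
  then obtain w where w: "Y = \<pi> t0 * w" by (rule dvdE)
  have "\<not> is_unit (\<pi> t0)" "\<pi> t0 \<noteq> 0" using S(2) pi(1) by (auto simp: prime_elem_def)
  then have "degree (\<pi> t0) > 0" by (simp add: is_unit_iff_degree)
  moreover have "w \<noteq> 0" using w by (auto simp: Y_def)
  moreover have "degree Y = 1" by (simp add: Y_def)
  ultimately have "degree w = 0" using w \<open>\<pi> t0 \<noteq> 0\<close> by (simp add: degree_mult_eq)
  then obtain c where c: "w = [:c:]" by (rule degree_eq_zeroE)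
  have "c \<noteq> 0" using c \<open>w \<noteq> 0\<close> by auto
  have "poly (\<pi> t0) \<beta> * c = poly Y \<beta>" unfolding w c by simp
  then have "poly (\<pi> t0) \<beta> = 0" using \<open>c \<noteq> 0\<close> by (simp add: Y_def)
  moreover have "\<pi> t0 dvd H" using pi(2)[of t0] u(2)[of t0] by (rule dvd_trans)
  ultimately show False using Hb by (auto elim: dvdE)
qed

definition primitive_elt :: "'a::field_char_0 \<Rightarrow> bool" where
  "primitive_elt \<theta> \<longleftrightarrow> (\<forall>x. \<exists>p. x = rat_eval p \<theta>)"

theorem primitive_element:
  assumes nf: "number_field TYPE('a::field_char_0)"
  obtains \<theta> :: "'a::field_char_0" where "primitive_elt \<theta>"
proof -
  obtain B :: "'a set" where B: "finite B" "\<And>x. \<exists>c. x = (\<Sum>b\<in>B. of_rat (c b) * b)"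
    using nf unfolding number_field_def by auto
  have "\<exists>\<theta>. \<forall>b\<in>S. \<exists>p. b = rat_eval p \<theta>" if "finite S" for S :: "'a set"
    using that
  proof (induction rule: finite_induct)
    case (insert b S)
    then obtain \<alpha> where a: "\<forall>b\<in>S. \<exists>p. b = rat_eval p \<alpha>" by blast
    obtain t p q where pq: "\<alpha> = rat_eval p (\<alpha> + of_nat t * b)" "b = rat_eval q (\<alpha> + of_nat t * b)"
      using primitive_element_pair[OF number_field_algebraic[OF nf]] by blast
    have "\<exists>p. x = rat_eval p (\<alpha> + of_nat t * b)" if "x \<in> S" for x
      using a that pq(1) rat_eval_pcompose by metis
    then show ?case using pq(2) by blast
  qed auto
  then obtain \<theta> P where P: "\<And>b. b \<in> B \<Longrightarrow> b = rat_eval (P b) \<theta>" using B(1) by metis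
  have "\<exists>p. x = rat_eval p \<theta>" for x
  proof -
    obtain c where "x = (\<Sum>b\<in>B. of_rat (c b) * b)" using B(2) by blast
    also have "\<dots> = (\<Sum>b\<in>B. of_rat (c b) * rat_eval (P b) \<theta>)" using P by (intro sum.cong) auto
    also have "\<dots> = rat_eval (\<Sum>b\<in>B. Polynomial.smult (c b) (P b)) \<theta>"
      by (simp add: rat_eval_sum rat_eval_smult)
    finally show ?thesis by blast
  qed
  then show ?thesis using that unfolding primitive_elt_def by blast
qed

section \<open>Complex embeddings\<close>

lemma emb_add: "\<sigma> \<in> complex_embeddings \<Longrightarrow> \<sigma> (x + y) = \<sigma> x + \<sigma> y"
  and emb_mult: "\<sigma> \<in> complex_embeddings \<Longrightarrow> \<sigma> (x * y) = \<sigma> x * \<sigma> y"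
  and emb_1: "\<sigma> \<in> complex_embeddings \<Longrightarrow> \<sigma> 1 = 1"
  unfolding complex_embeddings_def by auto

lemma emb_0: "\<sigma> \<in> complex_embeddings \<Longrightarrow> \<sigma> 0 = 0"
  using emb_add[of \<sigma> 0 0] by simp

lemma emb_minus: "\<sigma> \<in> complex_embeddings \<Longrightarrow> \<sigma> (- x) = - \<sigma> x"
  using emb_add[of \<sigma> x "- x"] emb_0[of \<sigma>] by (simp add: eq_neg_iff_add_eq_0 add.commute)

lemma emb_diff: "\<sigma> \<in> complex_embeddings \<Longrightarrow> \<sigma> (x - y) = \<sigma> x - \<sigma> y"
  using emb_add[of \<sigma> x "- y"] emb_minus[of \<sigma> y] by simp

lemma emb_of_nat: "\<sigma> \<in> complex_embeddings \<Longrightarrow> \<sigma> (of_nat k) = of_nat k"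
  by (induction k) (auto simp: emb_0 emb_add emb_1)

lemma emb_of_int: "\<sigma> \<in> complex_embeddings \<Longrightarrow> \<sigma> (of_int k) = of_int k"
  by (cases k rule: int_cases2) (auto simp: emb_of_nat emb_minus)

lemma emb_eq_0_iff: 
  assumes "\<sigma> \<in> complex_embeddings" shows "\<sigma> x = 0 \<longleftrightarrow> x = 0"
proof
  assume "\<sigma> x = 0"
  show "x = 0"
  proof (rule ccontr)
    assume "x \<noteq> 0"
    then have "\<sigma> x * \<sigma> (inverse x) = 1" using emb_mult[OF assms, of x "inverse x"] emb_1[OF assms] by simp
    then show False using \<open>\<sigma> x = 0\<close> by simp
  qed
qed (simp add: emb_0 assms)

lemma emb_of_rat: 
  assumes s: "\<sigma> \<in> complex_embeddings" shows "\<sigma> (of_rat r) = of_rat r"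
proof (cases r)
  case (Fract a b)
  have "\<sigma> (of_rat r) * of_int b = \<sigma> (of_rat r * of_int b)" by (simp add: emb_mult[OF s] emb_of_int[OF s])
  also have "\<dots> = of_int a" using Fract by (simp add: of_rat_rat emb_of_int[OF s])
  also have "\<dots> = of_rat r * of_int b" using Fract by (simp add: of_rat_rat)
  finally show ?thesis using Fract by simp
qed

lemma emb_sum: "\<sigma> \<in> complex_embeddings \<Longrightarrow> \<sigma> (\<Sum>i\<in>A. f i) = (\<Sum>i\<in>A. \<sigma> (f i))"
  by (induction A rule: infinite_finite_induct) (auto simp: emb_0 emb_add)

lemma emb_power: "\<sigma> \<in> complex_embeddings \<Longrightarrow> \<sigma> (x ^ n) = \<sigma> x ^ n"
  by (induction n) (auto simp: emb_1 emb_mult)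

lemma emb_rat_eval: "\<sigma> \<in> complex_embeddings \<Longrightarrow> \<sigma> (rat_eval p x) = rat_eval p (\<sigma> x)"
  by (induction p) (auto simp: emb_0 emb_add emb_mult emb_of_rat)

lemma poly_of_int_rat_eval: "poly (map_poly of_int p) x = rat_eval (map_poly of_int p) x"
  unfolding rat_eval_def by (simp add: map_poly_map_poly o_def)

lemma emb_alg_int_iff:
  assumes "\<sigma> \<in> complex_embeddings" shows "alg_int (\<sigma> x) \<longleftrightarrow> alg_int x"
  unfolding alg_int_def poly_of_int_rat_eval emb_rat_eval[OF assms, symmetric] emb_eq_0_iff[OF assms] ..

lemma primitive_imp_inj:
  assumes "primitive_elt \<theta>" shows "inj_on (\<lambda>\<sigma>. \<sigma> \<theta>) complex_embeddings"
proof (rule inj_onI)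
  fix \<sigma> \<tau> :: "'a \<Rightarrow> complex" assume st: "\<sigma> \<in> complex_embeddings" "\<tau> \<in> complex_embeddings" "\<sigma> \<theta> = \<tau> \<theta>"
  show "\<sigma> = \<tau>"
  proof
    fix x obtain p where "x = rat_eval p \<theta>" using assms unfolding primitive_elt_def by blast
    then show "\<sigma> x = \<tau> x" using st by (simp add: emb_rat_eval)
  qed
qed

text \<open>For a root \<open>z\<close>, the embedding sends the value of a rational polynomial at
  \<open>\<theta>\<close> to its value at \<open>z\<close>. This is well defined because two
  polynomials with equal value at \<open>\<theta>\<close> differ by a multiple of
  \<open>m\<close>.\<close>

lemma embeddings_bij_roots:
  assumes prim: "primitive_elt \<theta>" and m: "is_min_poly m \<theta>"
  shows "bij_betw (\<lambda>\<sigma>. \<sigma> \<theta>) complex_embeddings {z::complex. rat_eval m z = 0}"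
  unfolding bij_betw_def
proof
  show "inj_on (\<lambda>\<sigma>. \<sigma> \<theta>) complex_embeddings" by (rule primitive_imp_inj[OF prim])
  show "(\<lambda>\<sigma>. \<sigma> \<theta>) ` complex_embeddings = {z. rat_eval m z = 0}"
  proof (intro equalityI subsetI)
    fix z assume "z \<in> (\<lambda>\<sigma>. \<sigma> \<theta>) ` complex_embeddings"
    then obtain \<sigma> where s: "\<sigma> \<in> complex_embeddings" "z = \<sigma> \<theta>" by auto
    have "rat_eval m (\<sigma> \<theta>) = \<sigma> (rat_eval m \<theta>)" by (simp add: emb_rat_eval s)
    then show "z \<in> {z. rat_eval m z = 0}" using m s unfolding is_min_poly_def by (simp add: emb_0)
  next
    fix z :: complex assume "z \<in> {z. rat_eval m z = 0}"
    then have z: "rat_eval m z = 0" by simp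
    obtain P where P: "\<And>x. x = rat_eval (P x) \<theta>" using prim unfolding primitive_elt_def by metis
    have eq: "rat_eval p z = rat_eval q z" if "rat_eval p \<theta> = rat_eval q \<theta>" for p q
    proof -
      have "m dvd p - q" using min_poly_dvd_iff[OF m, of "p - q"] that by (simp add: rat_eval_diff)
      then have "rat_eval (p - q) z = 0" using z by (auto elim!: dvdE simp: rat_eval_mult)
      then show ?thesis by (simp add: rat_eval_diff)
    qed
    define \<sigma> where "\<sigma> x = rat_eval (P x) z" for x
    have s: "\<sigma> (rat_eval p \<theta>) = rat_eval p z" for p
      unfolding \<sigma>_def by (rule eq) (use P in metis)
    have "\<sigma> (x + y) = \<sigma> x + \<sigma> y" "\<sigma> (x * y) = \<sigma> x * \<sigma> y" for x y
      using s[of "P x + P y"] s[of "P x * P y"] P[of x] P[of y]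
      by (simp_all add: rat_eval_add rat_eval_mult \<sigma>_def)
    moreover have "\<sigma> 1 = 1" using s[of 1] by simp
    ultimately have "\<sigma> \<in> complex_embeddings" unfolding complex_embeddings_def by blast
    moreover have "\<sigma> \<theta> = z" using s[of "[:0,1:]"] by simp
    ultimately show "z \<in> (\<lambda>\<sigma>. \<sigma> \<theta>) ` complex_embeddings" by blast
  qed
qed

lemma card_embeddings_eq_degree:
  fixes \<theta> :: "'a::field_char_0"
  assumes "primitive_elt \<theta>" "is_min_poly m \<theta>"
  shows "card (complex_embeddings :: ('a \<Rightarrow> complex) set) = degree m"
  using bij_betw_same_card[OF embeddings_bij_roots[OF assms]] min_poly_card_roots[OF assms(2)] by simp

lemma number_field_ex_min_poly:
  fixes x :: "'a::field_char_0"
  assumes "number_field TYPE('a)"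
  obtains m where "is_min_poly m x"
  using number_field_algebraic[OF assms, of x] ex_min_poly by blast

lemma finite_embeddings:
  assumes "number_field TYPE('a::field_char_0)"
  shows "finite (complex_embeddings :: ('a::field_char_0 \<Rightarrow> complex) set)"
    and "card (complex_embeddings :: ('a::field_char_0 \<Rightarrow> complex) set) > 0"
proof -
  obtain \<theta> :: 'a where th: "primitive_elt \<theta>" using primitive_element[OF assms] .
  obtain m where m: "is_min_poly m \<theta>" using number_field_ex_min_poly[OF assms] .
  show c: "card (complex_embeddings :: ('a \<Rightarrow> complex) set) > 0"
    using card_embeddings_eq_degree[OF th m] min_poly_degree_pos[OF m] by simp
  then show "finite (complex_embeddings :: ('a \<Rightarrow> complex) set)" by (rule card_ge_0_finite)
qed

text \<open>A nonzero rational relation of degree below \<open>n\<close> for \<open>y\<close> would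
  have all \<open>n\<close> distinct conjugates of \<open>y\<close> as complex roots. So in a
  dependence among \<open>1, y, ..., y^(n-1), x\<close>, which exists because the dimension is at
  most \<open>n\<close>, the coefficient of \<open>x\<close> is nonzero.\<close>

lemma primitive_if_inj:
  fixes y :: "'a::field_char_0"
  assumes nf: "number_field TYPE('a)" and inj: "inj_on (\<lambda>\<sigma>. \<sigma> y) complex_embeddings"
  shows "primitive_elt y"
proof -
  obtain \<theta> :: 'a where th: "primitive_elt \<theta>" using primitive_element[OF nf] .
  obtain m where m: "is_min_poly m \<theta>" using number_field_ex_min_poly[OF nf] .
  define n where "n = degree m"
  have cardE: "card (complex_embeddings :: ('a \<Rightarrow> complex) set) = n"
    using card_embeddings_eq_degree[OF th m] n_def by simp
  have span: "Q.span ((\<lambda>i. \<theta> ^ i) ` {..<n}) = UNIV"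
  proof -
    have "x \<in> Q.span ((\<lambda>i. \<theta> ^ i) ` {..<n})" for x
    proof -
      obtain p where p: "x = rat_eval p \<theta>" using th unfolding primitive_elt_def by blast
      have "p mod m = p - p div m * m" by (simp add: minus_div_mult_eq_mod)
      then have "x = rat_eval (p mod m) \<theta>"
        using p m unfolding is_min_poly_def by (simp add: rat_eval_diff rat_eval_mult)
      also have "\<dots> = (\<Sum>i\<le>degree (p mod m). of_rat (coeff (p mod m) i) * \<theta> ^ i)" by (rule rat_eval_altdef)
      also have "\<dots> \<in> Q.span ((\<lambda>i. \<theta> ^ i) ` {..<n})"
      proof (intro Q.span_sum Q.span_scale Q.span_base imageI)
        fix i assume "i \<in> {..degree (p mod m)}"
        moreover have "degree (p mod m) < n"
          using degree_mod_less[OF min_poly_nonzero[OF m], of p] min_poly_degree_pos[OF m] unfolding n_def by auto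
        ultimately show "i \<in> {..<n}" by simp
      qed
      finally show ?thesis .
    qed
    then show ?thesis by blast
  qed
  show ?thesis unfolding primitive_elt_def
  proof
    fix x :: 'a
    have "card ((\<lambda>i. \<theta> ^ i) ` {..<n}) < card {..n}"
      using card_image_le[of "{..<n}" "\<lambda>i. \<theta> ^ i"] by simp
    \<comment> \<open>The index \<open>n\<close> stands for \<open>x\<close>, the smaller ones for
      the powers of \<open>y\<close>.\<close>
    then obtain c where c: "\<exists>i\<in>{..n}. c i \<noteq> 0"
       "(\<Sum>i\<le>n. of_rat (c i) * (if i = n then x else y ^ i)) = 0"
      using Q.dependent_family[of "(\<lambda>i. \<theta> ^ i) ` {..<n}" "\<lambda>i. if i = n then x else y ^ i" "{..n}"]
        span by auto
    define p where "p = (\<Sum>i<n. monom (c i) i)"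
    have cp: "coeff p i = (if i < n then c i else 0)" for i
      unfolding p_def by (simp add: coeff_sum)
    have rp: "rat_eval p y = (\<Sum>i<n. of_rat (c i) * y ^ i)"
      unfolding p_def by (simp add: rat_eval_sum rat_eval_monom)
    have eq: "rat_eval p y + of_rat (c n) * x = 0"
      using c(2) unfolding rp by (simp add: lessThan_Suc_atMost[symmetric])
    have "c n \<noteq> 0"
    proof
      assume c0: "c n = 0"
      then have "rat_eval p y = 0" using eq by simp
      have "p \<noteq> 0"
      proof
        assume "p = 0"
        then have "c i = 0" if "i < n" for i using cp[of i] that by simp
        then show False using c(1) c0 by (metis atMost_iff le_neq_implies_less)
      qed
      have "degree p < n \<or> n = 0" using cp by (metis \<open>p \<noteq> 0\<close> leading_coeff_0_iff)
      moreover have "n > 0" using min_poly_degree_pos[OF m] n_def by simp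
      moreover have "(\<lambda>\<sigma>. \<sigma> y) ` complex_embeddings \<subseteq> {z::complex. rat_eval p z = 0}"
        using \<open>rat_eval p y = 0\<close> by (auto simp: emb_rat_eval[symmetric] emb_0)
      then have "card ((\<lambda>\<sigma>. \<sigma> y) ` complex_embeddings) \<le> card {z::complex. rat_eval p z = 0}"
        by (intro card_mono finite_rat_roots \<open>p \<noteq> 0\<close>)
      then have "n \<le> card {z::complex. rat_eval p z = 0}"
        using card_image[OF inj] cardE by simp
      moreover have "card {z::complex. rat_eval p z = 0} \<le> degree p"
        unfolding rat_eval_def using \<open>p \<noteq> 0\<close> card_poly_roots_bound[of "map_poly of_rat p :: complex poly"] by (simp add: degree_map_poly)
      ultimately show False by simp
    qed
    then have "x = of_rat (- inverse (c n)) * rat_eval p y"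
      using eq by (simp add: of_rat_minus of_rat_inverse of_rat_divide field_simps add_eq_0_iff)
    then have "x = rat_eval (Polynomial.smult (- inverse (c n)) p) y"
      by (simp only: rat_eval_smult)
    then show "\<exists>p. x = rat_eval p y" by blast
  qed
qed

section \<open>Denominators and integral generators\<close>

lemma ex_common_denominator:
  fixes S :: "rat set"
  assumes "finite S"
  obtains N :: int where "N > 0" "\<And>r. r \<in> S \<Longrightarrow> of_int N * r \<in> \<int>"
proof -
  have "\<exists>N::int. N > 0 \<and> (\<forall>r\<in>S. of_int N * r \<in> \<int>)" using assms
  proof (induction rule: finite_induct)
    case (insert r S)
    then obtain N :: int where N: "N > 0" "\<forall>r\<in>S. of_int N * r \<in> \<int>" by auto
    obtain a b where r: "r = Rat.Fract a b" "b > 0" by (cases r) auto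
    have "of_int (N * b) * r = of_int (N * a)" using r by (simp add: Fract_of_int_quotient)
    then have "of_int (N * b) * r \<in> \<int>" by (simp only: Ints_of_int)
    moreover have "of_int (N * b) * s \<in> \<int>" if "s \<in> S" for s
    proof -
      have "of_int (N * b) * s = of_int b * (of_int N * s)" by simp
      then show ?thesis using N(2) that by (metis Ints_mult Ints_of_int)
    qed
    ultimately have "\<forall>s\<in>insert r S. of_int (N * b) * s \<in> \<int>" by blast
    then show ?case using N r by (intro exI[of _ "N * b"]) simp
  qed (auto intro: exI[of _ 1])
  then show ?thesis using that by blast
qed

lemma rat_poly_denominator:
  fixes p :: "rat poly"
  obtains N :: int and P :: "int poly" where "N > 0" "Polynomial.smult (of_int N) p = map_poly of_int P"
proof -
  obtain N :: int where N: "N > 0" "\<And>r. r \<in> set (coeffs p) \<Longrightarrow> of_int N * r \<in> \<int>"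
    using ex_common_denominator[of "set (coeffs p)"] by auto
  define P where "P = map_poly (\<lambda>r. \<lfloor>of_int N * r\<rfloor>) p"
  have "coeff (Polynomial.smult (of_int N) p) i = coeff (map_poly of_int P) i" for i
  proof (cases "coeff p i = 0")
    case False
    then have "coeff p i \<in> set (coeffs p)" by (metis coeff_0 coeff_in_coeffs le_degree)
    then have "of_int N * coeff p i \<in> \<int>" by (rule N(2))
    then show ?thesis by (auto simp: P_def coeff_map_poly elim: Ints_cases)
  qed (simp add: P_def coeff_map_poly)
  then show ?thesis using N(1) that by (blast intro: poly_eqI)
qed

text \<open>If \<open>N\<close> clears the denominators of the monic minimal polynomial, it becomes
  the leading coefficient of an integer polynomial with root \<open>x\<close>.\<close>

lemma alg_int_multiple:
  fixes x :: "'a::field_char_0"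
  assumes "number_field TYPE('a)"
  obtains N :: int where "N > 0" "alg_int (of_int N * x)"
proof -
  obtain m where m: "is_min_poly m x" using number_field_ex_min_poly[OF assms] .
  obtain N P where N: "N > 0" "Polynomial.smult (of_int N) m = map_poly of_int P"
    using rat_poly_denominator[of m] .
  define F :: "'a poly" where "F = map_poly of_int P"
  have cm: "of_int (coeff P i) = of_int N * coeff m i" for i
    using arg_cong[OF N(2), of "\<lambda>p. coeff p i"] by (simp add: coeff_map_poly)
  have "degree (map_poly of_int P :: rat poly) = degree m" using N by (metis degree_smult_eq less_irrefl of_int_eq_0_iff)
  then have dP: "degree P = degree m" by (simp add: degree_map_poly)
  then have dF: "degree F > 0" using min_poly_degree_pos[OF m] unfolding F_def by (simp add: degree_map_poly)
  have lm: "coeff m (degree m) = 1" using m unfolding is_min_poly_def by simp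
  have "(of_int (lead_coeff P) :: rat) = of_int N" unfolding cm dP lm by simp
  then have lF: "lead_coeff F = of_int N" unfolding F_def by (simp add: degree_map_poly coeff_map_poly)
  have "poly F x = rat_eval (Polynomial.smult (of_int N) m) x"
    unfolding F_def N(2) by (rule poly_of_int_rat_eval)
  also have "\<dots> = 0" using m unfolding is_min_poly_def by (simp add: rat_eval_smult)
  finally have "alg_int (lead_coeff F * x)"
    using dF by (intro alg_int_lead_coeff_root) (simp_all add: F_def coeff_map_poly)
  then show ?thesis using N that unfolding lF by blast
qed

lemma ex_integral_primitive:
  assumes nf: "number_field TYPE('a::field_char_0)"
  obtains \<theta> :: "'a::field_char_0" where "primitive_elt \<theta>" "alg_int \<theta>"
proof -
  obtain \<theta> :: 'a where th: "primitive_elt \<theta>" using primitive_element[OF nf] .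
  obtain N :: int where N: "N > 0" "alg_int (of_int N * \<theta>)" using alg_int_multiple[OF nf] .
  have "inj_on (\<lambda>\<sigma>. \<sigma> (of_int N * \<theta>)) complex_embeddings"
    using primitive_imp_inj[OF th] N(1) unfolding inj_on_def by (auto simp: emb_mult emb_of_int)
  then show ?thesis using that primitive_if_inj[OF nf] N(2) by blast
qed

text \<open>Shift a fixed integral primitive element by a natural number \<open>t\<close>, which
  keeps it primitive. A pair of distinct embeddings agrees on \<open>c * (\<theta> + t)\<close> for
  at most one \<open>t\<close>: two such \<open>t\<close> would give equal values at
  \<open>c\<close>, then at \<open>\<theta>\<close>. Only finitely many \<open>t\<close> are
  excluded.\<close>

lemma ex_primitive_multiplier:
  fixes c :: "'a::field_char_0"
  assumes nf: "number_field TYPE('a)" and c: "c \<noteq> 0"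
  obtains \<theta> where "primitive_elt \<theta>" "alg_int \<theta>" "primitive_elt (c * \<theta>)" "\<theta> \<noteq> 0"
proof -
  obtain \<theta> :: 'a where th: "primitive_elt \<theta>" "alg_int \<theta>" using ex_integral_primitive[OF nf] .
  let ?E = "complex_embeddings :: ('a \<Rightarrow> complex) set"
  define bad where "bad = (\<Union>(\<sigma>,\<tau>)\<in>{(\<sigma>,\<tau>). \<sigma> \<in> ?E \<and> \<tau> \<in> ?E \<and> \<sigma> \<noteq> \<tau>}. {t::nat. \<sigma> (c * (\<theta> + of_nat t)) = \<tau> (c * (\<theta> + of_nat t))})"
  have "finite bad" unfolding bad_def
  proof (rule finite_UN_I)
    show "finite {(\<sigma>,\<tau>). \<sigma> \<in> ?E \<and> \<tau> \<in> ?E \<and> \<sigma> \<noteq> \<tau>}"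
      by (rule finite_subset[of _ "?E \<times> ?E"]) (auto simp: finite_embeddings[OF nf])
    fix p assume "p \<in> {(\<sigma>,\<tau>). \<sigma> \<in> ?E \<and> \<tau> \<in> ?E \<and> \<sigma> \<noteq> \<tau>}"
    then obtain \<sigma> \<tau> where p: "p = (\<sigma>,\<tau>)" "\<sigma> \<in> ?E" "\<tau> \<in> ?E" "\<sigma> \<noteq> \<tau>" by auto
    have uniq: "s = t" if s: "\<sigma> (c * (\<theta> + of_nat s)) = \<tau> (c * (\<theta> + of_nat s))"
        and t: "\<sigma> (c * (\<theta> + of_nat t)) = \<tau> (c * (\<theta> + of_nat t))" for s t :: nat
    proof (rule ccontr)
      assume "s \<noteq> t"
      have e1: "\<sigma> c * (\<sigma> \<theta> + of_nat s) = \<tau> c * (\<tau> \<theta> + of_nat s)"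
        and e2: "\<sigma> c * (\<sigma> \<theta> + of_nat t) = \<tau> c * (\<tau> \<theta> + of_nat t)"
        using s t p by (simp_all add: emb_mult emb_add emb_of_nat)
      have "\<sigma> c * (of_nat s - of_nat t) = \<sigma> c * (\<sigma> \<theta> + of_nat s) - \<sigma> c * (\<sigma> \<theta> + of_nat t)" by (simp add: algebra_simps)
      also have "\<dots> = \<tau> c * (of_nat s - of_nat t)" unfolding e1 e2 by (simp add: algebra_simps)
      finally have "\<sigma> c = \<tau> c" using \<open>s \<noteq> t\<close> by simp
      moreover have "\<sigma> c \<noteq> 0" using emb_eq_0_iff[OF p(2)] c by simp
      ultimately have "\<sigma> \<theta> = \<tau> \<theta>" using e1 by simp
      then show False using primitive_imp_inj[OF th(1)] p unfolding inj_on_def by blast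
    qed
    let ?A = "{t::nat. \<sigma> (c * (\<theta> + of_nat t)) = \<tau> (c * (\<theta> + of_nat t))}"
    have "finite ?A"
    proof (cases "?A = {}")
      case False
      then obtain s where "s \<in> ?A" by blast
      then have "?A \<subseteq> {s}" using uniq by blast
      then show ?thesis by (rule finite_subset) simp
    qed simp
    then show "finite (case p of (\<sigma>,\<tau>) \<Rightarrow> {t::nat. \<sigma> (c * (\<theta> + of_nat t)) = \<tau> (c * (\<theta> + of_nat t))})"
      unfolding p(1) prod.case .
  qed
  then have "finite (bad \<union> {t. \<theta> + of_nat t = 0})"
  proof (rule finite_UnI)
    have "{t. \<theta> + of_nat t = 0} \<subseteq> of_nat -` {- \<theta>}" by (auto simp: add_eq_0_iff)
    moreover have "finite (of_nat -` {- \<theta>} :: nat set)" by (rule finite_vimageI) (auto simp: inj_on_def)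
    ultimately show "finite {t. \<theta> + of_nat t = 0}" by (rule finite_subset)
  qed
  then obtain t where t: "t \<notin> bad" "\<theta> + of_nat t \<noteq> 0"
  proof -
    obtain t where "t \<notin> bad \<union> {t. \<theta> + of_nat t = 0}"
      using \<open>finite (bad \<union> {t. \<theta> + of_nat t = 0})\<close> ex_new_if_finite[OF infinite_UNIV_nat] by blast
    then show thesis using that by blast
  qed
  have "inj_on (\<lambda>\<sigma>. \<sigma> (c * (\<theta> + of_nat t))) ?E"
    using t(1) unfolding bad_def inj_on_def by blast
  moreover have "inj_on (\<lambda>\<sigma>. \<sigma> (\<theta> + of_nat t)) ?E"
    using primitive_imp_inj[OF th(1)] unfolding inj_on_def by (auto simp: emb_add emb_of_nat)
  ultimately show ?thesis
    using that[of "\<theta> + of_nat t"] primitive_if_inj[OF nf] t(2) th(2) by (simp add: alg_int_add)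
qed

section \<open>Indices of additive subgroups\<close>

definition add_subgroup :: "'a::ab_group_add set \<Rightarrow> bool" where
  "add_subgroup H \<longleftrightarrow> 0 \<in> H \<and> (\<forall>x\<in>H. \<forall>y\<in>H. x - y \<in> H)"

lemma add_subgroup_0: "add_subgroup H \<Longrightarrow> 0 \<in> H"
  and add_subgroup_diff: "add_subgroup H \<Longrightarrow> x \<in> H \<Longrightarrow> y \<in> H \<Longrightarrow> x - y \<in> H"
  unfolding add_subgroup_def by auto

lemma add_subgroup_minus: "add_subgroup H \<Longrightarrow> x \<in> H \<Longrightarrow> - x \<in> H"
  using add_subgroup_diff[of H 0 x] add_subgroup_0 by auto

lemma add_subgroup_add: "add_subgroup H \<Longrightarrow> x \<in> H \<Longrightarrow> y \<in> H \<Longrightarrow> x + y \<in> H"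
  using add_subgroup_diff[of H x "- y"] add_subgroup_minus[of H y] by auto

lemma add_subgroup_diff_commute: "add_subgroup H \<Longrightarrow> x - y \<in> H \<Longrightarrow> y - x \<in> H"
  using add_subgroup_minus[of H "x - y"] by simp

lemma add_subgroup_diff_trans: "add_subgroup H \<Longrightarrow> x - y \<in> H \<Longrightarrow> y - z \<in> H \<Longrightarrow> x - z \<in> H"
  using add_subgroup_add[of H "x - y" "y - z"] by simp

text \<open>The index of \<open>H\<close> in \<open>G\<close>, as in \<open>ideal_norm\<close> but
  for arbitrary groups, so that chains of subgroups can be compared. An infinite index counts as 0;
  positivity is therefore the way to state finiteness.\<close>

definition add_index :: "'a::ab_group_add set \<Rightarrow> 'a set \<Rightarrow> nat" where
  "add_index G H = card {{y \<in> G. y - x \<in> H} | x. x \<in> G}"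

lemma ideal_norm_eq_index: "ideal_norm I = add_index ring_of_integers I"
  unfolding ideal_norm_def add_index_def ..

definition transversal :: "'a::ab_group_add set \<Rightarrow> 'a set \<Rightarrow> 'a set \<Rightarrow> bool" where
  "transversal T G H \<longleftrightarrow> T \<subseteq> G \<and> (\<forall>x\<in>G. \<exists>t\<in>T. x - t \<in> H) \<and> (\<forall>s\<in>T. \<forall>t\<in>T. s - t \<in> H \<longrightarrow> s = t)"

lemma transversal_card:
  assumes H: "add_subgroup H" and T: "transversal T G H"
  shows "add_index G H = card T"
proof -
  let ?c = "\<lambda>x. {y \<in> G. y - x \<in> H}"
  have "bij_betw ?c T {?c x | x. x \<in> G}"
    unfolding bij_betw_def
  proof
    show "inj_on ?c T"
    proof (rule inj_onI)
      fix s t assume st: "s \<in> T" "t \<in> T" "?c s = ?c t"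
      have "s \<in> ?c s" using st T H unfolding transversal_def by (auto simp: add_subgroup_0)
      then have "s - t \<in> H" using st by blast
      then show "s = t" using T st unfolding transversal_def by blast
    qed
    show "?c ` T = {?c x | x. x \<in> G}"
    proof (intro equalityI subsetI)
      fix C assume "C \<in> ?c ` T"
      then show "C \<in> {?c x | x. x \<in> G}" using T unfolding transversal_def by blast
    next
      fix C assume "C \<in> {?c x | x. x \<in> G}"
      then obtain x where x: "x \<in> G" "C = ?c x" by blast
      obtain t where t: "t \<in> T" "x - t \<in> H" using T x unfolding transversal_def by blast
      have "?c x = ?c t"
        using t(2) H add_subgroup_diff_trans[OF H] add_subgroup_diff_commute[OF H] by blast
      then show "C \<in> ?c ` T" using x t by blast
    qed
  qed
  then show ?thesis unfolding add_index_def by (simp add: bij_betw_same_card)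
qed

lemma ex_transversal:
  assumes H: "add_subgroup H"
  obtains T where "transversal T G H"
proof -
  let ?c = "\<lambda>x. {y \<in> G. y - x \<in> H}"
  define rep where "rep x = (SOME y. y \<in> ?c x)" for x
  have rep: "rep x \<in> G" "rep x - x \<in> H" if "x \<in> G" for x
  proof -
    have "x \<in> ?c x" using that H by (simp add: add_subgroup_0)
    then have "rep x \<in> ?c x" unfolding rep_def by (rule someI)
    then show "rep x \<in> G" "rep x - x \<in> H" by auto
  qed
  have eq: "rep x = rep y" if "x - y \<in> H" for x y
  proof -
    have "?c x = ?c y" using that add_subgroup_diff_trans[OF H] add_subgroup_diff_commute[OF H] by blast
    then show ?thesis unfolding rep_def by simp
  qed
  have "transversal (rep ` G) G H"
    unfolding transversal_def
  proof (intro conjI ballI impI)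
    show "rep ` G \<subseteq> G" using rep by auto
    fix x assume "x \<in> G"
    then show "\<exists>t\<in>rep ` G. x - t \<in> H" using rep add_subgroup_diff_commute[OF H] by blast
  next
    fix s t assume "s \<in> rep ` G" "t \<in> rep ` G" "s - t \<in> H"
    then obtain x y where xy: "x \<in> G" "y \<in> G" "s = rep x" "t = rep y" by auto
    have "x - s \<in> H" "t - y \<in> H" using rep xy add_subgroup_diff_commute[OF H] by blast+
    then have "x - y \<in> H" using \<open>s - t \<in> H\<close> add_subgroup_diff_trans[OF H] by blast
    then show "s = t" using eq xy by simp
  qed
  then show ?thesis using that by blast
qed

lemma add_index_pos_if_finite_map:
  assumes H: "add_subgroup H" and fin: "finite F" and f: "\<And>x. x \<in> G \<Longrightarrow> f x \<in> F"
    and inj: "\<And>x y. x \<in> G \<Longrightarrow> y \<in> G \<Longrightarrow> f x = f y \<Longrightarrow> x - y \<in> H" and G: "G \<noteq> {}"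
  shows "add_index G H > 0"
proof -
  obtain T where T: "transversal T G H" using ex_transversal[OF H] .
  then have TG: "T \<subseteq> G" unfolding transversal_def by blast
  have "T \<noteq> {}" using T G unfolding transversal_def by blast
  have "inj_on f T"
    using T inj TG unfolding transversal_def inj_on_def by blast
  moreover have "f ` T \<subseteq> F" using f TG by blast
  ultimately have "finite T" using fin by (meson finite_imageD finite_subset)
  then show ?thesis using \<open>T \<noteq> {}\<close> transversal_card[OF H T] by (simp add: card_gt_0_iff)
qed

text \<open>An arbitrary map that separates the cosets of \<open>H\<close> modulo \<open>H'\<close>
  induces an injection of transversals; in this form it accepts maps made by choice
  functions.\<close>

lemma add_index_le_if_map:
  assumes H: "add_subgroup H" "add_subgroup H'" and pos: "add_index G' H' > 0"
    and f: "\<And>x. x \<in> G \<Longrightarrow> f x \<in> G'"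
    and inj: "\<And>x y. x \<in> G \<Longrightarrow> y \<in> G \<Longrightarrow> f x - f y \<in> H' \<Longrightarrow> x - y \<in> H" and G: "G \<noteq> {}"
  shows "0 < add_index G H" "add_index G H \<le> add_index G' H'"
proof -
  obtain T where T: "transversal T G H" using ex_transversal[OF H(1)] .
  obtain T' where T': "transversal T' G' H'" using ex_transversal[OF H(2)] .
  have TG: "T \<subseteq> G" using T unfolding transversal_def by blast
  moreover have "T \<noteq> {}" using T G unfolding transversal_def by blast
  ultimately have TG: "T \<subseteq> G" "T \<noteq> {}" by blast+
  have finT': "finite T'" using pos transversal_card[OF H(2) T'] by (simp add: card_gt_0_iff)
  have "\<forall>x\<in>T. \<exists>t\<in>T'. f x - t \<in> H'" using T' f TG unfolding transversal_def by blast
  then obtain g where g: "\<And>x. x \<in> T \<Longrightarrow> g x \<in> T' \<and> f x - g x \<in> H'" by metis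
  have "inj_on g T"
  proof (rule inj_onI)
    fix x y assume xy: "x \<in> T" "y \<in> T" "g x = g y"
    have "f x - g x \<in> H'" "g y - f y \<in> H'" using g xy add_subgroup_diff_commute[OF H(2)] by blast+
    then have "f x - f y \<in> H'" using add_subgroup_diff_trans[OF H(2)] xy(3) by metis
    then have "x - y \<in> H" using inj xy TG by blast
    then show "x = y" using T xy unfolding transversal_def by blast
  qed
  moreover have gT: "g ` T \<subseteq> T'" using g by blast
  ultimately have "card T \<le> card T'" "finite T"
    using finT' by (auto intro: card_inj_on_le inj_on_finite)
  then show "0 < add_index G H" "add_index G H \<le> add_index G' H'"
    using TG transversal_card[OF H(1) T] transversal_card[OF H(2) T'] by (auto simp: card_gt_0_iff)
qed

text \<open>Sums of representatives form a transversal of \<open>K\<close> in \<open>G\<close>. The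
  formula also covers infinite indices, both sides being 0 then.\<close>

lemma add_index_mult:
  assumes H: "add_subgroup H" and K: "add_subgroup K" and sub: "K \<subseteq> H" "H \<subseteq> G" and G: "add_subgroup G"
  shows "add_index G K = add_index G H * add_index H K"
proof -
  obtain S where S: "transversal S G H" using ex_transversal[OF H] .
  obtain T where T: "transversal T H K" using ex_transversal[OF K] .
  have SG: "S \<subseteq> G" and TH: "T \<subseteq> H" using S T unfolding transversal_def by auto
  have inj: "s = s' \<and> t = t'" if "s \<in> S" "s' \<in> S" "t \<in> T" "t' \<in> T" "(s + t) - (s' + t') \<in> K" for s s' t t'
  proof -
    have "(s + t) - (s' + t') \<in> H" using that sub by blast
    moreover have "t' - t \<in> H" using that TH add_subgroup_diff[OF H] by blast
    ultimately have "((s + t) - (s' + t')) + (t' - t) \<in> H" by (rule add_subgroup_add[OF H])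
    then have "s - s' \<in> H" by (simp add: algebra_simps)
    then have "s = s'" using S that unfolding transversal_def by blast
    then have "t - t' \<in> K" using that by simp
    then have "t = t'" using T that unfolding transversal_def by blast
    then show ?thesis using \<open>s = s'\<close> by blast
  qed
  have "transversal ((\<lambda>(s,t). s + t) ` (S \<times> T)) G K"
    unfolding transversal_def
  proof (intro conjI ballI impI)
    show "(\<lambda>(s,t). s + t) ` (S \<times> T) \<subseteq> G"
      using SG TH sub by (auto intro!: add_subgroup_add[OF G])
    fix x assume "x \<in> G"
    then obtain s where s: "s \<in> S" "x - s \<in> H" using S unfolding transversal_def by blast
    then obtain t where "t \<in> T" "x - s - t \<in> K" using T unfolding transversal_def by blast
    then show "\<exists>z\<in>(\<lambda>(s,t). s + t) ` (S \<times> T). x - z \<in> K"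
      using s by (intro bexI[of _ "s + t"]) (auto simp: algebra_simps)
  next
    fix x y assume "x \<in> (\<lambda>(s,t). s + t) ` (S \<times> T)" "y \<in> (\<lambda>(s,t). s + t) ` (S \<times> T)" "x - y \<in> K"
    then show "x = y" using inj by auto
  qed
  then have "add_index G K = card ((\<lambda>(s,t). s + t) ` (S \<times> T))" by (rule transversal_card[OF K])
  also have "\<dots> = card (S \<times> T)"
    using inj add_subgroup_0[OF K] by (intro card_image inj_onI) auto
  also have "\<dots> = card S * card T" by (rule card_cartesian_product)
  finally show ?thesis using transversal_card[OF H S] transversal_card[OF K T] by simp
qed

lemma add_subgroup_scale:
  assumes H: "add_subgroup H" shows "add_subgroup ((*) (a::'a::ring) ` H)"
  unfolding add_subgroup_def
proof (intro conjI ballI)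
  show "0 \<in> (*) a ` H" using add_subgroup_0[OF H] by (intro image_eqI[of _ _ 0]) auto
  fix x y assume "x \<in> (*) a ` H" "y \<in> (*) a ` H"
  then obtain u v where "u \<in> H" "v \<in> H" "x = a * u" "y = a * v" by auto
  then show "x - y \<in> (*) a ` H"
    using add_subgroup_diff[OF H, of u v] by (intro image_eqI[of _ _ "u - v"]) (auto simp: right_diff_distrib)
qed

lemma add_index_scale:
  fixes a :: "'a::field"
  assumes a: "a \<noteq> 0" and H: "add_subgroup H"
  shows "add_index ((*) a ` G) ((*) a ` H) = add_index G H"
proof -
  obtain T where T: "transversal T G H" using ex_transversal[OF H] .
  have mem: "a * x - a * y \<in> (*) a ` H \<longleftrightarrow> x - y \<in> H" for x y
    unfolding right_diff_distrib[symmetric] using a by (auto simp: image_iff)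
  have "transversal ((*) a ` T) ((*) a ` G) ((*) a ` H)"
    using T a unfolding transversal_def by (auto simp: mem)
  then have "add_index ((*) a ` G) ((*) a ` H) = card ((*) a ` T)"
    by (rule transversal_card[OF add_subgroup_scale[OF H]])
  also have "\<dots> = card T" using a by (intro card_image) (auto simp: inj_on_def)
  finally show ?thesis using transversal_card[OF H T] by simp
qed

lemma add_index_pos_mono:
  assumes pos: "add_index G H > 0" and sub: "H \<subseteq> H'" "H' \<subseteq> G'" "G' \<subseteq> G"
    and grp: "add_subgroup H" "add_subgroup H'" "add_subgroup G'" "add_subgroup G"
  shows "add_index G' H' > 0"
proof -
  have "H \<subseteq> G'" using sub by (meson subset_trans)
  have "add_index G H = add_index G G' * add_index G' H"
    by (rule add_index_mult[OF grp(3) grp(1) \<open>H \<subseteq> G'\<close> sub(3) grp(4)])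
  moreover have "add_index G' H = add_index G' H' * add_index H' H"
    by (rule add_index_mult[OF grp(2) grp(1) sub(1,2) grp(3)])
  ultimately show ?thesis using pos by simp
qed

section \<open>The ring of integers and the orders Z[c]\<close>

abbreviation "OK \<equiv> ring_of_integers"

lemma add_subgroup_OK: "add_subgroup (OK :: 'a::field_char_0 set)"
  unfolding add_subgroup_def ring_of_integers_def by (auto simp: alg_int_diff)

lemma OK_mult: "x \<in> OK \<Longrightarrow> y \<in> OK \<Longrightarrow> x * y \<in> OK"
  and OK_1: "1 \<in> OK" and OK_0: "0 \<in> OK" and OK_of_int: "of_int k \<in> OK"
  unfolding ring_of_integers_def by (auto simp: alg_int_mult)

text \<open>The order Z[c] when \<open>c\<close> is integral. Indices in it are computable from the
  minimal polynomial, unlike those in the full ring of integers.\<close>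

definition int_span :: "'a::field_char_0 \<Rightarrow> 'a set" where
  "int_span c = range (\<lambda>p::int poly. poly (map_poly of_int p) c)"

lemma int_span_subgroup: "add_subgroup (int_span c)"
  unfolding add_subgroup_def
proof (intro conjI ballI)
  show "0 \<in> int_span c" unfolding int_span_def by (intro image_eqI[of _ _ 0]) auto
  fix x y assume "x \<in> int_span c" "y \<in> int_span c"
  then obtain p q :: "int poly" where "x = poly (map_poly of_int p) c" "y = poly (map_poly of_int q) c"
    unfolding int_span_def by auto
  then have "x - y = poly (map_poly of_int (p - q)) c" by (simp add: hom_distribs)
  then show "x - y \<in> int_span c" unfolding int_span_def by blast
qed

lemma int_span_subset_OK: "alg_int c \<Longrightarrow> int_span c \<subseteq> OK"
  unfolding int_span_def ring_of_integers_def
  by (auto simp: poly_altdef coeff_map_poly intro!: alg_int_sum alg_int_mult alg_int_power)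

lemma int_span_mult: "x \<in> int_span c \<Longrightarrow> c * x \<in> int_span c"
proof -
  assume "x \<in> int_span c"
  then obtain p :: "int poly" where "x = poly (map_poly of_int p) c" unfolding int_span_def by auto
  then have "c * x = poly (map_poly of_int (pCons 0 p)) c" by (simp add: of_int_hom.map_poly_pCons_hom)
  then show ?thesis unfolding int_span_def by blast
qed

lemma int_span_smult: "x \<in> int_span c \<Longrightarrow> of_int k * x \<in> int_span c"
proof -
  assume "x \<in> int_span c"
  then obtain p :: "int poly" where "x = poly (map_poly of_int p) c" unfolding int_span_def by auto
  then have "of_int k * x = poly (map_poly of_int (Polynomial.smult k p)) c" by (simp add: hom_distribs)
  then show ?thesis unfolding int_span_def by blast
qed

lemma alg_int_coeff_mult:
  assumes "\<And>i. alg_int (coeff p i)" "\<And>i. alg_int (coeff q i)"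
  shows "alg_int (coeff (p * q) i)"
  unfolding coeff_mult using assms by (auto intro!: alg_int_sum alg_int_mult)

lemma alg_int_coeff_linear_prod:
  assumes "\<And>z. z \<in> A \<Longrightarrow> alg_int z"
  shows "alg_int (coeff (\<Prod>z\<in>A. [:- z, 1:]) i)"
  using assms
proof (induction A arbitrary: i rule: infinite_finite_induct)
  case (insert x F)
  have "alg_int (coeff [:- x, 1:] j)" for j
    using insert.prems[of x] by (auto simp: coeff_pCons alg_int_uminus split: nat.splits)
  then have "alg_int (coeff ([:- x, 1:] * (\<Prod>z\<in>F. [:- z, 1:])) i)"
    using insert by (intro alg_int_coeff_mult) auto
  then show ?case using insert(1,2) by simp
qed (auto simp: coeff_1)

lemma complex_min_poly_factor:
  assumes "is_min_poly m (x::'a::field_char_0)"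
  shows "map_poly of_rat m = (\<Prod>z\<in>{z::complex. rat_eval m z = 0}. [:- z, 1:])"
proof -
  let ?P = "map_poly of_rat m :: complex poly"
  have "?P \<noteq> 0" using min_poly_nonzero[OF assms] by simp
  then have "rsquarefree ?P"
    using min_poly_card_roots[OF assms] rsquarefree_card_degree[of ?P] unfolding rat_eval_def by (simp add: degree_map_poly)
  then have "Polynomial.smult (lead_coeff ?P) (\<Prod>z | poly ?P z = 0. [:- z, 1:]) = ?P"
    by (rule complex_poly_decompose_rsquarefree)
  moreover have "lead_coeff ?P = 1" using assms unfolding is_min_poly_def by (simp add: degree_map_poly coeff_map_poly)
  ultimately show ?thesis unfolding rat_eval_def by simp
qed

lemma min_poly_root_alg_int:
  fixes x :: "'a::field_char_0"
  assumes m: "is_min_poly m x" and x: "alg_int x" and z: "rat_eval m (z::complex) = 0"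
  shows "alg_int z"
proof -
  obtain p :: "int poly" where p: "lead_coeff p = 1" "poly (map_poly of_int p) x = 0"
    using x unfolding alg_int_def by blast
  then have "m dvd map_poly of_int p" using min_poly_dvd_iff[OF m] poly_of_int_rat_eval by metis
  then have "rat_eval (map_poly of_int p) z = 0" using z by (auto elim!: dvdE simp: rat_eval_mult)
  then show ?thesis using p poly_of_int_rat_eval unfolding alg_int_def by metis
qed

lemma rat_coeffs_int_poly:
  fixes p :: "rat poly"
  assumes "\<And>i. alg_int (of_rat (coeff p i) :: 'a::field_char_0)"
  obtains P :: "int poly" where "p = map_poly of_int P"
proof -
  define P where "P = map_poly floor p"
  have "p = map_poly of_int P"
  proof (rule poly_eqI)
    fix i
    have "coeff p i \<in> \<int>" using assms[of i] by (rule alg_int_of_rat)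
    then show "coeff p i = coeff (map_poly of_int P) i"
      unfolding P_def by (auto simp: coeff_map_poly elim: Ints_cases)
  qed
  then show ?thesis using that by blast
qed

text \<open>The coefficients are polynomial expressions in the conjugates of \<open>x\<close>, which
  are algebraic integers, and a rational algebraic integer is an integer.\<close>

lemma min_poly_int:
  fixes x :: "'a::field_char_0"
  assumes m: "is_min_poly m x" and x: "alg_int x"
  obtains M :: "int poly" where "m = map_poly of_int M" "lead_coeff M = 1"
proof -
  have "alg_int (of_rat (coeff m i) :: complex)" for i
  proof -
    have "of_rat (coeff m i) = coeff (map_poly of_rat m :: complex poly) i" by (simp add: coeff_map_poly)
    then show ?thesis unfolding complex_min_poly_factor[OF m]
      using min_poly_root_alg_int[OF m x] by (auto intro!: alg_int_coeff_linear_prod)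
  qed
  then obtain M :: "int poly" where M: "m = map_poly of_int M" using rat_coeffs_int_poly by metis
  moreover have "lead_coeff M = 1" using m unfolding is_min_poly_def M by (simp add: degree_map_poly coeff_map_poly)
  ultimately show ?thesis using that by blast
qed

lemma monic_int_division:
  fixes p M :: "int poly"
  assumes "lead_coeff M = 1"
  obtains q r where "p = q * M + r" "r = 0 \<or> degree r < degree M"
proof -
  obtain q r where qr: "pseudo_divmod p M = (q, r)" by (cases "pseudo_divmod p M") auto
  have "M \<noteq> 0" using assms by auto
  then show ?thesis using pseudo_divmod[OF \<open>M \<noteq> 0\<close> qr] assms that[of q r] by (simp add: mult.commute)
qed

lemma int_poly_kills_dvd:
  fixes x :: "'a::field_char_0"
  assumes m: "is_min_poly (map_poly of_int M) x" and M: "lead_coeff M = 1" and p: "poly (map_poly of_int p) x = 0"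
  shows "M dvd (p :: int poly)"
proof -
  obtain q r where qr: "p = q * M + r" "r = 0 \<or> degree r < degree M" using monic_int_division[OF M] .
  have M0: "poly (map_poly of_int M) x = 0" using m unfolding is_min_poly_def poly_of_int_rat_eval[symmetric] by blast
  have "poly (map_poly of_int r) x = 0" using p M0 unfolding qr(1) by (simp add: hom_distribs)
  then have "r = 0"
    using m qr(2) unfolding is_min_poly_def poly_of_int_rat_eval by (auto simp: degree_map_poly)
  then show ?thesis using qr by simp
qed

lemma int_span_reduce:
  assumes m: "is_min_poly (map_poly of_int M) c" and M: "lead_coeff M = 1" and x: "x \<in> int_span c"
  obtains p :: "int poly" where "x = poly (map_poly of_int p) c" "degree p < degree M"
proof -
  obtain p :: "int poly" where p: "x = poly (map_poly of_int p) c" using x unfolding int_span_def by auto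
  obtain q r where qr: "p = q * M + r" "r = 0 \<or> degree r < degree M" using monic_int_division[OF M] .
  have M0: "poly (map_poly of_int M) c = 0" using m unfolding is_min_poly_def poly_of_int_rat_eval[symmetric] by blast
  have "x = poly (map_poly of_int r) c" using M0 unfolding p qr(1) by (simp add: hom_distribs)
  moreover have "degree r < degree M" using qr(2) min_poly_degree_pos[OF m] by (auto simp: degree_map_poly)
  ultimately show ?thesis using that by blast
qed

text \<open>Modulo \<open>c\<close>, an element of Z[c] reduces to the constant coefficient of a
  polynomial representing it. An integer \<open>j\<close> equals \<open>c q(c)\<close> exactly when
  \<open>M\<close> divides some \<open>X q - j\<close>, that is when the constant coefficient of
  \<open>M\<close> divides \<open>j\<close>.\<close>

lemma int_span_index:
  fixes c :: "'a::field_char_0"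
  assumes m: "is_min_poly (map_poly of_int M) c" and M: "lead_coeff M = 1" and c: "c \<noteq> 0"
  shows "add_index (int_span c) ((*) c ` int_span c) = nat \<bar>coeff M 0\<bar>" "coeff M 0 \<noteq> 0"
proof -
  define k where "k = \<bar>coeff M 0\<bar>"
  have M0: "poly (map_poly of_int M) c = 0" using m unfolding is_min_poly_def poly_of_int_rat_eval[symmetric] by blast
  obtain a P where aP: "M = pCons a P" by (cases M) auto
  have a: "coeff M 0 = a" using aP by simp
  have dM: "degree M > 0" using min_poly_degree_pos[OF m] by (simp add: degree_map_poly)
  have eq: "of_int a = c * poly (map_poly of_int (- P)) c"
    using M0 unfolding aP by (simp add: hom_distribs of_int_hom.map_poly_pCons_hom eq_neg_iff_add_eq_0)
  show nz: "coeff M 0 \<noteq> 0"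
  proof
    assume "coeff M 0 = 0"
    then have "poly (map_poly of_int P) c = 0" using eq c a by (simp add: hom_distribs)
    moreover have "P \<noteq> 0" using aP dM by auto
    ultimately have "degree M \<le> degree P"
    proof -
      have "map_poly of_int P \<noteq> (0 :: rat poly)" using \<open>P \<noteq> 0\<close> by simp
      moreover have "rat_eval (map_poly of_int P) c = 0"
        using \<open>poly (map_poly of_int P) c = 0\<close> by (simp only: poly_of_int_rat_eval)
      ultimately have "degree (map_poly of_int M :: rat poly) \<le> degree (map_poly of_int P :: rat poly)"
        using m unfolding is_min_poly_def by blast
      then show ?thesis by (simp add: degree_map_poly)
    qed
    then show False using aP \<open>P \<noteq> 0\<close> by simp
  qed
  have mem: "of_int j \<in> (*) c ` int_span c \<longleftrightarrow> k dvd j" for j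
  proof
    assume "of_int j \<in> (*) c ` int_span c"
    then obtain q :: "int poly" where "of_int j = c * poly (map_poly of_int q) c" unfolding int_span_def by auto
    then have "poly (map_poly of_int (pCons (- j) q)) c = 0" by (simp add: of_int_hom.map_poly_pCons_hom)
    then have "M dvd pCons (- j) q" using int_poly_kills_dvd[OF m M] by blast
    then obtain w where "pCons (- j) q = M * w" by (rule dvdE)
    then have "coeff (pCons (- j) q) 0 = coeff M 0 * coeff w 0" by (simp add: coeff_mult_0)
    then have "- j = coeff M 0 * coeff w 0" by simp
    then show "k dvd j" unfolding k_def by (metis abs_dvd_iff dvd_minus_iff dvd_triv_left)
  next
    assume "k dvd j"
    then have "a dvd j" unfolding k_def a by simp
    then obtain b where "j = a * b" by (rule dvdE)
    then have "of_int j = c * (of_int b * poly (map_poly of_int (- P)) c)" using eq by simp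
    moreover have "of_int b * poly (map_poly of_int (- P)) c \<in> int_span c"
      by (rule int_span_smult) (auto simp: int_span_def)
    ultimately show "of_int j \<in> (*) c ` int_span c" by blast
  qed
  have kpos: "k > 0" using nz k_def by simp
  have "transversal (of_int ` {0..<k}) (int_span c) ((*) c ` int_span c)"
    unfolding transversal_def
  proof (intro conjI ballI impI)
    show "of_int ` {0..<k} \<subseteq> int_span c"
      unfolding int_span_def by (auto intro: image_eqI[of _ _ "[:j:]" for j] simp: of_int_hom.map_poly_pCons_hom)
    fix x assume "x \<in> int_span c"
    then obtain p :: "int poly" where p: "x = poly (map_poly of_int p) c" unfolding int_span_def by auto
    obtain b q where bq: "p = pCons b q" by (cases p) auto
    have "k dvd b - b mod k" by (simp add: mod_eq_dvd_iff[symmetric])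
    then have "of_int (b - b mod k) \<in> (*) c ` int_span c" using mem by blast
    moreover have "c * poly (map_poly of_int q) c \<in> (*) c ` int_span c" unfolding int_span_def by auto
    ultimately have "of_int (b - b mod k) + c * poly (map_poly of_int q) c \<in> (*) c ` int_span c"
      by (rule add_subgroup_add[OF add_subgroup_scale[OF int_span_subgroup]])
    then have "x - of_int (b mod k) \<in> (*) c ` int_span c"
      unfolding p bq by (simp add: of_int_hom.map_poly_pCons_hom algebra_simps)
    then show "\<exists>t\<in>of_int ` {0..<k}. x - t \<in> (*) c ` int_span c" using kpos by auto
  next
    fix s t :: 'a assume st: "s \<in> of_int ` {0..<k}" "t \<in> of_int ` {0..<k}" "s - t \<in> (*) c ` int_span c"
    then obtain i j where ij: "s = of_int i" "t = of_int j" "0 \<le> i" "i < k" "0 \<le> j" "j < k" by auto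
    have "of_int (i - j) \<in> (*) c ` int_span c" using st ij by simp
    then have "k dvd i - j" using mem by blast
    then have "i mod k = j mod k" by (simp add: mod_eq_dvd_iff)
    then show "s = t" using ij by simp
  qed
  then have "add_index (int_span c) ((*) c ` int_span c) = card (of_int ` {0..<k} :: 'a set)"
    by (rule transversal_card[OF add_subgroup_scale[OF int_span_subgroup]])
  also have "\<dots> = nat k" by (subst card_image) (auto simp: inj_on_def)
  finally show "add_index (int_span c) ((*) c ` int_span c) = nat \<bar>coeff M 0\<bar>" unfolding k_def .
qed

section \<open>Norms of principal ideals\<close>

text \<open>An element is classified by its coordinates modulo \<open>N\<close> with respect to
  \<open>1, c, ..., c^(n-1)\<close>, which leaves finitely many classes.\<close>

lemma int_span_index_smult_pos:
  assumes m: "is_min_poly (map_poly of_int M) c" and M: "lead_coeff M = 1" and N: "(N::int) > 0"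
  shows "add_index (int_span c) ((*) (of_int N) ` int_span c) > 0"
proof -
  let ?n = "degree M"
  have "\<forall>x\<in>int_span c. \<exists>p::int poly. x = poly (map_poly of_int p) c \<and> degree p < ?n"
    using int_span_reduce[OF m M] by metis
  then obtain p where p: "\<And>x. x \<in> int_span c \<Longrightarrow> x = poly (map_poly of_int (p x :: int poly)) c \<and> degree (p x) < ?n"
    by metis
  define f where "f x = map (\<lambda>i. coeff (p x) i mod N) [0..<?n]" for x
  show ?thesis
  proof (rule add_index_pos_if_finite_map)
    show "add_subgroup ((*) (of_int N) ` int_span c)" by (rule add_subgroup_scale[OF int_span_subgroup])
    show "finite {xs. set xs \<subseteq> {0..<N} \<and> length xs = ?n}" by (rule finite_lists_length_eq) simp
    show "f x \<in> {xs. set xs \<subseteq> {0..<N} \<and> length xs = ?n}" for x unfolding f_def using N by auto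
    show "int_span c \<noteq> {}" unfolding int_span_def by blast
    fix x y assume xy: "x \<in> int_span c" "y \<in> int_span c" "f x = f y"
    have "N dvd coeff (p x - p y) i" for i
    proof (cases "i < ?n")
      case True
      then have "coeff (p x) i mod N = coeff (p y) i mod N" using xy(3) unfolding f_def by simp
      then show ?thesis by (simp add: mod_eq_dvd_iff)
    next
      case False
      then show ?thesis using p[OF xy(1)] p[OF xy(2)] by (simp add: coeff_eq_0)
    qed
    then have "[:N:] dvd p x - p y" by (simp add: const_poly_dvd_iff)
    then obtain w where w: "p x - p y = [:N:] * w" by (rule dvdE)
    have "x - y = poly (map_poly of_int (p x - p y)) c" using p[OF xy(1)] p[OF xy(2)] by (simp add: hom_distribs)
    also have "\<dots> = of_int N * poly (map_poly of_int w) c" unfolding w by (simp add: hom_distribs)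
    finally show "x - y \<in> (*) (of_int N) ` int_span c" unfolding int_span_def by blast
  qed
qed

text \<open>
  Lagrange interpolation at the conjugates of \<open>c\<close> expresses the rational coordinates of an algebraic integer
  with respect to the powers of \<open>c\<close> by algebraic integers divided by values of \<open>m'\<close>, where \<open>m\<close> is the minimal polynomial.
  A Bezout relation for \<open>m\<close> and \<open>m'\<close> clears these denominators.
\<close>

lemma OK_multiple_in_int_span:
  fixes c :: "'a::field_char_0"
  assumes prim: "primitive_elt c" and m: "is_min_poly (map_poly of_int M) c" and M: "lead_coeff M = 1" and c: "alg_int c"
  obtains \<Delta> :: int where "\<Delta> > 0" "\<And>x. x \<in> OK \<Longrightarrow> of_int \<Delta> * x \<in> int_span c"
proof -
  define mr :: "rat poly" where "mr = map_poly of_int M"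
  note m = m[folded mr_def]
  define Z where "Z = {z::complex. rat_eval mr z = 0}"
  have bij: "bij_betw (\<lambda>\<sigma>. \<sigma> c) complex_embeddings Z"
    unfolding Z_def by (rule embeddings_bij_roots[OF prim m])
  have finZ: "finite Z" and cardZ: "card Z = degree mr"
    unfolding Z_def using finite_rat_roots[OF min_poly_nonzero[OF m]] min_poly_card_roots[OF m] by auto
  have Zint: "alg_int z" if "z \<in> Z" for z using min_poly_root_alg_int[OF m c] that Z_def by auto
  define mC :: "complex poly" where "mC = map_poly of_rat mr"
  have mC: "mC = (\<Prod>z\<in>Z. [:- z, 1:])" unfolding mC_def Z_def by (rule complex_min_poly_factor[OF m])
  obtain u v where uv: "u * mr + v * pderiv mr = 1"
    using min_poly_coprime_pderiv[OF m] bezout_coefficients_fst_snd[of mr "pderiv mr"] by (metis coprime_iff_gcd_eq_1)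
  obtain \<Delta> V where V: "\<Delta> > 0" "Polynomial.smult (of_int \<Delta>) v = map_poly of_int V" using rat_poly_denominator[of v] .
  \<comment> \<open>The Lagrange numerator \<open>mC / (X - z)\<close>: it vanishes at the other
    conjugates, and its value at \<open>z\<close> is the derivative of \<open>mC\<close>
    there.\<close>
  define g where "g z = (\<Prod>w\<in>Z - {z}. [:- w, 1:])" for z
  have dg: "degree (g z) = degree mr - 1" if "z \<in> Z" for z
    unfolding g_def using that finZ cardZ by (simp add: degree_prod_sum_eq)
  have gint: "alg_int (coeff (g z) i)" for z i unfolding g_def using Zint by (intro alg_int_coeff_linear_prod) auto
  have mg: "mC = [:- z, 1:] * g z" if "z \<in> Z" for z
    unfolding mC g_def using that finZ by (simp add: prod.remove)
  have g0: "poly (g z) w = 0" if "w \<in> Z" "w \<noteq> z" for z w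
    unfolding g_def poly_prod using that finZ by (intro prod_zero) auto
  \<comment> \<open>On the roots, \<open>V\<close> takes the values \<open>\<Delta>\<close> divided
    by the derivative, so it replaces the Lagrange denominators by algebraic integers.\<close>
  have gz: "poly (g z) z * poly (map_poly of_int V) z = of_int \<Delta>" if "z \<in> Z" for z
  proof -
    have "poly (g z) z = poly (pderiv mC) z" unfolding mg[OF that] pderiv_mult by (simp add: pderiv_pCons)
    also have "\<dots> = rat_eval (pderiv mr) z" unfolding mC_def rat_eval_def of_rat_hom.map_poly_pderiv ..
    finally have 1: "poly (g z) z = rat_eval (pderiv mr) z" .
    have "poly (map_poly of_int V) z = rat_eval (Polynomial.smult (of_int \<Delta>) v) z"
      unfolding V(2) by (rule poly_of_int_rat_eval)
    then have 2: "poly (map_poly of_int V) z = of_int \<Delta> * rat_eval v z" by (simp add: rat_eval_smult)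
    have "rat_eval (u * mr + v * pderiv mr) z = 1" unfolding uv by simp
    then have "rat_eval v z * rat_eval (pderiv mr) z = 1" using that unfolding Z_def by (simp add: rat_eval_add rat_eval_mult)
    then show ?thesis unfolding 1 2 by (simp add: algebra_simps)
  qed
  have "of_int \<Delta> * x \<in> int_span c" if x: "x \<in> OK" for x
  proof -
    obtain p where p: "x = rat_eval p c" using prim unfolding primitive_elt_def by blast
    define r where "r = p mod mr"
    have "r = p - p div mr * mr" unfolding r_def by (simp add: minus_div_mult_eq_mod)
    then have xr: "x = rat_eval r c" using p m unfolding is_min_poly_def by (simp add: rat_eval_diff rat_eval_mult)
    have dr: "degree r < degree mr"
      using degree_mod_less[OF min_poly_nonzero[OF m], of p] min_poly_degree_pos[OF m] unfolding r_def by auto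
    have rz: "alg_int (rat_eval r z)" if "z \<in> Z" for z
    proof -
      have "z \<in> (\<lambda>\<sigma>. \<sigma> c) ` complex_embeddings" using bij_betw_imp_surj_on[OF bij] that by simp
      then obtain \<sigma> where s: "\<sigma> \<in> complex_embeddings" "z = \<sigma> c" by auto
      have "rat_eval r z = \<sigma> x" unfolding s(2) xr by (rule emb_rat_eval[OF s(1), symmetric])
      then show ?thesis using emb_alg_int_iff[OF s(1)] x unfolding ring_of_integers_def by simp
    qed
    \<comment> \<open>This is the interpolation formula for \<open>\<Delta> r\<close>; agreement at
      the \<open>card Z\<close> conjugates suffices since both degrees are smaller. It exhibits the
      coefficients of \<open>\<Delta> r\<close> as rational numbers that are algebraic
      integers.\<close>
    define L where "L = (\<Sum>z\<in>Z. Polynomial.smult (rat_eval r z * poly (map_poly of_int V) z) (g z))"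
    have "Polynomial.smult (of_int \<Delta>) (map_poly of_rat r) = L"
    proof (rule poly_eqI_degree[of Z])
      fix z assume z: "z \<in> Z"
      have "poly L z = (\<Sum>w\<in>Z. if w = z then rat_eval r z * (poly (g z) z * poly (map_poly of_int V) z) else 0)"
        unfolding L_def poly_sum using g0 z by (intro sum.cong) auto
      also have "\<dots> = rat_eval r z * of_int \<Delta>" using z finZ by (simp add: gz)
      finally show "poly (Polynomial.smult (of_int \<Delta>) (map_poly of_rat r)) z = poly L z"
        unfolding rat_eval_def by simp
      next
      show "card Z > degree (Polynomial.smult (of_int \<Delta>) (map_poly of_rat r :: complex poly))"
        using dr V(1) cardZ by (simp add: degree_map_poly)
      have "degree L \<le> degree mr - 1" unfolding L_def
        using dg by (intro degree_sum_le finZ) (auto intro: order_trans[OF degree_smult_le])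
      then show "card Z > degree L" using cardZ dr by simp
    qed
    then have cL: "of_rat (of_int \<Delta> * coeff r i) = coeff L i" for i
      by (auto simp: coeff_map_poly of_rat_mult poly_eq_iff)
    have "alg_int (poly (map_poly of_int V) z)" if "z \<in> Z" for z
      using int_span_subset_OK[OF Zint[OF that]] unfolding int_span_def ring_of_integers_def by blast
    then have "alg_int (coeff L i)" for i
      unfolding L_def coeff_sum using rz gint by (auto intro!: alg_int_sum alg_int_mult)
    then have "alg_int (of_rat (coeff (Polynomial.smult (of_int \<Delta>) r) i) :: complex)" for i
      using cL by simp
    then obtain P :: "int poly" where P: "Polynomial.smult (of_int \<Delta>) r = map_poly of_int P"
      using rat_coeffs_int_poly by metis
    have "of_int \<Delta> * x = rat_eval (Polynomial.smult (of_int \<Delta>) r) c" by (simp add: xr rat_eval_smult)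
    also have "\<dots> = poly (map_poly of_int P) c" unfolding P by (rule poly_of_int_rat_eval[symmetric])
    finally show ?thesis unfolding int_span_def by blast
  qed
  then show ?thesis using V(1) that by blast
qed

text \<open>Multiplication by \<open>\<Delta>\<close> moves the ring of integers into Z[c]. If two
  images agree modulo \<open>\<Delta> N Z[c]\<close>, the originals differ by \<open>N\<close> times
  an element of Z[c], so finiteness carries over from Z[c].\<close>

lemma OK_index_of_int_pos:
  assumes nf: "number_field TYPE('a::field_char_0)" and N: "(N::int) > 0"
  shows "add_index OK ((*) (of_int N) ` (OK :: 'a::field_char_0 set)) > 0"
proof -
  obtain c :: 'a where c: "primitive_elt c" "alg_int c" using ex_integral_primitive[OF nf] .
  obtain m where m: "is_min_poly m c" using number_field_ex_min_poly[OF nf] .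
  obtain M :: "int poly" where M: "m = map_poly of_int M" "lead_coeff M = 1" using min_poly_int[OF m c(2)] .
  note m = m[unfolded M(1)]
  obtain \<Delta> where D: "\<Delta> > 0" "\<And>x::'a. x \<in> OK \<Longrightarrow> of_int \<Delta> * x \<in> int_span c"
    using OK_multiple_in_int_span[OF c(1) m M(2) c(2)] by metis
  have "\<Delta> * N > 0" using D(1) N by simp
  show ?thesis
  proof (rule add_index_le_if_map(1))
    show "add_subgroup ((*) (of_int N) ` (OK :: 'a set))" by (rule add_subgroup_scale[OF add_subgroup_OK])
    show "add_subgroup ((*) (of_int (\<Delta> * N)) ` int_span c)" by (rule add_subgroup_scale[OF int_span_subgroup])
    show "add_index (int_span c) ((*) (of_int (\<Delta> * N)) ` int_span c) > 0"
      by (rule int_span_index_smult_pos[OF m M(2) \<open>\<Delta> * N > 0\<close>])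
    show "of_int \<Delta> * x \<in> int_span c" if "x \<in> OK" for x using D(2)[OF that] .
    show "OK \<noteq> ({} :: 'a set)" using OK_0 by blast
    fix x y :: 'a assume "of_int \<Delta> * x - of_int \<Delta> * y \<in> (*) (of_int (\<Delta> * N)) ` int_span c"
    then obtain w where w: "w \<in> int_span c" "of_int \<Delta> * x - of_int \<Delta> * y = of_int (\<Delta> * N) * w" by auto
    then have "of_int \<Delta> * (x - y) = of_int \<Delta> * (of_int N * w)" by (simp add: algebra_simps)
    then have "x - y = of_int N * w" using D(1) by simp
    then show "x - y \<in> (*) (of_int N) ` OK" using w(1) int_span_subset_OK[OF c(2)] by blast
  qed
qed

text \<open>Put \<open>L = Z[c]\<close> and compute the index of \<open>c L\<close> in the ring of
  integers through \<open>L\<close> and through \<open>c OK\<close>. The factors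
  \<open>[OK : L]\<close> and \<open>[c OK : c L]\<close> are equal and finite and cancel, leaving
  the index of \<open>c L\<close> in \<open>L\<close>, the constant coefficient of the minimal
  polynomial and thus the product of the conjugates up to sign.\<close>

lemma primitive_index:
  fixes c :: "'a::field_char_0"
  assumes nf: "number_field TYPE('a)" and c: "primitive_elt c" "alg_int c" "c \<noteq> 0"
  shows "real (add_index OK ((*) c ` OK)) = (\<Prod>\<sigma>\<in>complex_embeddings. cmod (\<sigma> c))"
proof -
  obtain m where m: "is_min_poly m c" using number_field_ex_min_poly[OF nf] .
  obtain M :: "int poly" where M: "m = map_poly of_int M" "lead_coeff M = 1" using min_poly_int[OF m c(2)] .
  note bij = embeddings_bij_roots[OF c(1) m]
  note fac = complex_min_poly_factor[OF m]
  note m = m[unfolded M(1)]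
  obtain \<Delta> where D: "\<Delta> > 0" "\<And>x::'a. x \<in> OK \<Longrightarrow> of_int \<Delta> * x \<in> int_span c"
    using OK_multiple_in_int_span[OF c(1) m M(2) c(2)] by metis
  let ?L = "int_span c"
  have cL: "(*) c ` ?L \<subseteq> ?L" using int_span_mult by auto
  have cO: "(*) c ` OK \<subseteq> OK" using c(2) OK_mult unfolding ring_of_integers_def by auto
  have LO: "?L \<subseteq> OK" by (rule int_span_subset_OK[OF c(2)])
  have gL: "add_subgroup ?L" "add_subgroup ((*) c ` ?L)" "add_subgroup ((*) c ` (OK::'a set))"
    by (simp_all add: int_span_subgroup add_subgroup_scale add_subgroup_OK)
  have pos: "add_index OK ?L > 0"
  proof (rule add_index_pos_mono[OF OK_index_of_int_pos[OF nf D(1)]])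
    show "(*) (of_int \<Delta>) ` OK \<subseteq> ?L" using D(2) by auto
  qed (use LO gL add_subgroup_OK add_subgroup_scale in auto)
  have "add_index OK ((*) c ` ?L) = add_index OK ?L * add_index ?L ((*) c ` ?L)"
    by (rule add_index_mult[OF gL(1,2) cL LO add_subgroup_OK])
  moreover have "add_index OK ((*) c ` ?L) = add_index OK ((*) c ` OK) * add_index ((*) c ` OK) ((*) c ` ?L)"
    by (rule add_index_mult[OF gL(3,2) _ cO add_subgroup_OK]) (use LO in auto)
  moreover have "add_index ((*) c ` OK) ((*) c ` ?L) = add_index OK ?L"
    by (rule add_index_scale[OF c(3) gL(1)])
  ultimately have "add_index OK ((*) c ` OK) = add_index ?L ((*) c ` ?L)" using pos by simp
  also have "\<dots> = nat \<bar>coeff M 0\<bar>" by (rule int_span_index(1)[OF m M(2) c(3)])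
  finally have "real (add_index OK ((*) c ` OK)) = cmod (of_int (coeff M 0))" by simp
  also have "of_int (coeff M 0) = poly (map_poly of_rat m :: complex poly) 0"
    unfolding M(1) by (simp add: poly_0_coeff_0 coeff_map_poly)
  also have "\<dots> = (\<Prod>z\<in>{z. rat_eval m z = 0}. - z)" unfolding fac by (simp add: poly_prod)
  also have "cmod \<dots> = (\<Prod>z\<in>{z. rat_eval m z = 0}. cmod z)" by (simp add: prod_norm[symmetric])
  also have "\<dots> = (\<Prod>\<sigma>\<in>complex_embeddings. cmod (\<sigma> c))"
    by (rule prod.reindex_bij_betw[OF bij, symmetric])
  finally show ?thesis .
qed

text \<open>The absolute value of the field norm to the rationals.\<close>

definition emb_norm :: "'a::field_char_0 \<Rightarrow> real" where
  "emb_norm c = (\<Prod>\<sigma>\<in>complex_embeddings. cmod (\<sigma> c))"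

lemma emb_norm_mult: "emb_norm (x * y) = emb_norm x * emb_norm y"
  unfolding emb_norm_def by (simp add: emb_mult norm_mult prod.distrib)

lemma emb_norm_pos: "c \<noteq> 0 \<Longrightarrow> emb_norm c > 0"
  unfolding emb_norm_def by (intro prod_pos) (auto simp: emb_eq_0_iff)

text \<open>
  For primitive \<open>c\<close> the index of \<open>c\<int>[c]\<close> in \<open>\<int>[c]\<close> is the constant coefficient of the minimal polynomial; as both
  sides are multiplicative, the general case follows by writing \<open>c = (c\<theta>)/\<theta>\<close> with both \<open>c\<theta>\<close> and \<open>\<theta>\<close> primitive.
\<close>

theorem index_principal:
  fixes c :: "'a::field_char_0"
  assumes nf: "number_field TYPE('a)" and c: "alg_int c" "c \<noteq> 0"
  shows "real (add_index OK ((*) c ` OK)) = emb_norm c"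
proof -
  obtain \<theta> :: 'a where th: "primitive_elt \<theta>" "alg_int \<theta>" "primitive_elt (c * \<theta>)" "\<theta> \<noteq> 0"
    using ex_primitive_multiplier[OF nf c(2)] .
  have 1: "real (add_index OK ((*) \<theta> ` OK)) = emb_norm \<theta>"
    by (rule primitive_index[OF nf th(1,2,4), folded emb_norm_def])
  have 2: "real (add_index OK ((*) (c * \<theta>) ` OK)) = emb_norm c * emb_norm \<theta>"
    unfolding emb_norm_mult[symmetric]
    by (rule primitive_index[OF nf th(3), folded emb_norm_def]) (use th c alg_int_mult in auto)
  have img: "(*) (c * \<theta>) ` OK = (*) c ` ((*) \<theta> ` OK)" by (auto simp: image_image mult.assoc)
  have sub: "(*) \<theta> ` OK \<subseteq> OK" "(*) c ` OK \<subseteq> OK" using th(2) c(1) OK_mult unfolding ring_of_integers_def by auto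
  have "add_index OK ((*) (c * \<theta>) ` OK) = add_index OK ((*) c ` OK) * add_index ((*) c ` OK) ((*) c ` ((*) \<theta> ` OK))"
    unfolding img by (rule add_index_mult) (use sub in \<open>auto simp: add_subgroup_scale add_subgroup_OK\<close>)
  also have "add_index ((*) c ` OK) ((*) c ` ((*) \<theta> ` OK)) = add_index OK ((*) \<theta> ` OK)"
    by (rule add_index_scale[OF c(2)]) (simp add: add_subgroup_scale add_subgroup_OK)
  finally have "emb_norm c * emb_norm \<theta> = real (add_index OK ((*) c ` OK)) * emb_norm \<theta>"
    using 1 2 by auto
  then show ?thesis using emb_norm_pos[OF th(4)] by auto
qed

section \<open>The Gauss lemma of Kronecker and Dedekind\<close>

text \<open>With \<open>a\<close> the leading coefficient of \<open>G\<close>,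
  \<open>a \<rho>\<close> is integral because \<open>\<rho>\<close> is a root of a polynomial with
  integral coefficients and leading coefficient \<open>a\<close>. So removing
  \<open>a X^n (X - \<rho>)\<close> keeps the product integral and lowers the degree of
  \<open>G\<close>.\<close>

lemma alg_int_div_linear:
  fixes G :: "'a::field_char_0 poly"
  assumes "\<And>i. alg_int (coeff ([:- \<rho>, 1:] * G) i)"
  shows "alg_int (coeff G i)"
  using assms
proof (induction "degree G" arbitrary: G i rule: less_induct)
  case less
  show ?case
  proof (cases "G = 0")
    case False
    let ?F = "[:- \<rho>, 1:] * G"
    define n where "n = degree G"
    define a where "a = lead_coeff G"
    have dF: "degree ?F = Suc n" using False unfolding n_def by (subst degree_mult_eq) auto
    have lF: "lead_coeff ?F = a" unfolding a_def by (subst lead_coeff_mult) simp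
    have a: "alg_int a" using less.prems lF by metis
    have ar: "alg_int (a * \<rho>)"
      using alg_int_lead_coeff_root[of ?F \<rho>] less.prems dF lF by simp
    define G' where "G' = G - monom a n"
    have cG': "coeff G' j = (if j = n then 0 else coeff G j)" for j
      unfolding G'_def a_def n_def by simp
    have F': "[:- \<rho>, 1:] * G' = ?F - monom a (Suc n) + monom (a * \<rho>) n"
      unfolding G'_def by (simp add: algebra_simps smult_monom monom_Suc smult_diff_right add_monom)
    have int': "alg_int (coeff ([:- \<rho>, 1:] * G') j)" for j
    proof -
      have "alg_int (coeff ?F j)" by (rule less.prems)
      then show ?thesis unfolding F' coeff_add coeff_diff coeff_monom using a ar
        by (intro alg_int_add alg_int_diff) auto
    qed
    have "alg_int (coeff G' j)" for j
    proof (cases "degree G' < degree G")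
      case True
      then show ?thesis using less.hyps int' by blast
    next
      case False
      have "degree G' \<le> n" by (rule degree_le) (auto simp: cG' n_def coeff_eq_0)
      then have "degree G' = n" using False n_def by simp
      then have "lead_coeff G' = 0" using cG'[of n] by simp
      then show ?thesis by simp
    qed
    moreover have "coeff G i = coeff G' i + (if i = n then a else 0)"
      unfolding cG' by (simp add: a_def n_def)
    ultimately show ?thesis using a by (auto intro: alg_int_add)
  qed simp
qed

lemma alg_int_drop_linear_factors:
  fixes H :: "'a::field_char_0 poly"
  assumes "finite B" "\<And>i. alg_int (coeff (H * (\<Prod>b\<in>B. [:- \<rho> b, 1:])) i)"
  shows "alg_int (coeff H i)"
  using assms
proof (induction B rule: finite_induct)
  case (insert b B)
  have "H * (\<Prod>b\<in>insert b B. [:- \<rho> b, 1:]) = [:- \<rho> b, 1:] * (H * (\<Prod>b\<in>B. [:- \<rho> b, 1:]))"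
    using insert(1,2) by (simp add: mult.left_commute)
  then have "alg_int (coeff (H * (\<Prod>b\<in>B. [:- \<rho> b, 1:])) i)" for i
    using alg_int_div_linear[of "\<rho> b"] insert.prems by metis
  then show ?case using insert.IH by blast
qed simp

text \<open>Dividing out the linear factors outside \<open>S\<close> preserves integrality; up to
  sign, the constant coefficient of what remains is the claimed product.\<close>

lemma alg_int_subset_roots:
  fixes a :: "'a::field_char_0"
  assumes A: "finite A" and int: "\<And>i. alg_int (coeff (Polynomial.smult a (\<Prod>b\<in>A. [:- \<rho> b, 1:])) i)" and S: "S \<subseteq> A"
  shows "alg_int (a * (\<Prod>b\<in>S. \<rho> b))"
proof -
  have "(\<Prod>b\<in>A. [:- \<rho> b, 1:]) = (\<Prod>b\<in>S. [:- \<rho> b, 1:]) * (\<Prod>b\<in>A - S. [:- \<rho> b, 1:])"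
    using prod.subset_diff[OF S A, of "\<lambda>b. [:- \<rho> b, 1:]"] by (simp add: mult.commute)
  then have "alg_int (coeff (Polynomial.smult a (\<Prod>b\<in>S. [:- \<rho> b, 1:]) * (\<Prod>b\<in>A - S. [:- \<rho> b, 1:])) i)" for i
    using int[of i] by simp
  then have "alg_int (coeff (Polynomial.smult a (\<Prod>b\<in>S. [:- \<rho> b, 1:])) 0)"
    using alg_int_drop_linear_factors[of "A - S"] A by (metis finite_Diff)
  also have "coeff (Polynomial.smult a (\<Prod>b\<in>S. [:- \<rho> b, 1:])) 0 = a * (\<Prod>b\<in>S. - \<rho> b)"
    by (simp add: poly_0_coeff_0[symmetric] poly_prod)
  also have "(\<Prod>b\<in>S. - \<rho> b) = (-1) ^ card S * (\<Prod>b\<in>S. \<rho> b)"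
    using prod.distrib[of "\<lambda>_. -1" \<rho> S] by simp
  finally have "alg_int (a * ((-1) ^ card S * (\<Prod>b\<in>S. \<rho> b)))" .
  then have "alg_int ((-1) ^ card S * (a * ((-1) ^ card S * (\<Prod>b\<in>S. \<rho> b))))"
    using alg_int_mult alg_int_power alg_int_of_int[of "-1"] by (metis of_int_1 of_int_minus)
  moreover have "(-1) ^ card S * (a * ((-1) ^ card S * (\<Prod>b\<in>S. \<rho> b))) = a * (\<Prod>b\<in>S. \<rho> b)"
    by (cases "even (card S)") auto
  ultimately show ?thesis by simp
qed

text \<open>A coefficient of a product of linear factors is a signed sum of products over sets of
  roots. The induction moves the root split off last into the scalar \<open>x\<close>.\<close>

lemma alg_int_coeff_from_subset_roots:
  fixes x :: "'a::field_char_0"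
  assumes "finite A" "\<And>S. S \<subseteq> A \<Longrightarrow> alg_int (x * (\<Prod>b\<in>S. \<rho> b))"
  shows "alg_int (x * coeff (\<Prod>b\<in>A. [:- \<rho> b, 1:]) i)"
  using assms
proof (induction A arbitrary: x i rule: finite_induct)
  case empty
  then show ?case by (auto simp: coeff_1 dest: spec[of _ "{}"])
next
  case (insert r A)
  let ?P = "\<Prod>b\<in>A. [:- \<rho> b, 1:]"
  have 1: "alg_int (x * coeff ?P j)" for j
    using insert.prems by (intro insert.IH) auto
  have 2: "alg_int ((x * \<rho> r) * coeff ?P j)" for j
  proof (rule insert.IH)
    fix S assume "S \<subseteq> A"
    then have "r \<notin> S" "finite S" using insert(1,2) finite_subset by auto
    then show "alg_int (x * \<rho> r * (\<Prod>b\<in>S. \<rho> b))"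
      using insert.prems[of "insert r S"] \<open>S \<subseteq> A\<close> by (auto simp: mult.assoc)
  qed
  have "x * coeff (\<Prod>b\<in>insert r A. [:- \<rho> b, 1:]) i = (if i = 0 then 0 else x * coeff ?P (i - 1)) - (x * \<rho> r) * coeff ?P i"
    using insert(1,2) by (cases i) (auto simp: algebra_simps)
  then show ?case using 1 2 by (auto intro: alg_int_diff alg_int_uminus)
qed

text \<open>Roots are listed by an index so that multiple roots, and roots common to two
  polynomials, remain separate factors.\<close>

lemma complex_poly_indexed_roots:
  fixes f :: "complex poly"
  obtains \<rho> :: "nat \<Rightarrow> complex" where "f = Polynomial.smult (lead_coeff f) (\<Prod>b<degree f. [:- \<rho> b, 1:])"
proof -
  obtain as where as: "Polynomial.smult (coeff f (degree f)) (\<Prod>a\<leftarrow>as. [:- a, 1:]) = f" "length as = degree f"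
    using fundamental_theorem_algebra_factorized[of f] by auto
  have "(\<Prod>a\<leftarrow>as. [:- a, 1:]) = (\<Prod>b<degree f. [:- as ! b, 1:])"
    using as(2) by (simp add: prod.list_conv_set_nth atLeast0LessThan)
  then show ?thesis using as(1) that[of "\<lambda>i. as ! i"] by simp
qed

text \<open>After extracting leading coefficients, \<open>coeff f i * coeff g j / k\<close> is a
  signed sum of terms \<open>c\<close> times a set of roots of \<open>f\<close> times a set of roots
  of \<open>g\<close>. Each such term is \<open>c\<close> times a product over a set of roots of
  \<open>f * g\<close>, hence integral by the integrality of \<open>f * g / k\<close>.\<close>

lemma complex_gauss_kronecker:
  fixes f g :: "complex poly"
  assumes k: "k \<noteq> 0" and int: "\<And>i. alg_int (coeff (f * g) i / k)"
  shows "alg_int (coeff f i * coeff g j / k)"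
proof -
  obtain \<rho> where \<rho>: "f = Polynomial.smult (lead_coeff f) (\<Prod>b<degree f. [:- \<rho> b, 1:])" using complex_poly_indexed_roots .
  obtain \<tau> where \<tau>: "g = Polynomial.smult (lead_coeff g) (\<Prod>b<degree g. [:- \<tau> b, 1:])" using complex_poly_indexed_roots .
  define m n where "m = degree f" and "n = degree g"
  define c where "c = lead_coeff f * lead_coeff g / k"
  define F where "F = (\<Prod>b<m. [:- \<rho> b, 1:])"
  define G where "G = (\<Prod>b<n. [:- \<tau> b, 1:])"
  have fF: "f = Polynomial.smult (lead_coeff f) F" and gG: "g = Polynomial.smult (lead_coeff g) G"
    unfolding F_def G_def m_def n_def by (rule \<rho>, rule \<tau>)
  have int': "alg_int (coeff (Polynomial.smult c (F * G)) i)" for i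
  proof -
    have "f * g = Polynomial.smult (lead_coeff f * lead_coeff g) (F * G)"
      by (subst fF, subst gG) (simp add: mult.commute)
    then show ?thesis using int[of i] unfolding c_def by simp
  qed
  \<comment> \<open>The two root lists are concatenated: indices below \<open>m\<close> belong to
    \<open>f\<close>, the following \<open>n\<close> to \<open>g\<close>.\<close>
  define \<mu> where "\<mu> b = (if b < m then \<rho> b else \<tau> (b - m))" for b
  have G\<mu>: "G = (\<Prod>b\<in>{m..<m + n}. [:- \<mu> b, 1:])"
    unfolding G_def \<mu>_def
    by (rule prod.reindex_bij_witness[of _ "\<lambda>b. b - m" "\<lambda>b. b + m"]) auto
  have F\<mu>: "F = (\<Prod>b\<in>{..<m}. [:- \<mu> b, 1:])" unfolding F_def \<mu>_def by simp
  have "F * G = (\<Prod>b\<in>{..<m} \<union> {m..<m+n}. [:- \<mu> b, 1:])"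
    unfolding F\<mu> G\<mu> by (rule prod.union_disjoint[symmetric]) auto
  then have sub: "alg_int (c * (\<Prod>b\<in>S. \<mu> b))" if "S \<subseteq> {..<m} \<union> {m..<m+n}" for S
    using int' that by (intro alg_int_subset_roots[of "{..<m} \<union> {m..<m+n}"]) auto
  have 1: "alg_int ((c * (\<Prod>b\<in>T. \<mu> b)) * coeff F i)" if T: "T \<subseteq> {m..<m+n}" for T
    unfolding F\<mu>
  proof (rule alg_int_coeff_from_subset_roots)
    fix S assume S: "S \<subseteq> {..<m}"
    have "T \<inter> S = {}" using S T by fastforce
    then have "(\<Prod>b\<in>T \<union> S. \<mu> b) = (\<Prod>b\<in>T. \<mu> b) * (\<Prod>b\<in>S. \<mu> b)"
      using finite_subset[OF S] finite_subset[OF T] by (intro prod.union_disjoint) auto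
    then show "alg_int (c * (\<Prod>b\<in>T. \<mu> b) * (\<Prod>b\<in>S. \<mu> b))"
      using sub[of "T \<union> S"] S T by (auto simp: mult.assoc)
  qed simp
  have "alg_int ((c * coeff F i) * coeff G j)"
    unfolding G\<mu>
  proof (rule alg_int_coeff_from_subset_roots)
    fix T assume "T \<subseteq> {m..<m+n}"
    from 1[OF this] show "alg_int (c * coeff F i * (\<Prod>b\<in>T. \<mu> b))" by (simp add: mult_ac)
  qed simp
  moreover have "coeff f i * coeff g j / k = (c * coeff F i) * coeff G j"
    by (subst fF, subst gG) (simp add: c_def)
  ultimately show ?thesis by simp
qed

text \<open>A single complex embedding suffices, since embeddings both preserve and reflect
  integrality; the splitting into linear factors takes place over the complex numbers.\<close>

lemma gauss_kronecker:
  fixes f g :: "'a::field_char_0 poly"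
  assumes nf: "number_field TYPE('a)" and k: "k \<noteq> 0" and int: "\<And>i. alg_int (coeff (f * g) i / k)"
  shows "alg_int (coeff f i * coeff g j / k)"
proof -
  obtain \<sigma> :: "'a \<Rightarrow> complex" where s: "\<sigma> \<in> complex_embeddings"
    using finite_embeddings(2)[OF nf] by (metis card_gt_0_iff ex_in_conv)
  have div: "\<sigma> (x / k) = \<sigma> x / \<sigma> k" for x
    using k emb_mult[OF s, of "x / k" k] emb_eq_0_iff[OF s, of k] by (simp add: field_simps)
  have cs: "coeff (map_poly \<sigma> p) i = \<sigma> (coeff p i)" for p i by (simp add: coeff_map_poly emb_0[OF s])
  have "map_poly \<sigma> f * map_poly \<sigma> g = map_poly \<sigma> (f * g)"
    by (rule poly_eqI) (simp add: cs coeff_mult emb_sum[OF s] emb_mult[OF s])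
  then have "alg_int (coeff (map_poly \<sigma> f * map_poly \<sigma> g) i / \<sigma> k)" for i
    using int[of i] by (simp add: cs div[symmetric] emb_alg_int_iff[OF s])
  then have "alg_int (coeff (map_poly \<sigma> f) i * coeff (map_poly \<sigma> g) j / \<sigma> k)"
    using k emb_eq_0_iff[OF s, of k] by (intro complex_gauss_kronecker) auto
  then show ?thesis by (simp add: cs emb_mult[OF s, symmetric] div[symmetric] emb_alg_int_iff[OF s])
qed

lemma common_alg_int_multiple:
  fixes S :: "'a::field_char_0 set"
  assumes nf: "number_field TYPE('a)" and "finite S"
  obtains N :: int where "N > 0" "\<And>x. x \<in> S \<Longrightarrow> alg_int (of_int N * x)"
proof -
  have "\<exists>N::int. N > 0 \<and> (\<forall>x\<in>S. alg_int (of_int N * x))" using assms(2)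
  proof (induction rule: finite_induct)
    case (insert x S)
    then obtain N :: int where N: "N > 0" "\<forall>x\<in>S. alg_int (of_int N * x)" by auto
    obtain M :: int where M: "M > 0" "alg_int (of_int M * x)" using alg_int_multiple[OF nf] .
    have "alg_int (of_int N * (of_int M * x))" by (rule alg_int_mult[OF alg_int_of_int M(2)])
    then have x: "alg_int (of_int (M * N) * x)" by (simp add: mult_ac)
    have y: "alg_int (of_int (M * N) * y)" if "y \<in> S" for y
    proof -
      have "alg_int (of_int N * y)" using N(2) that by blast
      then have "alg_int (of_int M * (of_int N * y))" by (rule alg_int_mult[OF alg_int_of_int])
      then show ?thesis by (simp only: of_int_mult mult.assoc)
    qed
    have "\<forall>y\<in>insert x S. alg_int (of_int (M * N) * y)" using x y by blast
    moreover have "M * N > 0" using M(1) N(1) by simp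
    ultimately show ?case by blast
  qed (auto intro: exI[of _ 1])
  then show ?thesis using that by blast
qed

text \<open>Residues modulo \<open>f\<close> form a finite-dimensional rational vector space, so
  powers of \<open>X\<close> become dependent there. This stands in for the norm of
  \<open>f\<close>.\<close>

lemma poly_divides_rat_poly:
  fixes f :: "'a::field_char_0 poly"
  assumes nf: "number_field TYPE('a)" and f: "f \<noteq> 0"
  obtains h :: "rat poly" where "h \<noteq> 0" "f dvd map_poly of_rat h"
proof -
  interpret V: vector_space "\<lambda>r (p::'a poly). Polynomial.smult (of_rat r) p"
    by unfold_locales (simp_all add: smult_add_right smult_add_left of_rat_add of_rat_mult)
  obtain B :: "'a set" where B: "finite B" "\<And>x. \<exists>c. x = (\<Sum>b\<in>B. of_rat (c b) * b)"
    using nf unfolding number_field_def by auto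
  define T where "T = (\<lambda>(b,i). monom b i) ` (B \<times> {..degree f})"
  have T: "finite T" unfolding T_def using B(1) by simp
  have span: "p \<in> V.span T" if "degree p \<le> degree f" for p
  proof -
    obtain c where c: "\<And>x. x = (\<Sum>b\<in>B. of_rat (c x b) * b)" using B(2) by metis
    have "p = (\<Sum>i\<le>degree p. monom (coeff p i) i)" by (simp add: poly_as_sum_of_monoms)
    also have "\<dots> = (\<Sum>i\<le>degree p. \<Sum>b\<in>B. Polynomial.smult (of_rat (c (coeff p i) b)) (monom b i))"
      by (subst c) (simp add: smult_monom monom_sum)
    also have "\<dots> \<in> V.span T"
      using that by (intro V.span_sum V.span_scale V.span_base) (auto simp: T_def intro!: image_eqI[of _ _ "(b, i)" for b i])
    finally show ?thesis .
  qed
  define N where "N = card T"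
  have "(\<lambda>i. monom 1 i mod f) ` {..N} \<subseteq> V.span T"
  proof
    fix p assume "p \<in> (\<lambda>i. monom 1 i mod f) ` {..N}"
    then obtain i where "p = monom 1 i mod f" by auto
    then have "degree p \<le> degree f" using degree_mod_less[OF f, of "monom 1 i"] by auto
    then show "p \<in> V.span T" by (rule span)
  qed
  then obtain c where c: "\<exists>i\<in>{..N}. c i \<noteq> 0"
      "(\<Sum>i\<in>{..N}. Polynomial.smult (of_rat (c i)) (monom 1 i mod f)) = 0"
    using V.dependent_family[OF T, of "\<lambda>i. monom 1 i mod f" "{..N}"] N_def by auto
  define h where "h = (\<Sum>i\<le>N. monom (c i) i)"
  have ch: "coeff h i = (if i \<le> N then c i else 0)" for i unfolding h_def by (simp add: coeff_sum)
  have "h \<noteq> 0" using c(1) ch by (metis atMost_iff coeff_0)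
  have "map_poly of_rat h = (\<Sum>i\<le>N. Polynomial.smult (of_rat (c i)) (monom 1 i) :: 'a poly)"
    by (rule poly_eqI) (simp add: coeff_map_poly ch coeff_sum if_distrib cong: if_cong)
  then have "map_poly of_rat h mod f = (\<Sum>i\<le>N. Polynomial.smult (of_rat (c i)) (monom 1 i mod f))"
    by (simp add: poly_mod_sum mod_smult_left)
  then have "map_poly of_rat h mod f = 0" using c(2) by simp
  then have "f dvd map_poly of_rat h" by (simp only: mod_eq_0_iff_dvd)
  then show ?thesis using \<open>h \<noteq> 0\<close> that by blast
qed

text \<open>Content 1 is the point: it later forces the scaling constant itself into a product of
  coefficient ideals.\<close>

lemma poly_divides_primitive_int_poly:
  fixes f :: "'a::field_char_0 poly"
  assumes nf: "number_field TYPE('a)" and f: "f \<noteq> 0"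
  obtains h :: "int poly" where "Polynomial.content h = 1" "f dvd map_poly of_int h"
proof -
  obtain h :: "rat poly" where h: "h \<noteq> 0" "f dvd map_poly of_rat h" using poly_divides_rat_poly[OF nf f] .
  obtain N and P :: "int poly" where N: "N > 0" "Polynomial.smult (of_int N) h = map_poly of_int P"
    using rat_poly_denominator[of h] .
  have "P \<noteq> 0" using N h by auto
  have "Polynomial.smult (of_int N) (map_poly of_rat h :: 'a poly) = map_poly of_int P"
  proof (rule poly_eqI)
    fix i
    have "of_rat (coeff (Polynomial.smult (of_int N) h) i) = (of_rat (coeff (map_poly of_int P) i) :: 'a)" using N(2) by simp
    then show "coeff (Polynomial.smult (of_int N) (map_poly of_rat h :: 'a poly)) i = coeff (map_poly of_int P) i"
      by (simp add: coeff_map_poly of_rat_mult)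
  qed
  then have "f dvd (map_poly of_int P :: 'a poly)" using dvd_smult[OF h(2)] by metis
  also have "(map_poly of_int P :: 'a poly) = map_poly of_int (Polynomial.smult (Polynomial.content P) (primitive_part P))" by simp
  also have "\<dots> = Polynomial.smult (of_int (Polynomial.content P)) (map_poly of_int (primitive_part P))" by (simp only: hom_distribs)
  finally have "f dvd map_poly of_int (primitive_part P)"
    using \<open>P \<noteq> 0\<close> by (subst (asm) dvd_smult_iff) auto
  then show ?thesis using that[of "primitive_part P"] \<open>P \<noteq> 0\<close> by simp
qed

section \<open>Powers of ideals\<close>

definition ok_module :: "'a::field_char_0 set \<Rightarrow> bool" where
  "ok_module M \<longleftrightarrow> add_subgroup M \<and> (\<forall>r\<in>OK. \<forall>x\<in>M. r * x \<in> M)"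

lemma ok_module_subgroup: "ok_module M \<Longrightarrow> add_subgroup M"
  and ok_module_mult: "ok_module M \<Longrightarrow> r \<in> OK \<Longrightarrow> x \<in> M \<Longrightarrow> r * x \<in> M"
  unfolding ok_module_def by auto

lemma ok_module_0: "ok_module M \<Longrightarrow> 0 \<in> M"
  and ok_module_add: "ok_module M \<Longrightarrow> x \<in> M \<Longrightarrow> y \<in> M \<Longrightarrow> x + y \<in> M"
  and ok_module_diff: "ok_module M \<Longrightarrow> x \<in> M \<Longrightarrow> y \<in> M \<Longrightarrow> x - y \<in> M"
  using ok_module_subgroup add_subgroup_0 add_subgroup_add add_subgroup_diff by blast+

lemma ok_module_sum: "ok_module M \<Longrightarrow> (\<And>i. i \<in> A \<Longrightarrow> f i \<in> M) \<Longrightarrow> sum f A \<in> M"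
  by (induction A rule: infinite_finite_induct) (auto simp: ok_module_0 ok_module_add)

lemma ok_moduleI:
  assumes "0 \<in> M" "\<And>x y. x \<in> M \<Longrightarrow> y \<in> M \<Longrightarrow> x - y \<in> M" "\<And>r x. r \<in> OK \<Longrightarrow> x \<in> M \<Longrightarrow> r * x \<in> M"
  shows "ok_module M"
  unfolding ok_module_def add_subgroup_def using assms by auto

lemma ok_module_OK: "ok_module OK"
  by (rule ok_moduleI) (auto simp: OK_0 OK_mult add_subgroup_diff[OF add_subgroup_OK])

text \<open>Colon modules serve as targets for the minimality of generated ideals and of
  \<open>mod_prod\<close>, so that inclusions are checked on generators only.\<close>

lemma ok_module_colon: "ok_module M \<Longrightarrow> ok_module {y. \<forall>x\<in>A. x * y \<in> M}"
  by (rule ok_moduleI) (auto simp: ok_module_0 ok_module_diff right_diff_distrib mult.left_commute ok_module_mult)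

lemma ok_module_scale: 
  assumes "ok_module M" shows "ok_module ((*) a ` M)"
  unfolding ok_module_def
proof (intro conjI ballI add_subgroup_scale ok_module_subgroup assms)
  fix r x :: 'a assume "r \<in> OK" "x \<in> (*) a ` M"
  then obtain y where "y \<in> M" "x = a * y" by auto
  then show "r * x \<in> (*) a ` M" using ok_module_mult[OF assms \<open>r \<in> OK\<close>, of y]
    by (intro image_eqI[of _ _ "r * y"]) auto
qed

lemma ok_module_gen_ideal: "ok_module (gen_ideal xs)"
proof (rule ok_moduleI)
  show "0 \<in> gen_ideal xs" unfolding gen_ideal_def
    by (intro CollectI exI[of _ "\<lambda>_. 0"]) (auto simp: OK_0)
  fix x y assume "x \<in> gen_ideal xs" "y \<in> gen_ideal xs"
  then obtain r s where "x = (\<Sum>i<length xs. r i * xs ! i)" "\<forall>i. r i \<in> OK"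
    "y = (\<Sum>i<length xs. s i * xs ! i)" "\<forall>i. s i \<in> OK" unfolding gen_ideal_def by auto
  then show "x - y \<in> gen_ideal xs" unfolding gen_ideal_def
    by (intro CollectI exI[of _ "\<lambda>i. r i - s i"])
      (auto simp: left_diff_distrib sum_subtractf add_subgroup_diff[OF add_subgroup_OK])
next
  fix r x :: 'a assume r: "r \<in> OK" "x \<in> gen_ideal xs"
  then obtain s where "x = (\<Sum>i<length xs. s i * xs ! i)" "\<forall>i. s i \<in> OK" unfolding gen_ideal_def by auto
  then show "r * x \<in> gen_ideal xs" unfolding gen_ideal_def using r
    by (intro CollectI exI[of _ "\<lambda>i. r * s i"]) (auto simp: sum_distrib_left mult.assoc OK_mult)
qed

lemma gen_ideal_base: assumes "x \<in> set xs" shows "x \<in> gen_ideal xs"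
proof -
  obtain i where i: "i < length xs" "x = xs ! i" using assms by (auto simp: in_set_conv_nth)
  have "(\<Sum>j<length xs. (if j = i then 1 else 0) * xs ! j) = (\<Sum>j<length xs. if j = i then xs ! j else 0)"
    by (intro sum.cong) auto
  also have "\<dots> = x" using i by simp
  finally have "x = (\<Sum>j<length xs. (if j = i then 1 else 0) * xs ! j)" ..
  moreover have "\<forall>j. (if j = i then 1 else 0 :: 'a) \<in> OK" by (auto simp: OK_0 OK_1)
  ultimately show ?thesis unfolding gen_ideal_def by (intro CollectI exI conjI)
qed

lemma gen_ideal_minimal: "ok_module M \<Longrightarrow> set xs \<subseteq> M \<Longrightarrow> gen_ideal xs \<subseteq> M"
  unfolding gen_ideal_def by (auto intro!: ok_module_sum ok_module_mult)

text \<open>The product of ideals, taken as the least module containing all products instead of as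
  finite sums, so that upper bounds follow from minimality.\<close>

definition mod_prod :: "'a::field_char_0 set \<Rightarrow> 'a set \<Rightarrow> 'a set" where
  "mod_prod I J = \<Inter>{M. ok_module M \<and> (\<forall>x\<in>I. \<forall>y\<in>J. x * y \<in> M)}"

lemma ok_module_mod_prod: "ok_module (mod_prod I J)"
  unfolding mod_prod_def by (rule ok_moduleI) (auto simp: ok_module_0 ok_module_diff ok_module_mult)

lemma mod_prod_mem: "x \<in> I \<Longrightarrow> y \<in> J \<Longrightarrow> x * y \<in> mod_prod I J"
  unfolding mod_prod_def by auto

lemma mod_prod_minimal: "ok_module M \<Longrightarrow> (\<And>x y. x \<in> I \<Longrightarrow> y \<in> J \<Longrightarrow> x * y \<in> M) \<Longrightarrow> mod_prod I J \<subseteq> M"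
  unfolding mod_prod_def by auto

lemma mod_prod_mono: "J \<subseteq> J' \<Longrightarrow> mod_prod I J \<subseteq> mod_prod I J'"
  by (rule mod_prod_minimal[OF ok_module_mod_prod]) (auto intro: mod_prod_mem)

lemma mod_prod_OK: assumes "ok_module I" shows "mod_prod I OK = I"
proof
  show "mod_prod I OK \<subseteq> I"
    by (rule mod_prod_minimal[OF assms]) (metis ok_module_mult[OF assms] mult.commute)
  show "I \<subseteq> mod_prod I OK"
  proof
    fix x assume "x \<in> I"
    then show "x \<in> mod_prod I OK" using mod_prod_mem[of x I 1 OK] OK_1 by simp
  qed
qed

lemma add_index_eq_1D:
  assumes H: "add_subgroup H" "add_subgroup G" and sub: "H \<subseteq> G" and idx: "add_index G H = 1"
  shows "G = H"
proof -
  obtain T where T: "transversal T G H" using ex_transversal[OF H(1)] .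
  have "card T = 1" using transversal_card[OF H(1) T] idx by simp
  then obtain t where t: "T = {t}" by (auto simp: card_1_singleton_iff)
  have "x \<in> H" if "x \<in> G" for x
  proof -
    have "x - t \<in> H" "0 - t \<in> H" using T that add_subgroup_0[OF H(2)] unfolding transversal_def t by auto
    then show ?thesis using add_subgroup_diff[OF H(1), of "x - t" "0 - t"] by simp
  qed
  then show ?thesis using sub by blast
qed

lemma add_index_self: assumes "add_subgroup G" shows "add_index G G = 1"
proof -
  have "transversal {0} G G" using assms unfolding transversal_def by (auto simp: add_subgroup_0)
  then show ?thesis using transversal_card[OF assms] by fastforce
qed

text \<open>\<open>J\<close> contains the principal ideal of \<open>a\<close>, whose index is the
  norm of \<open>a\<close> and hence positive.\<close>

lemma ideal_index_pos:
  fixes J :: "'a::field_char_0 set"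
  assumes nf: "number_field TYPE('a)" and J: "ok_module J" "J \<subseteq> OK" and a: "a \<in> J" "a \<noteq> 0"
  shows "add_index OK J > 0"
proof -
  have "real (add_index OK ((*) a ` OK)) > 0"
    using index_principal[OF nf _ a(2)] emb_norm_pos[OF a(2)] a J unfolding ring_of_integers_def by auto
  then have "add_index OK ((*) a ` OK) > 0" by simp
  then show ?thesis
  proof (rule add_index_pos_mono)
    show "(*) a ` OK \<subseteq> J" using ok_module_mult[OF J(1) _ a(1)] by (auto simp: mult.commute)
  qed (use J in \<open>auto simp: add_subgroup_OK add_subgroup_scale ok_module_subgroup\<close>)
qed

definition mod_adjoin :: "'a::field_char_0 set \<Rightarrow> 'a \<Rightarrow> 'a set" where
  "mod_adjoin L y = {l + r * y | l r. l \<in> L \<and> r \<in> OK}"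

lemma mod_adjoin:
  assumes L: "ok_module L"
  shows "ok_module (mod_adjoin L y)" "L \<subseteq> mod_adjoin L y" "y \<in> mod_adjoin L y"
    "\<And>M. ok_module M \<Longrightarrow> L \<subseteq> M \<Longrightarrow> y \<in> M \<Longrightarrow> mod_adjoin L y \<subseteq> M"
proof -
  show "ok_module (mod_adjoin L y)"
  proof (rule ok_moduleI)
    show "0 \<in> mod_adjoin L y" unfolding mod_adjoin_def
      by (intro CollectI exI[of _ 0]) (auto simp: ok_module_0[OF L] OK_0)
    fix x x' assume "x \<in> mod_adjoin L y" "x' \<in> mod_adjoin L y"
    then obtain l r l' r' where "x = l + r * y" "l \<in> L" "r \<in> OK" "x' = l' + r' * y" "l' \<in> L" "r' \<in> OK"
      unfolding mod_adjoin_def by auto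
    then show "x - x' \<in> mod_adjoin L y" unfolding mod_adjoin_def
      by (intro CollectI exI[of _ "l - l'"] exI[of _ "r - r'"])
        (auto simp: algebra_simps ok_module_diff[OF L] ok_module_diff[OF ok_module_OK])
  next
    fix s x :: 'a assume s: "s \<in> OK" "x \<in> mod_adjoin L y"
    then obtain l r where "x = l + r * y" "l \<in> L" "r \<in> OK" unfolding mod_adjoin_def by auto
    then show "s * x \<in> mod_adjoin L y" unfolding mod_adjoin_def using s
      by (intro CollectI exI[of _ "s * l"] exI[of _ "s * r"])
        (auto simp: distrib_left mult.assoc ok_module_mult[OF L] OK_mult)
  qed
  show "L \<subseteq> mod_adjoin L y" unfolding mod_adjoin_def
  proof
    fix l assume "l \<in> L"
    then show "l \<in> {l + r * y | l r. l \<in> L \<and> r \<in> OK}"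
      by (intro CollectI exI[of _ l] exI[of _ 0]) (auto simp: OK_0)
  qed
  show "y \<in> mod_adjoin L y" unfolding mod_adjoin_def
    by (intro CollectI exI[of _ 0] exI[of _ 1]) (auto simp: OK_1 ok_module_0[OF L])
  show "mod_adjoin L y \<subseteq> M" if "ok_module M" "L \<subseteq> M" "y \<in> M" for M
    unfolding mod_adjoin_def using that by (auto intro!: ok_module_add ok_module_mult)
qed

text \<open>
  If \<open>L/L'\<close> is simple, it is isomorphic to \<open>OK/P\<close> for a maximal ideal \<open>P\<close>, and \<open>P\<close> annihilates the nonzero
  module \<open>IL/IL'\<close>, which therefore contains a copy of \<open>OK/P\<close>.
\<close>

lemma index_le_index_mod_prod_simple:
  fixes I :: "'a::field_char_0 set"
  assumes L: "ok_module L" and L': "ok_module L'" and sub: "L' \<subseteq> L"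
    and simple: "\<And>N. ok_module N \<Longrightarrow> L' \<subset> N \<Longrightarrow> N \<subseteq> L \<Longrightarrow> N = L"
    and y: "y \<in> L" "y \<notin> L'" and z: "z \<in> mod_prod I L" "z \<notin> mod_prod I L'"
    and fin: "add_index (mod_prod I L) (mod_prod I L') > 0"
  shows "add_index L L' \<le> add_index (mod_prod I L) (mod_prod I L')"
proof -
  have gen: "mod_adjoin L' w = L" if "w \<in> L" "w \<notin> L'" for w
    using mod_adjoin[OF L', where y = w] that L sub by (intro simple) auto
  have "\<forall>x\<in>L. \<exists>r. r \<in> OK \<and> x - r * y \<in> L'"
  proof
    fix x assume "x \<in> L"
    then have "x \<in> mod_adjoin L' y" using gen[OF y] by simp
    then show "\<exists>r. r \<in> OK \<and> x - r * y \<in> L'" unfolding mod_adjoin_def by auto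
  qed
  then obtain \<rho> where \<rho>: "\<And>x. x \<in> L \<Longrightarrow> \<rho> x \<in> OK \<and> x - \<rho> x * y \<in> L'" by metis
  let ?P = "mod_prod I L" and ?P' = "mod_prod I L'"
  show ?thesis
  proof (rule add_index_le_if_map(2)[OF _ _ fin])
    show "add_subgroup L'" "add_subgroup ?P'" using L' ok_module_mod_prod ok_module_subgroup by blast+
    show "\<rho> x * z \<in> ?P" if "x \<in> L" for x using ok_module_mult[OF ok_module_mod_prod] \<rho>[OF that] z(1) by blast
    show "L \<noteq> {}" using y by blast
    fix a b assume ab: "a \<in> L" "b \<in> L" "\<rho> a * z - \<rho> b * z \<in> ?P'"
    define r where "r = \<rho> a - \<rho> b"
    have rO: "r \<in> OK" unfolding r_def using \<rho> ab ok_module_diff[OF ok_module_OK] by blast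
    have rz: "r * z \<in> ?P'" using ab(3) unfolding r_def by (simp add: left_diff_distrib)
    \<comment> \<open>The comparison map is \<open>x\<close> to \<open>\<rho> x * z\<close>.
      Separating cosets amounts to this: if \<open>r\<close> sends \<open>z\<close> into
      \<open>mod_prod I L'\<close>, it sends \<open>y\<close> into \<open>L'\<close>.\<close>
    have ry: "r * y \<in> L'"
    proof (rule ccontr)
      assume nin: "r * y \<notin> L'"
      have "r * y \<in> L" using ok_module_mult[OF L rO y(1)] .
      then have "y \<in> mod_adjoin L' (r * y)" using gen[OF _ nin] y(1) by simp
      then obtain l s where ls: "y = l + s * (r * y)" "l \<in> L'" "s \<in> OK" unfolding mod_adjoin_def by auto
      \<comment> \<open>\<open>t\<close> maps \<open>L\<close> into \<open>L'\<close>, hence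
        \<open>mod_prod I L\<close> into \<open>mod_prod I L'\<close>. As \<open>r * z\<close> also
        lies there, so would \<open>z = t * z + s * (r * z)\<close>.\<close>
      define t where "t = 1 - s * r"
      have tO: "t \<in> OK" unfolding t_def using OK_1 OK_mult[OF ls(3) rO] ok_module_diff[OF ok_module_OK] by blast
      have "t * y = l" unfolding t_def using ls(1) by (simp add: algebra_simps)
      then have ty: "t * y \<in> L'" using ls(2) by simp
      have tL: "t * x \<in> L'" if "x \<in> L" for x
      proof -
        have "t * (x - \<rho> x * y) + \<rho> x * (t * y) \<in> L'"
          by (rule ok_module_add[OF L' ok_module_mult[OF L' tO conjunct2[OF \<rho>[OF that]]]
                ok_module_mult[OF L' conjunct1[OF \<rho>[OF that]] ty]])
        then show ?thesis by (simp add: algebra_simps)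
      qed
      have "?P \<subseteq> {w. \<forall>x\<in>{t}. x * w \<in> ?P'}"
      proof (rule mod_prod_minimal[OF ok_module_colon[OF ok_module_mod_prod]])
        fix i x assume "i \<in> I" "x \<in> L"
        then show "i * x \<in> {w. \<forall>x\<in>{t}. x * w \<in> ?P'}"
          using mod_prod_mem[of i I "t * x" L'] tL by (simp add: mult.left_commute)
      qed
      then have "t * z \<in> ?P'" using z(1) by blast
      moreover have "s * (r * z) \<in> ?P'" by (rule ok_module_mult[OF ok_module_mod_prod ls(3) rz])
      ultimately have "t * z + s * (r * z) \<in> ?P'" by (rule ok_module_add[OF ok_module_mod_prod])
      then show False using z(2) unfolding t_def by (simp add: algebra_simps)
    qed
    have "(a - \<rho> a * y) - (b - \<rho> b * y) + r * y \<in> L'"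
      by (rule ok_module_add[OF L' ok_module_diff[OF L' conjunct2[OF \<rho>[OF ab(1)]] conjunct2[OF \<rho>[OF ab(2)]]] ry])
    then show "a - b \<in> L'" unfolding r_def by (simp add: algebra_simps)
  qed
qed

text \<open>Choose \<open>N\<close> strictly above \<open>L'\<close> with least index over
  \<open>L'\<close>, so that \<open>N/L'\<close> is simple. Cancellation makes the product with
  \<open>N\<close> strictly larger than that with \<open>L'\<close>, the simple case bounds this
  layer, and induction on the index treats \<open>L\<close> over \<open>N\<close>.\<close>

lemma index_le_index_mod_prod:
  fixes I :: "'a::field_char_0 set"
  assumes cancel: "\<And>L L'. ok_module L \<Longrightarrow> ok_module L' \<Longrightarrow> mod_prod I L \<subseteq> mod_prod I L' \<Longrightarrow> L \<subseteq> L'"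
    and L: "ok_module L" and L': "ok_module L'" and sub: "L' \<subseteq> L"
    and fin: "add_index (mod_prod I L) (mod_prod I L') > 0" and finL: "add_index L L' > 0"
  shows "add_index L L' \<le> add_index (mod_prod I L) (mod_prod I L')"
  using L L' sub fin finL
proof (induction "add_index L L'" arbitrary: L L' rule: less_induct)
  case less
  note L = less.prems(1) and L' = less.prems(2) and sub = less.prems(3) and fin = less.prems(4) and finL = less.prems(5)
  note grp = ok_module_subgroup
  show ?case
  proof (cases "L = L'")
    case True
    then show ?thesis using fin add_index_self[OF grp[OF L']] by simp
  next
    case False
    define Q where "Q N \<longleftrightarrow> ok_module N \<and> L' \<subset> N \<and> N \<subseteq> L" for N
    have "Q L" unfolding Q_def using L sub False by auto
    then obtain N where N: "Q N" "\<And>N'. Q N' \<Longrightarrow> add_index N L' \<le> add_index N' L'"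
      using ex_has_least_nat[of Q L "\<lambda>N. add_index N L'"] by blast
    have mN: "ok_module N" "L' \<subseteq> N" "L' \<noteq> N" "N \<subseteq> L" using N(1) unfolding Q_def by auto
    have e1: "add_index L L' = add_index L N * add_index N L'"
      by (rule add_index_mult[OF grp[OF mN(1)] grp[OF L'] mN(2,4) grp[OF L]])
    have simple: "N' = N" if N': "ok_module N'" "L' \<subset> N'" "N' \<subseteq> N" for N'
    proof -
      have "Q N'" unfolding Q_def using N' mN by auto
      then have le: "add_index N L' \<le> add_index N' L'" by (rule N(2))
      have "add_index N L' = add_index N N' * add_index N' L'"
        using N' by (intro add_index_mult grp mN L') auto
      moreover have pos: "add_index N L' > 0" using e1 finL by simp
      ultimately have "add_index N N' = 1" using le
        by (metis mult_is_0 mult_le_cancel2 nat_mult_1 le_antisym less_one linorder_not_less not_gr_zero)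
      then show ?thesis using add_index_eq_1D[OF grp[OF N'(1)] grp[OF mN(1)] N'(3)] by simp
    qed
    let ?p = "\<lambda>L. mod_prod I L"
    have e2: "add_index (?p L) (?p L') = add_index (?p L) (?p N) * add_index (?p N) (?p L')"
      by (intro add_index_mult grp ok_module_mod_prod mod_prod_mono mN)
    obtain y where y: "y \<in> N" "y \<notin> L'" using mN by blast
    have "\<not> ?p N \<subseteq> ?p L'" using cancel[OF mN(1) L'] mN by blast
    then obtain z where z: "z \<in> ?p N" "z \<notin> ?p L'" by blast
    have s: "add_index N L' \<le> add_index (?p N) (?p L')"
      by (rule index_le_index_mod_prod_simple[OF mN(1) L' mN(2) simple y z]) (use e2 fin in auto)
    have "add_index N L' \<noteq> 1" using add_index_eq_1D[OF grp[OF L'] grp[OF mN(1)] mN(2)] mN(3) by blast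
    then have "add_index N L' \<ge> 2" using e1 finL by (cases "add_index N L'") auto
    moreover have "add_index L N > 0" using e1 finL by simp
    ultimately have lt: "add_index L N < add_index L L'" unfolding e1 by simp
    have "add_index L N \<le> add_index (?p L) (?p N)"
      by (rule less.hyps[OF lt L mN(1,4)]) (use e1 e2 fin finL in auto)
    then show ?thesis unfolding e1 e2 using s by (rule mult_le_mono)
  qed
qed

text \<open>For \<open>y\<close> in \<open>L\<close>, \<open>k y\<close> lies in
  \<open>I' I y\<close>, hence in \<open>I' I L'\<close>, hence in \<open>k L'\<close>; dividing by
  \<open>k\<close> gives \<open>y\<close> in \<open>L'\<close>.\<close>

lemma cancel_mod_prod_if_invertible:
  fixes I I' :: "'a::field_char_0 set"
  assumes k: "k \<noteq> 0" "k \<in> mod_prod I' I" and II': "\<And>x' x. x' \<in> I' \<Longrightarrow> x \<in> I \<Longrightarrow> x' * x \<in> (*) k ` OK"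
    and L': "ok_module L'" and sub: "mod_prod I L \<subseteq> mod_prod I L'"
  shows "L \<subseteq> L'"
proof
  fix y assume y: "y \<in> L"
  have kL': "ok_module ((*) k ` L')" by (rule ok_module_scale[OF L'])
  have "mod_prod I L' \<subseteq> {w. \<forall>x'\<in>I'. x' * w \<in> (*) k ` L'}"
  proof (rule mod_prod_minimal[OF ok_module_colon[OF kL']], intro CollectI ballI)
    fix x l x' assume "x \<in> I" "l \<in> L'" "x' \<in> I'"
    then obtain r where "r \<in> OK" "x' * x = k * r" using II' by blast
    then have "x' * (x * l) = k * (r * l)" by (simp add: mult.assoc[symmetric])
    then show "x' * (x * l) \<in> (*) k ` L'" using ok_module_mult[OF L' \<open>r \<in> OK\<close> \<open>l \<in> L'\<close>] by blast
  qed
  moreover have "mod_prod I' I \<subseteq> {z. \<forall>x\<in>{y}. x * z \<in> (*) k ` L'}"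
  proof (rule mod_prod_minimal[OF ok_module_colon[OF kL']], intro CollectI ballI)
    fix x' x w assume "x' \<in> I'" "x \<in> I" "w \<in> {y}"
    then have "x * y \<in> mod_prod I L'" using mod_prod_mem[of x I y L] y sub by blast
    then have "x' * (x * y) \<in> (*) k ` L'" using calculation \<open>x' \<in> I'\<close> by blast
    then show "w * (x' * x) \<in> (*) k ` L'" using \<open>w \<in> {y}\<close> by (simp add: mult_ac)
  qed
  ultimately have "y * k \<in> (*) k ` L'" using k(2) by blast
  then show "y \<in> L'" using k(1) by (auto simp: mult.commute)
qed

fun mod_pow :: "'a::field_char_0 set \<Rightarrow> nat \<Rightarrow> 'a set" where
  "mod_pow I 0 = OK"
| "mod_pow I (Suc n) = mod_prod I (mod_pow I n)"

lemma ok_module_mod_pow: "ok_module (mod_pow I n)"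
  by (cases n) (auto simp: ok_module_OK ok_module_mod_prod)

lemma mod_pow_mult: "x \<in> mod_pow I a \<Longrightarrow> y \<in> mod_pow I b \<Longrightarrow> x * y \<in> mod_pow I (a + b)"
proof (induction a arbitrary: x y)
  case 0
  then show ?case using ok_module_mult[OF ok_module_mod_pow] by simp
next
  case (Suc a)
  have "mod_prod I (mod_pow I a) \<subseteq> {x. \<forall>y\<in>mod_pow I b. y * x \<in> mod_pow I (Suc a + b)}"
  proof (rule mod_prod_minimal[OF ok_module_colon[OF ok_module_mod_pow]], intro CollectI ballI)
    fix i z w assume "i \<in> I" "z \<in> mod_pow I a" "w \<in> mod_pow I b"
    then have "i * (z * w) \<in> mod_pow I (Suc a + b)" using Suc.IH[of z w] mod_prod_mem[of i I "z * w"] by simp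
    then show "w * (i * z) \<in> mod_pow I (Suc a + b)" by (simp add: mult_ac)
  qed
  then show ?case using Suc.prems by (auto simp: mult.commute)
qed

lemma mod_pow_1: "x \<in> I \<Longrightarrow> x \<in> mod_pow I (Suc 0)"
  using mod_prod_mem[of x I 1 OK] OK_1 by simp

lemma mod_pow_power: "x \<in> I \<Longrightarrow> x ^ n \<in> mod_pow I n"
  by (induction n) (auto simp: OK_1 intro: mod_prod_mem)

lemma mod_pow_subset_OK:
  assumes "I \<subseteq> OK" shows "mod_pow I n \<subseteq> OK"
proof (induction n)
  case (Suc n)
  show ?case unfolding mod_pow.simps
    by (rule mod_prod_minimal[OF ok_module_OK]) (use assms Suc.IH OK_mult in blast)
qed simp

text \<open>The index of the next power is \<open>[OK : I]\<close> times
  \<open>[I OK : I I^n]\<close>, and the second factor is at least \<open>[OK : I^n]\<close> by the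
  comparison of indices under multiplication by \<open>I\<close>.\<close>

theorem index_mod_pow_ge:
  fixes I :: "'a::field_char_0 set"
  assumes nf: "number_field TYPE('a)" and I: "ok_module I" "I \<subseteq> OK" "a \<in> I" "a \<noteq> 0"
    and cancel: "\<And>L L'. ok_module L \<Longrightarrow> ok_module L' \<Longrightarrow> mod_prod I L \<subseteq> mod_prod I L' \<Longrightarrow> L \<subseteq> L'"
  shows "add_index OK I ^ n \<le> add_index OK (mod_pow I n)"
proof (induction n)
  case 0
  then show ?case using add_index_self[OF add_subgroup_OK[where 'a='a]] by simp
next
  case (Suc n)
  note grp = ok_module_subgroup
  have pos: "add_index OK (mod_pow I k) > 0" for k
    using ideal_index_pos[OF nf ok_module_mod_pow mod_pow_subset_OK[OF I(2)] mod_pow_power[OF I(3), of k]] I(4) by simp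
  have sub: "mod_pow I (Suc n) \<subseteq> I"
    using mod_prod_mono[OF mod_pow_subset_OK[OF I(2)], of I n] mod_prod_OK[OF I(1)] by simp
  have e: "add_index OK (mod_pow I (Suc n)) = add_index OK I * add_index I (mod_pow I (Suc n))"
    by (intro add_index_mult grp I ok_module_mod_pow sub ok_module_OK)
  have "add_index OK (mod_pow I n) \<le> add_index (mod_prod I OK) (mod_prod I (mod_pow I n))"
  proof (rule index_le_index_mod_prod)
    show "L \<subseteq> L'" if "ok_module L" "ok_module L'" "mod_prod I L \<subseteq> mod_prod I L'" for L L'
      using that by (rule cancel)
    show "add_index (mod_prod I OK) (mod_prod I (mod_pow I n)) > 0"
      using pos[of "Suc n"] e unfolding mod_prod_OK[OF I(1)] by simp
  qed (rule ok_module_OK ok_module_mod_pow pos mod_pow_subset_OK[OF I(2)])+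
  then have "add_index OK (mod_pow I n) \<le> add_index I (mod_pow I (Suc n))"
    using mod_prod_OK[OF I(1)] by simp
  then show ?case unfolding e using Suc.IH by (simp add: mult_le_mono)
qed

section \<open>Heights\<close>

lemma int_Gcd_mem:
  fixes H :: "int set"
  assumes "finite S" "S \<subseteq> H" and H: "0 \<in> H" "\<And>x y. x \<in> H \<Longrightarrow> y \<in> H \<Longrightarrow> x + y \<in> H" "\<And>r x. x \<in> H \<Longrightarrow> r * x \<in> H"
  shows "Gcd S \<in> H"
  using assms(1,2)
proof (induction rule: finite_induct)
  case (insert x S)
  obtain u v where "u * x + v * Gcd S = gcd x (Gcd S)" using bezout_int by blast
  moreover have "u * x + v * Gcd S \<in> H" using insert by (intro H) auto
  ultimately show ?case by simp
qed (simp add: H)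

lemma content_1_Gcd_coeffs:
  fixes h :: "int poly"
  assumes "Polynomial.content h = 1"
  shows "Gcd (set (coeffs h)) = 1"
proof -
  let ?G = "Gcd (set (coeffs h))"
  have "?G dvd coeff h i" for i
  proof (cases "coeff h i = 0")
    case False
    then have "coeff h i \<in> set (coeffs h)" by (metis coeff_0 coeff_in_coeffs le_degree)
    then show ?thesis by (rule Gcd_dvd)
  qed simp
  then have "[:?G:] dvd h" by (simp add: const_poly_dvd_iff)
  then have "?G dvd 1" using assms const_poly_dvd_iff_dvd_content by metis
  then have "normalize ?G = 1" by (rule is_unit_normalize)
  then show ?thesis by (simp only: normalize_Gcd)
qed

lemma Poly_eq_0_imp: "Poly xs = 0 \<Longrightarrow> x \<in> set xs \<Longrightarrow> x = 0"
  by (induction xs) auto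

text \<open>Let \<open>f\<close> have the coefficients \<open>xs\<close>, let \<open>h\<close> be a
  primitive integer multiple of \<open>f\<close>, and choose \<open>g\<close> with
  \<open>f g = k h\<close>. For \<open>I'\<close> generated by the coefficients of \<open>g\<close>,
  the Gauss lemma gives \<open>I' I \<subseteq> k OK\<close>; the coefficients of \<open>k h\<close>
  lie in \<open>I' I\<close> and have gcd \<open>k\<close>, which yields \<open>k\<close>
  itself.\<close>

lemma gen_ideal_invertible:
  fixes xs :: "'a::field_char_0 list"
  assumes nf: "number_field TYPE('a)" and x: "x \<in> set xs" "x \<noteq> 0"
  obtains k I' where "k \<noteq> 0" "k \<in> mod_prod I' (gen_ideal xs)"
    "\<And>x' x. x' \<in> I' \<Longrightarrow> x \<in> gen_ideal xs \<Longrightarrow> x' * x \<in> (*) k ` OK"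
proof -
  define f where "f = Poly xs"
  have f0: "f \<noteq> 0" using Poly_eq_0_imp x unfolding f_def by blast
  have cf: "coeff f i = (if i < length xs then xs ! i else 0)" for i
    unfolding f_def by (simp add: nth_default_def)
  obtain h :: "int poly" where h: "Polynomial.content h = 1" "f dvd map_poly of_int h"
    using poly_divides_primitive_int_poly[OF nf f0] .
  obtain g0 where g0: "map_poly of_int h = f * g0" using h(2) by (rule dvdE)
  obtain N :: int where N: "N > 0" "\<And>y. y \<in> set (coeffs g0) \<Longrightarrow> alg_int (of_int N * y)"
    using common_alg_int_multiple[OF nf, of "set (coeffs g0)"] by auto
  define k :: 'a where "k = of_int N"
  define g where "g = Polynomial.smult k g0"
  have k0: "k \<noteq> 0" unfolding k_def using N(1) by simp
  have fg: "coeff (f * g) i = k * of_int (coeff h i)" for i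
    unfolding g_def using g0[symmetric] by (simp add: coeff_map_poly)
  have prod: "alg_int (coeff f i * coeff g j / k)" for i j
    by (rule gauss_kronecker[OF nf k0]) (simp add: fg k0)
  define I' where "I' = gen_ideal (coeffs g)"
  let ?I = "gen_ideal xs"
  have kO: "ok_module ((*) k ` OK)" by (rule ok_module_scale[OF ok_module_OK])
  have "?I \<subseteq> {y. \<forall>z\<in>set (coeffs g). z * y \<in> (*) k ` OK}"
  proof (rule gen_ideal_minimal[OF ok_module_colon[OF kO]], intro subsetI CollectI ballI)
    fix y z assume yz: "y \<in> set xs" "z \<in> set (coeffs g)"
    obtain i where i: "i < length xs" "xs ! i = y" using yz(1) by (auto simp: in_set_conv_nth)
    then have "y = coeff f i" by (simp add: cf)
    moreover obtain j where "z = coeff g j" using yz(2) by (auto simp: coeffs_def split: if_splits)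
    ultimately have "z * y = k * (coeff f i * coeff g j / k)" using k0 by simp
    then show "z * y \<in> (*) k ` OK" using prod[of i j] unfolding ring_of_integers_def by blast
  qed
  then have gen: "z * y \<in> (*) k ` OK" if "z \<in> set (coeffs g)" "y \<in> ?I" for z y using that by blast
  have sub: "I' \<subseteq> {z. \<forall>y\<in>?I. y * z \<in> (*) k ` OK}"
    unfolding I'_def
  proof (rule gen_ideal_minimal[OF ok_module_colon[OF kO]], intro subsetI CollectI ballI)
    fix z y assume "z \<in> set (coeffs g)" "y \<in> ?I"
    then show "y * z \<in> (*) k ` OK" by (subst mult.commute) (rule gen)
  qed
  have inv: "z * y \<in> (*) k ` OK" if "z \<in> I'" "y \<in> ?I" for z y
    using sub that by (subst mult.commute) blast
  let ?M = "mod_prod I' ?I"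
  have fI: "coeff f i \<in> ?I" for i
    unfolding cf using gen_ideal_base[of "xs ! i" xs] ok_module_0[OF ok_module_gen_ideal] by auto
  have gI: "coeff g j \<in> I'" for j
  proof (cases "coeff g j = 0")
    case False
    then have "coeff g j \<in> set (coeffs g)" by (metis coeff_0 coeff_in_coeffs le_degree)
    then show ?thesis unfolding I'_def by (rule gen_ideal_base)
  qed (simp add: I'_def ok_module_0[OF ok_module_gen_ideal])
  \<comment> \<open>An ideal of the integers that contains all coefficients of \<open>h\<close>; as
    their gcd is 1, it contains 1.\<close>
  define H where "H = {z::int. k * of_int z \<in> ?M}"
  have "coeff h i \<in> H" for i
  proof -
    have "coeff (f * g) i \<in> ?M"
      unfolding coeff_mult using mod_prod_mem[OF gI fI] by (intro ok_module_sum ok_module_mod_prod) (simp add: mult.commute)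
    then show ?thesis unfolding H_def fg by simp
  qed
  then have "set (coeffs h) \<subseteq> H" by (auto simp: coeffs_def split: if_splits)
  then have "Gcd (set (coeffs h)) \<in> H"
  proof (rule int_Gcd_mem[rotated])
    show "0 \<in> H" unfolding H_def by (simp add: ok_module_0[OF ok_module_mod_prod])
    show "x + y \<in> H" if "x \<in> H" "y \<in> H" for x y
      using that ok_module_add[OF ok_module_mod_prod] unfolding H_def by (simp add: distrib_left)
    show "r * x \<in> H" if "x \<in> H" for r x
      using that ok_module_mult[OF ok_module_mod_prod OK_of_int[of r]] unfolding H_def by (simp add: mult.left_commute[of k])
  qed simp
  then have "k \<in> ?M" unfolding H_def content_1_Gcd_coeffs[OF h(1)] by simp
  then show ?thesis using that[of k I'] k0 inv by blast
qed

lemma gen_ideal_subset_OK: "(\<And>y. y \<in> set xs \<Longrightarrow> alg_int y) \<Longrightarrow> gen_ideal xs \<subseteq> OK"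
  by (rule gen_ideal_minimal[OF ok_module_OK]) (auto simp: ring_of_integers_def)

theorem gen_ideal_index_pow:
  fixes xs :: "'a::field_char_0 list"
  assumes nf: "number_field TYPE('a)" and int: "\<And>y. y \<in> set xs \<Longrightarrow> alg_int y" and x: "x \<in> set xs" "x \<noteq> 0"
  shows "add_index OK (gen_ideal xs) ^ n \<le> add_index OK (mod_pow (gen_ideal xs) n)"
proof -
  obtain k I' where k: "k \<noteq> 0" "k \<in> mod_prod I' (gen_ideal xs)"
    "\<And>x' x. x' \<in> I' \<Longrightarrow> x \<in> gen_ideal xs \<Longrightarrow> x' * x \<in> (*) k ` OK"
    using gen_ideal_invertible[OF nf x] by metis
  show ?thesis
  proof (rule index_mod_pow_ge[OF nf ok_module_gen_ideal gen_ideal_subset_OK[OF int] gen_ideal_base[OF x(1)] x(2)])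
    show "L \<subseteq> L'" if "ok_module L'" "mod_prod (gen_ideal xs) L \<subseteq> mod_prod (gen_ideal xs) L'" for L L'
      by (rule cancel_mod_prod_if_invertible[OF k that])
  qed
qed

section \<open>Scaling invariance and estimates for the height\<close>

lemma gen_ideal_scale: "gen_ideal (map ((*) c) xs) = (*) c ` gen_ideal xs"
proof -
  have "gen_ideal (map ((*) c) xs) = {c * (\<Sum>i<length xs. r i * xs ! i) | r. \<forall>i. r i \<in> OK}"
    unfolding gen_ideal_def by (simp add: sum_distrib_left mult.left_commute)
  then show ?thesis unfolding gen_ideal_def by blast
qed

lemma index_scale_integral:
  fixes J :: "'a::field_char_0 set"
  assumes nf: "number_field TYPE('a)" and J: "ok_module J" "J \<subseteq> OK" and c: "alg_int c" "c \<noteq> 0"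
  shows "real (add_index OK ((*) c ` J)) = emb_norm c * real (add_index OK J)"
proof -
  have sub: "(*) c ` OK \<subseteq> OK" using c(1) OK_mult unfolding ring_of_integers_def by auto
  have "add_index OK ((*) c ` J) = add_index OK ((*) c ` OK) * add_index ((*) c ` OK) ((*) c ` J)"
    by (intro add_index_mult add_subgroup_scale ok_module_subgroup J ok_module_OK image_mono sub)
  also have "add_index ((*) c ` OK) ((*) c ` J) = add_index OK J"
    by (rule add_index_scale[OF c(2) ok_module_subgroup[OF J(1)]])
  finally show ?thesis using index_principal[OF nf c] by simp
qed

text \<open>Here \<open>c\<close> may be a fraction. Multiplying once more by a denominator
  \<open>N\<close> reduces to integral factors, and the norm of \<open>N\<close> cancels.\<close>

lemma index_scale:
  fixes J :: "'a::field_char_0 set"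
  assumes nf: "number_field TYPE('a)" and J: "ok_module J" "J \<subseteq> OK" "(*) c ` J \<subseteq> OK" and c: "c \<noteq> 0"
  shows "real (add_index OK ((*) c ` J)) = emb_norm c * real (add_index OK J)"
proof -
  obtain N :: int where N: "N > 0" "alg_int (of_int N * c)" using alg_int_multiple[OF nf] .
  have N0: "(of_int N :: 'a) \<noteq> 0" using N(1) by simp
  have "emb_norm (of_int N :: 'a) * real (add_index OK ((*) c ` J)) = real (add_index OK ((*) (of_int N) ` (*) c ` J))"
    by (rule index_scale_integral[OF nf ok_module_scale[OF J(1)] J(3) alg_int_of_int N0, symmetric])
  also have "(*) (of_int N) ` (*) c ` J = (*) (of_int N * c) ` J" by (simp add: image_image mult.assoc)
  also have "real (add_index OK \<dots>) = emb_norm (of_int N * c) * real (add_index OK J)"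
    using N0 c by (intro index_scale_integral[OF nf J(1,2) N(2)]) simp
  finally show ?thesis using emb_norm_pos[OF N0] by (simp add: emb_norm_mult)
qed

definition emb_max :: "('a \<Rightarrow> complex) \<Rightarrow> 'a list \<Rightarrow> real" where
  "emb_max \<sigma> xs = Max ((\<lambda>c. cmod (\<sigma> c)) ` set xs)"

lemma emb_max_ge: "x \<in> set xs \<Longrightarrow> cmod (\<sigma> x) \<le> emb_max \<sigma> xs"
  unfolding emb_max_def by simp

lemma emb_max_le: "xs \<noteq> [] \<Longrightarrow> (\<And>x. x \<in> set xs \<Longrightarrow> cmod (\<sigma> x) \<le> B) \<Longrightarrow> emb_max \<sigma> xs \<le> B"
  unfolding emb_max_def by auto

lemma emb_max_pos: "\<sigma> \<in> complex_embeddings \<Longrightarrow> x \<in> set xs \<Longrightarrow> x \<noteq> 0 \<Longrightarrow> emb_max \<sigma> xs > 0"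
  using emb_max_ge[of x xs \<sigma>] emb_eq_0_iff[of \<sigma> x] by (meson norm_le_zero_iff not_le order_trans)

lemma emb_max_scale:
  assumes s: "\<sigma> \<in> complex_embeddings" and xs: "xs \<noteq> []"
  shows "emb_max \<sigma> (map ((*) c) xs) = cmod (\<sigma> c) * emb_max \<sigma> xs"
proof -
  have "emb_max \<sigma> (map ((*) c) xs) = Max ((*) (cmod (\<sigma> c)) ` (\<lambda>x. cmod (\<sigma> x)) ` set xs)"
    unfolding emb_max_def by (simp add: image_image emb_mult[OF s] norm_mult)
  also have "\<dots> = cmod (\<sigma> c) * Max ((\<lambda>x. cmod (\<sigma> x)) ` set xs)"
    using xs by (intro mono_Max_commute[symmetric]) (auto simp: mono_def mult_left_mono)
  finally show ?thesis unfolding emb_max_def .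
qed

lemma height_integral_altdef:
  "height_integral (xs :: 'a::field_char_0 list) =
     ((\<Sum>\<sigma>\<in>complex_embeddings. ln (emb_max \<sigma> xs)) - ln (real (add_index OK (gen_ideal xs))))
       / real (card (complex_embeddings :: ('a \<Rightarrow> complex) set))"
  unfolding height_integral_def emb_max_def ideal_norm_eq_index ..

lemma ln_emb_norm:
  fixes c :: "'a::field_char_0"
  assumes "number_field TYPE('a)" "c \<noteq> 0"
  shows "ln (emb_norm c) = (\<Sum>\<sigma>\<in>complex_embeddings. ln (cmod (\<sigma> c)))"
  unfolding emb_norm_def using assms by (intro ln_prod) (auto simp: emb_eq_0_iff finite_embeddings)

lemma gen_ideal_index_pos:
  fixes xs :: "'a::field_char_0 list"
  assumes "number_field TYPE('a)" "\<And>y. y \<in> set xs \<Longrightarrow> alg_int y" "x \<in> set xs" "x \<noteq> 0"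
  shows "add_index OK (gen_ideal xs) > 0"
  using ideal_index_pos[OF assms(1) ok_module_gen_ideal gen_ideal_subset_OK[OF assms(2)] gen_ideal_base[OF assms(3)] assms(4)] .

text \<open>The product formula: the logarithm of the norm of \<open>c\<close> enters both the
  archimedean sum and the logarithm of the ideal norm, and cancels.\<close>

lemma height_integral_scale:
  fixes xs :: "'a::field_char_0 list"
  assumes nf: "number_field TYPE('a)" and int: "\<And>y. y \<in> set xs \<Longrightarrow> alg_int y" and x: "x \<in> set xs" "x \<noteq> 0"
    and c: "c \<noteq> 0" and int': "\<And>y. y \<in> set xs \<Longrightarrow> alg_int (c * y)"
  shows "height_integral (map ((*) c) xs) = height_integral xs"
proof -
  have xs: "xs \<noteq> []" using x by auto
  have "real (add_index OK (gen_ideal (map ((*) c) xs))) = emb_norm c * real (add_index OK (gen_ideal xs))"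
    unfolding gen_ideal_scale
  proof (rule index_scale[OF nf ok_module_gen_ideal gen_ideal_subset_OK[OF int] _ c])
    show "(*) c ` gen_ideal xs \<subseteq> OK" unfolding gen_ideal_scale[symmetric]
      using int' by (intro gen_ideal_subset_OK) auto
  qed
  then have "ln (real (add_index OK (gen_ideal (map ((*) c) xs)))) = ln (emb_norm c) + ln (real (add_index OK (gen_ideal xs)))"
    using gen_ideal_index_pos[OF nf int x] emb_norm_pos[OF c] by (simp add: ln_mult)
  moreover have "(\<Sum>\<sigma>\<in>complex_embeddings. ln (emb_max \<sigma> (map ((*) c) xs))) =
      (\<Sum>\<sigma>\<in>complex_embeddings. ln (cmod (\<sigma> c)) + ln (emb_max \<sigma> xs))"
  proof (rule sum.cong[OF refl])
    fix \<sigma> :: "'a \<Rightarrow> complex" assume s: "\<sigma> \<in> complex_embeddings"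
    show "ln (emb_max \<sigma> (map ((*) c) xs)) = ln (cmod (\<sigma> c)) + ln (emb_max \<sigma> xs)"
      unfolding emb_max_scale[OF s xs] using emb_max_pos[OF s x] emb_eq_0_iff[OF s, of c] c
      by (simp add: ln_mult)
  qed
  ultimately show ?thesis
    unfolding height_integral_altdef by (simp add: ln_emb_norm[OF nf c] sum.distrib)
qed

text \<open>Replaces the least denominator \<open>m\<close> in the definition by any convenient
  factor \<open>c\<close>; the two scalings differ by \<open>c / m\<close>, which need not be
  integral.\<close>

lemma proj_height_eq_height_integral:
  fixes xs :: "'a::field_char_0 list"
  assumes nf: "number_field TYPE('a)" and x: "x \<in> set xs" "x \<noteq> 0"
    and c: "c \<noteq> 0" and int: "\<And>y. y \<in> set xs \<Longrightarrow> alg_int (c * y)"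
  shows "proj_height xs = height_integral (map ((*) c) xs)"
proof -
  define Q where "Q m \<longleftrightarrow> m > 0 \<and> (\<forall>y\<in>set xs. alg_int (of_nat m * y))" for m :: nat
  define m where "m = (LEAST m. Q m)"
  obtain N :: int where N: "N > 0" "\<And>y. y \<in> set xs \<Longrightarrow> alg_int (of_int N * y)"
    using common_alg_int_multiple[OF nf, of "set xs"] by auto
  then have "Q (nat N)" unfolding Q_def by simp
  then have m: "Q m" unfolding m_def by (rule LeastI)
  have m0: "(of_nat m :: 'a) \<noteq> 0" using m unfolding Q_def by simp
  have "proj_height xs = height_integral (map ((*) (of_nat m)) xs)"
    unfolding proj_height_def m_def Q_def ..
  also have "\<dots> = height_integral (map ((*) (c / of_nat m)) (map ((*) (of_nat m)) xs))"
  proof (rule height_integral_scale[symmetric, OF nf])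
    show "of_nat m * x \<in> set (map ((*) (of_nat m)) xs)" "of_nat m * x \<noteq> 0" using x m0 by auto
    show "c / of_nat m \<noteq> 0" using c m0 by simp
  qed (use m int m0 in \<open>auto simp: Q_def\<close>)
  also have "map ((*) (c / of_nat m)) (map ((*) (of_nat m)) xs) = map ((*) c) xs" using m0 by simp
  finally show ?thesis .
qed

text \<open>The ideal contains the principal ideal of \<open>x\<close>, so its norm is at most the
  norm of \<open>x\<close>, which is at most the product of the maxima over all embeddings.\<close>

lemma height_integral_nonneg:
  fixes xs :: "'a::field_char_0 list"
  assumes nf: "number_field TYPE('a)" and int: "\<And>y. y \<in> set xs \<Longrightarrow> alg_int y" and x: "x \<in> set xs" "x \<noteq> 0"
  shows "height_integral xs \<ge> 0"
proof -
  let ?I = "gen_ideal xs"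
  have pos: "add_index OK ?I > 0" by (rule gen_ideal_index_pos[OF nf int x])
  have xI: "(*) x ` OK \<subseteq> ?I"
    using ok_module_mult[OF ok_module_gen_ideal _ gen_ideal_base[OF x(1)]] by (auto simp: mult.commute)
  have "add_index OK ((*) x ` OK) = add_index OK ?I * add_index ?I ((*) x ` OK)"
    by (intro add_index_mult ok_module_subgroup ok_module_gen_ideal ok_module_scale ok_module_OK xI gen_ideal_subset_OK int)
  moreover have e: "real (add_index OK ((*) x ` OK)) = emb_norm x" by (rule index_principal[OF nf int[OF x(1)] x(2)])
  then have "add_index OK ((*) x ` OK) > 0" using emb_norm_pos[OF x(2)] by (metis of_nat_0_less_iff)
  ultimately have "add_index OK ?I \<le> add_index OK ((*) x ` OK)" by simp
  then have "real (add_index OK ?I) \<le> emb_norm x" using e by linarith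
  then have "ln (real (add_index OK ?I)) \<le> ln (emb_norm x)" using pos emb_norm_pos[OF x(2)] by simp
  also have "\<dots> \<le> (\<Sum>\<sigma>\<in>complex_embeddings. ln (emb_max \<sigma> xs))"
    unfolding ln_emb_norm[OF nf x(2)]
  proof (rule sum_mono)
    fix \<sigma> :: "'a \<Rightarrow> complex" assume s: "\<sigma> \<in> complex_embeddings"
    have "cmod (\<sigma> x) > 0" using emb_eq_0_iff[OF s, of x] x(2) by simp
    moreover have "emb_max \<sigma> xs > 0" by (rule emb_max_pos[OF s x])
    ultimately show "ln (cmod (\<sigma> x)) \<le> ln (emb_max \<sigma> xs)"
      using emb_max_ge[OF x(1), of \<sigma>] by simp
  qed
  finally show ?thesis unfolding height_integral_altdef by simp
qed

text \<open>At the finite places, containment in the \<open>M\<close>-th power gives norm at least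
  the \<open>M\<close>-th power of the norm of the ideal of \<open>xs\<close>. At each embedding the
  bound is assumed. Averaging over the embeddings leaves \<open>C\<close> and \<open>B\<close> with
  weight one.\<close>

theorem height_integral_le_if_mem_mod_pow:
  fixes xs ys :: "'a::field_char_0 list"
  assumes nf: "number_field TYPE('a)" and int: "\<And>y. y \<in> set xs \<Longrightarrow> alg_int y" and x: "x \<in> set xs" "x \<noteq> 0"
    and y: "y \<in> set ys" "y \<noteq> 0" and mem: "set ys \<subseteq> mod_pow (gen_ideal xs) M"
    and C: "C > 0" "B > 0"
    and bound: "\<And>\<sigma> y. \<sigma> \<in> complex_embeddings \<Longrightarrow> y \<in> set ys \<Longrightarrow> cmod (\<sigma> y) \<le> C * (B * emb_max \<sigma> xs) ^ M"
  shows "height_integral ys \<le> ln C + real M * (ln B + height_integral xs)"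
proof -
  let ?I = "gen_ideal xs" and ?J = "gen_ideal ys" and ?E = "complex_embeddings :: ('a \<Rightarrow> complex) set"
  have IO: "?I \<subseteq> OK" by (rule gen_ideal_subset_OK[OF int])
  have ysO: "alg_int z" if "z \<in> set ys" for z
    using mem mod_pow_subset_OK[OF IO] that unfolding ring_of_integers_def by blast
  have Ipos: "add_index OK ?I > 0" by (rule gen_ideal_index_pos[OF nf int x])
  have Jpos: "add_index OK ?J > 0" by (rule gen_ideal_index_pos[OF nf ysO y])
  have JP: "?J \<subseteq> mod_pow ?I M" by (rule gen_ideal_minimal[OF ok_module_mod_pow mem])
  have "add_index OK ?J = add_index OK (mod_pow ?I M) * add_index (mod_pow ?I M) ?J"
    by (intro add_index_mult ok_module_subgroup ok_module_gen_ideal ok_module_mod_pow ok_module_OK JP mod_pow_subset_OK IO)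
  then have "add_index OK (mod_pow ?I M) \<le> add_index OK ?J" using Jpos by simp
  then have "add_index OK ?I ^ M \<le> add_index OK ?J"
    using gen_ideal_index_pow[OF nf int x, of M] by linarith
  then have "real (add_index OK ?I) ^ M \<le> real (add_index OK ?J)" by (metis of_nat_le_iff of_nat_power)
  then have "ln (real (add_index OK ?I) ^ M) \<le> ln (real (add_index OK ?J))" using Ipos Jpos by simp
  then have 1: "real M * ln (real (add_index OK ?I)) \<le> ln (real (add_index OK ?J))" using Ipos by (simp add: ln_realpow)
  have 2: "ln (emb_max \<sigma> ys) \<le> ln C + real M * (ln B + ln (emb_max \<sigma> xs))" if s: "\<sigma> \<in> ?E" for \<sigma>
  proof -
    have xp: "emb_max \<sigma> xs > 0" and yp: "emb_max \<sigma> ys > 0" using emb_max_pos[OF s] x y by blast+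
    have "emb_max \<sigma> ys \<le> C * (B * emb_max \<sigma> xs) ^ M"
      using y bound[OF s] by (intro emb_max_le) auto
    then have "ln (emb_max \<sigma> ys) \<le> ln (C * (B * emb_max \<sigma> xs) ^ M)" using yp by simp
    also have "\<dots> = ln C + real M * (ln B + ln (emb_max \<sigma> xs))"
      using C xp by (simp add: ln_mult ln_realpow)
    finally show ?thesis .
  qed
  have card: "real (card ?E) > 0" using finite_embeddings(2)[OF nf] by simp
  have "(\<Sum>\<sigma>\<in>?E. ln (emb_max \<sigma> ys)) \<le> (\<Sum>\<sigma>\<in>?E. ln C + real M * (ln B + ln (emb_max \<sigma> xs)))"
    by (rule sum_mono) (rule 2)
  also have "\<dots> = real (card ?E) * (ln C + real M * ln B) + real M * (\<Sum>\<sigma>\<in>?E. ln (emb_max \<sigma> xs))"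
    by (simp add: sum.distrib sum_distrib_left distrib_left)
  finally have "(\<Sum>\<sigma>\<in>?E. ln (emb_max \<sigma> ys)) - ln (real (add_index OK ?J)) \<le>
      real (card ?E) * (ln C + real M * ln B) + real M * ((\<Sum>\<sigma>\<in>?E. ln (emb_max \<sigma> xs)) - ln (real (add_index OK ?I)))"
    using 1 by (simp add: algebra_simps)
  then show ?thesis unfolding height_integral_altdef using card by (simp add: field_simps)
qed

section \<open>Continued fractions and Hankel determinants\<close>

lemma poly_to_fls_nth:
  "fls_nth (poly_to_fls f) k = (if k \<le> 0 then coeff f (nat (- k)) else 0)"
proof -
  have "fls_nth (poly_to_fls f) k = (\<Sum>i\<le>degree f. if i = nat (- k) \<and> k \<le> 0 then coeff f i else 0)"
    unfolding poly_to_fls_def fls_nth_sum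
    by (intro sum.cong) (auto simp: fls_X_inv_power_conv_shift_1)
  also have "\<dots> = (if k \<le> 0 then coeff f (nat (- k)) else 0)"
    by (auto simp: coeff_eq_0)
  finally show ?thesis .
qed

lemma poly_to_fls_0 [simp]: "poly_to_fls 0 = 0" and poly_to_fls_1 [simp]: "poly_to_fls 1 = 1"
  by (rule fls_eqI; auto simp: poly_to_fls_nth coeff_1)+

lemma poly_to_fls_add: "poly_to_fls (f + g) = poly_to_fls f + poly_to_fls g"
  and poly_to_fls_diff: "poly_to_fls (f - g) = poly_to_fls f - poly_to_fls g"
  by (rule fls_eqI, simp add: poly_to_fls_nth)+

lemma poly_to_fls_eq_iff: "poly_to_fls f = poly_to_fls g \<longleftrightarrow> f = g"
proof
  assume eq: "poly_to_fls f = poly_to_fls g"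
  show "f = g"
  proof (rule poly_eqI)
    fix i show "coeff f i = coeff g i"
      using arg_cong[OF eq, of "\<lambda>x. fls_nth x (- int i)"] by (simp add: poly_to_fls_nth)
  qed
qed simp

lemma poly_to_fls_times_nth:
  assumes "degree f \<le> n"
  shows "fls_nth (poly_to_fls f * g) k = (\<Sum>j\<le>n. coeff f j * fls_nth g (k + int j))"
proof -
  have "fls_nth (poly_to_fls f * g) k = (\<Sum>j\<le>degree f. coeff f j * fls_nth g (k + int j))"
    unfolding poly_to_fls_def sum_distrib_right fls_nth_sum
    by (intro sum.cong) (auto simp: mult.assoc fls_X_inv_power_times_conv_shift fls_shifted_times_simps)
  also have "\<dots> = (\<Sum>j\<le>n. coeff f j * fls_nth g (k + int j))"
    using assms by (intro sum.mono_neutral_left) (auto simp: coeff_eq_0)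
  finally show ?thesis .
qed

lemma poly_to_fls_mult: "poly_to_fls (f * g) = poly_to_fls f * poly_to_fls g"
proof (rule fls_eqI)
  fix k
  have r: "fls_nth (poly_to_fls f * poly_to_fls g) k = (\<Sum>j\<le>degree f. coeff f j * fls_nth (poly_to_fls g) (k + int j))"
    by (rule poly_to_fls_times_nth) simp
  show "fls_nth (poly_to_fls (f * g)) k = fls_nth (poly_to_fls f * poly_to_fls g) k"
  proof (cases "k \<le> 0")
    case True
    define m where "m = nat (- k)"
    have k: "k = - int m" using True m_def by simp
    have "coeff (f * g) m = (\<Sum>j\<le>m. coeff f j * coeff g (m - j))" by (rule coeff_mult)
    also have "\<dots> = (\<Sum>j\<le>max m (degree f). if j \<le> m then coeff f j * coeff g (m - j) else 0)"
      by (intro sum.mono_neutral_cong_left) auto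
    also have "\<dots> = (\<Sum>j\<le>degree f. if j \<le> m then coeff f j * coeff g (m - j) else 0)"
      by (intro sum.mono_neutral_right) (auto simp: coeff_eq_0)
    also have "\<dots> = (\<Sum>j\<le>degree f. coeff f j * fls_nth (poly_to_fls g) (k + int j))"
      by (intro sum.cong) (auto simp: poly_to_fls_nth k nat_diff_distrib)
    finally show ?thesis unfolding r by (simp add: poly_to_fls_nth k)
  next
    case False
    then show ?thesis unfolding r by (simp add: poly_to_fls_nth)
  qed
qed

lemma poly_to_fls_eq_0_iff: "poly_to_fls f = 0 \<longleftrightarrow> f = 0"
  using poly_to_fls_eq_iff[of f 0] by simp

lemma poly_to_fls_power: "poly_to_fls (f ^ n) = poly_to_fls f ^ n"
  by (induction n) (auto simp: poly_to_fls_mult)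

lemma poly_to_fls_subdegree:
  assumes "f \<noteq> 0" shows "fls_subdegree (poly_to_fls f) = - int (degree f)"
  by (rule fls_subdegree_eqI) (use assms in \<open>auto simp: poly_to_fls_nth coeff_eq_0\<close>)

lemma coeff_lfloor: "coeff (lfloor \<alpha>) i = fls_nth \<alpha> (- int i)"
proof (cases "i < nat (- fls_subdegree \<alpha>) + 1")
  case True
  then show ?thesis unfolding lfloor_def by (simp add: nth_default_def del: upt_Suc)
next
  case False
  then have "- int i < fls_subdegree \<alpha>" by linarith
  then show ?thesis unfolding lfloor_def using False by (simp add: nth_default_def)
qed

lemma frac_nth: "fls_nth (\<alpha> - poly_to_fls (lfloor \<alpha>)) k = (if k \<le> 0 then 0 else fls_nth \<alpha> k)"
  by (simp add: poly_to_fls_nth coeff_lfloor)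

lemma frac_subdegree_pos:
  assumes "\<alpha> - poly_to_fls (lfloor \<alpha>) \<noteq> 0"
  shows "fls_subdegree (\<alpha> - poly_to_fls (lfloor \<alpha>)) > 0"
proof (rule ccontr)
  assume "\<not> ?thesis"
  then have "fls_nth (\<alpha> - poly_to_fls (lfloor \<alpha>)) (fls_subdegree (\<alpha> - poly_to_fls (lfloor \<alpha>))) = 0"
    by (subst frac_nth) simp
  then show False using nth_fls_subdegree_nonzero[OF assms] by contradiction
qed

lemma degree_lfloor:
  assumes "\<alpha> \<noteq> 0" "fls_subdegree \<alpha> \<le> 0"
  shows "int (degree (lfloor \<alpha>)) = - fls_subdegree \<alpha>"
proof -
  have "degree (lfloor \<alpha>) = nat (- fls_subdegree \<alpha>)"
  proof (rule antisym)
    show "degree (lfloor \<alpha>) \<le> nat (- fls_subdegree \<alpha>)"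
      by (rule degree_le) (auto simp: coeff_lfloor)
    show "nat (- fls_subdegree \<alpha>) \<le> degree (lfloor \<alpha>)"
      by (rule le_degree) (use assms nth_fls_subdegree_nonzero[OF assms(1)] in \<open>auto simp: coeff_lfloor\<close>)
  qed
  then show ?thesis using assms by simp
qed

section \<open>Degrees and approximation errors of convergents\<close>

definition cf_frac :: "'a::field fls \<Rightarrow> nat \<Rightarrow> 'a fls" where
  "cf_frac s k = cf_alpha s k - poly_to_fls (cf_a s k)"

text \<open>Because of the shifted indices, \<open>cf_err s (Suc k)\<close> is
  \<open>q_k s - p_k\<close>, and \<open>cf_err s 0\<close> is -1.\<close>

definition cf_err :: "'a::field fls \<Rightarrow> nat \<Rightarrow> 'a fls" where
  "cf_err s k = poly_to_fls (cf_q s k) * s - poly_to_fls (cf_p s k)"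

lemma cf_det: "cf_p s (Suc k) * cf_q s k - cf_p s k * cf_q s (Suc k) = (- 1) ^ Suc k"
proof (induction k)
  case (Suc k)
  have "cf_p s (Suc (Suc k)) * cf_q s (Suc k) - cf_p s (Suc k) * cf_q s (Suc (Suc k)) =
    - (cf_p s (Suc k) * cf_q s k - cf_p s k * cf_q s (Suc k))"
    by (simp add: algebra_simps)
  then show ?case using Suc by simp
qed simp

lemma cf_bezout: "\<exists>u v. u * cf_p s (Suc k) + v * cf_q s (Suc k) = 1"
proof -
  have "((- 1) ^ Suc k * cf_q s k) * cf_p s (Suc k) + (- ((- 1) ^ Suc k) * cf_p s k) * cf_q s (Suc k)
     = (- 1) ^ Suc k * (cf_p s (Suc k) * cf_q s k - cf_p s k * cf_q s (Suc k))"
    by (simp add: algebra_simps)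
  also have "\<dots> = 1" unfolding cf_det by (simp flip: power_mult_distrib)
  finally show ?thesis by blast
qed

text \<open>The errors obey the same recursion as \<open>p\<close> and \<open>q\<close>. Since the
  next complete quotient is the inverse of the current fractional part, the induction hypothesis
  expresses the older error by the newer one, and the recursion collapses to a product.\<close>

lemma cf_err_Suc:
  assumes "\<And>j. j < k \<Longrightarrow> cf_frac s j \<noteq> 0"
  shows "cf_err s (Suc k) = - cf_frac s k * cf_err s k"
  using assms
proof (induction k)
  case 0
  show ?case by (simp add: cf_err_def cf_frac_def)
next
  case (Suc k)
  have IH: "cf_err s (Suc k) = - cf_frac s k * cf_err s k" using Suc by simp
  have nz: "cf_frac s k \<noteq> 0" using Suc.prems by simp
  have al: "cf_alpha s (Suc k) = inverse (cf_frac s k)" unfolding cf_frac_def cf_a_def by simp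
  have "cf_err s k = - (cf_alpha s (Suc k) * cf_err s (Suc k))"
    unfolding IH al using nz by simp
  moreover have "cf_err s (Suc (Suc k)) = poly_to_fls (cf_a s (Suc k)) * cf_err s (Suc k) + cf_err s k"
    unfolding cf_err_def by (simp add: poly_to_fls_add poly_to_fls_mult algebra_simps)
  ultimately show ?case unfolding cf_frac_def[of s "Suc k"] by (simp add: algebra_simps)
qed

lemma cf_degree_a:
  assumes "cf_frac s k \<noteq> 0"
  shows "int (degree (cf_a s (Suc k))) = fls_subdegree (cf_frac s k)" "degree (cf_a s (Suc k)) > 0"
proof -
  have al: "cf_alpha s (Suc k) = inverse (cf_frac s k)" unfolding cf_frac_def cf_a_def by simp
  have pos: "fls_subdegree (cf_frac s k) > 0"
    using frac_subdegree_pos assms unfolding cf_frac_def cf_a_def by blast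
  have sub: "fls_subdegree (cf_alpha s (Suc k)) = - fls_subdegree (cf_frac s k)"
    unfolding al using assms by (simp add: fls_inverse_subdegree)
  show d: "int (degree (cf_a s (Suc k))) = fls_subdegree (cf_frac s k)"
    unfolding cf_a_def using assms al sub pos by (subst degree_lfloor) auto
  show "degree (cf_a s (Suc k)) > 0" using d pos by simp
qed

text \<open>The degree formula starts at \<open>k > 0\<close> because the initial denominator is 1
  whatever the degree of \<open>cf_a s 0\<close>.\<close>

lemma cf_degree_q:
  assumes "\<And>j. j < k \<Longrightarrow> cf_frac s j \<noteq> 0"
  shows "cf_q s (Suc k) \<noteq> 0 \<and> (cf_q s k = 0 \<or> degree (cf_q s k) < degree (cf_q s (Suc k))) \<and>
    (k > 0 \<longrightarrow> degree (cf_q s (Suc k)) = degree (cf_a s k) + degree (cf_q s k))"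
  using assms
proof (induction k)
  case (Suc k)
  let ?a = "cf_a s (Suc k)" and ?q = "cf_q s (Suc k)"
  have IH: "?q \<noteq> 0" "cf_q s k = 0 \<or> degree (cf_q s k) < degree ?q" using Suc by auto
  have a: "degree ?a > 0" using cf_degree_a(2) Suc.prems by blast
  then have a0: "?a \<noteq> 0" by auto
  have d: "degree (?a * ?q) = degree ?a + degree ?q" using a0 IH by (simp add: degree_mult_eq)
  have "degree (cf_q s (Suc (Suc k))) = degree ?a + degree ?q"
  proof (cases "cf_q s k = 0")
    case False
    then show ?thesis using IH d by (simp add: degree_add_eq_left)
  qed (simp add: d)
  moreover have "cf_q s (Suc (Suc k)) \<noteq> 0" using calculation a by auto
  ultimately show ?case using a by auto
qed simp

text \<open>If the expansion stopped, then \<open>q s = p\<close>, so \<open>q^2 D = p^2\<close>; a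
  Bezout relation makes \<open>q\<close> divide \<open>p\<close>, and \<open>D\<close> would be a
  square.\<close>

lemma cf_frac_nonzero:
  fixes D :: "'a::field poly"
  assumes nsq: "\<not> (\<exists>g. D = g ^ 2)" and s: "s ^ 2 = poly_to_fls D"
  shows "cf_frac s k \<noteq> 0"
proof (induction k rule: less_induct)
  case (less k)
  show ?case
  proof
    assume z: "cf_frac s k = 0"
    let ?p = "cf_p s (Suc k)" and ?q = "cf_q s (Suc k)"
    have q0: "?q \<noteq> 0" using cf_degree_q less by blast
    have "cf_err s (Suc k) = 0" using cf_err_Suc[of k s] less z by simp
    then have eq: "poly_to_fls ?q * s = poly_to_fls ?p" unfolding cf_err_def by simp
    have "poly_to_fls (?q ^ 2 * D) = (poly_to_fls ?q * s) ^ 2"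
      by (simp add: poly_to_fls_mult poly_to_fls_power s[symmetric] power_mult_distrib)
    also have "\<dots> = poly_to_fls (?p ^ 2)" unfolding eq by (simp add: poly_to_fls_power)
    finally have sq: "?q ^ 2 * D = ?p ^ 2" by (simp add: poly_to_fls_eq_iff)
    obtain u v where uv: "u * ?p + v * ?q = 1" using cf_bezout by blast
    have "?p * 1 = u * ?p ^ 2 + v * ?q * ?p" unfolding uv[symmetric] by (simp add: algebra_simps power2_eq_square)
    also have "\<dots> = ?q * (u * ?q * D + v * ?p)" unfolding sq[symmetric] by (simp add: algebra_simps power2_eq_square)
    finally obtain w where w: "?p = ?q * w" by simp
    have "?q ^ 2 * D = ?q ^ 2 * w ^ 2" unfolding sq using w by (metis power_mult_distrib)
    then have "D = w ^ 2" using q0 by simp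
    then show False using nsq by blast
  qed
qed

text \<open>The order of \<open>q_k s - p_k\<close> is exactly the degree of the next denominator,
  since both grow by the degree of the same partial quotient; denominators have strictly increasing
  degrees.\<close>

lemma cf_err_small:
  fixes D :: "'a::field poly"
  assumes nsq: "\<not> (\<exists>g. D = g ^ 2)" and s: "s ^ 2 = poly_to_fls D"
  shows "fls_subdegree (cf_err s (Suc k)) > int (degree (cf_q s (Suc k)))"
proof -
  note nz = cf_frac_nonzero[OF nsq s]
  have e: "cf_err s (Suc k) = - cf_frac s k * cf_err s k" for k by (rule cf_err_Suc) (rule nz)
  have e0: "cf_err s k \<noteq> 0" for k
    by (induction k) (use e nz in \<open>auto simp: cf_err_def\<close>)
  have "fls_subdegree (cf_err s k) = int (degree (cf_q s (Suc k)))" for k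
  proof (induction k)
    case 0
    show ?case by (simp add: cf_err_def)
  next
    case (Suc k)
    have "fls_subdegree (cf_err s (Suc k)) = fls_subdegree (cf_frac s k) + fls_subdegree (cf_err s k)"
      unfolding e[of k] using nz e0 by simp
    also have "\<dots> = int (degree (cf_a s (Suc k)) + degree (cf_q s (Suc k)))"
      using cf_degree_a(1)[OF nz, of k] Suc by simp
    also have "degree (cf_a s (Suc k)) + degree (cf_q s (Suc k)) = degree (cf_q s (Suc (Suc k)))"
      using cf_degree_q[of "Suc k" s] nz by simp
    finally show ?case .
  qed
  moreover have "degree (cf_q s (Suc k)) < degree (cf_q s (Suc (Suc k)))"
    using cf_degree_q[of "Suc k" s] cf_degree_q[of k s] nz by auto
  ultimately show ?thesis by simp
qed

locale cf_approx =
  fixes s :: "'a::field fls" and p q :: "'a poly" and n :: nat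
  assumes q0: "q \<noteq> 0" and n: "n = degree q"
    and bez: "\<exists>u v. u * p + v * q = 1"
    and err: "\<And>k. k \<le> int n \<Longrightarrow> fls_nth (poly_to_fls q * s - poly_to_fls p) k = 0"
begin

text \<open>A polynomial contributes nothing to negative powers of \<open>X\<close>, so the order of
  the error gives \<open>n\<close> linear equations for the coefficients of \<open>q\<close>: the
  Hankel system.\<close>

lemma kernel: "1 \<le> k \<Longrightarrow> k \<le> n \<Longrightarrow> (\<Sum>j\<le>n. coeff q j * fls_nth s (int k + int j)) = 0"
  using err[of "int k"] poly_to_fls_times_nth[of q n s "int k"] n by (simp add: poly_to_fls_nth)

lemma coeff_p: "coeff p i = (\<Sum>j\<le>n. coeff q j * fls_nth s (int j - int i))"
  using err[of "- int i"] poly_to_fls_times_nth[of q n s "- int i"] n by (simp add: poly_to_fls_nth)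

text \<open>Let \<open>p'\<close> be the polynomial part of \<open>r s\<close>. Then
  \<open>q p' - p r\<close> is a combination of two small errors, has positive order, and being a
  polynomial is 0. Coprimality makes \<open>q\<close> divide \<open>r\<close>, whose degree is too
  small.\<close>

lemma kernel_unique:
  assumes r: "degree r < n" and ker: "\<And>k. 1 \<le> k \<Longrightarrow> k \<le> n \<Longrightarrow> (\<Sum>j\<le>n. coeff r j * fls_nth s (int k + int j)) = 0"
  shows "r = 0"
proof (rule ccontr)
  assume r0: "r \<noteq> 0"
  define f where "f = poly_to_fls r * s"
  define p' where "p' = lfloor f"
  define e where "e = f - poly_to_fls p'"
  define e' where "e' = poly_to_fls q * s - poly_to_fls p"
  have e: "fls_nth e k = 0" if "k \<le> int n" for k
  proof (cases "k \<le> 0")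
    case True
    then show ?thesis unfolding e_def p'_def frac_nth by simp
  next
    case False
    then have "fls_nth e k = fls_nth f k" unfolding e_def p'_def frac_nth by simp
    also have "\<dots> = (\<Sum>j\<le>n. coeff r j * fls_nth s (k + int j))"
      unfolding f_def using r by (intro poly_to_fls_times_nth) simp
    also have "\<dots> = 0" using ker[of "nat k"] False that by simp
    finally show ?thesis .
  qed
  have "poly_to_fls (q * p' - p * r) = poly_to_fls r * e' - poly_to_fls q * e"
    unfolding e_def e'_def f_def by (simp add: poly_to_fls_diff poly_to_fls_mult algebra_simps)
  moreover have "fls_nth (poly_to_fls r * e' - poly_to_fls q * e) k = 0" if "k \<le> 0" for k
    using that r n e err unfolding e'_def[symmetric]
    by (simp add: poly_to_fls_times_nth[of r n] poly_to_fls_times_nth[of q n])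
  ultimately have nonpos: "fls_nth (poly_to_fls (q * p' - p * r)) k = 0" if "k \<le> 0" for k using that by simp
  have "q * p' - p * r = 0"
  proof (rule poly_eqI)
    fix i show "coeff (q * p' - p * r) i = coeff 0 i"
      using nonpos[of "- int i"] by (simp add: poly_to_fls_nth)
  qed
  then have eq: "p * r = q * p'" by simp
  obtain u v where "u * p + v * q = 1" using bez by blast
  then have "r = r * (u * p + v * q)" by simp
  also have "\<dots> = u * (p * r) + v * q * r" by (simp add: algebra_simps)
  also have "\<dots> = q * (u * p' + v * r)" unfolding eq by (simp add: algebra_simps)
  finally have "q dvd r" by (rule dvdI)
  then show False using dvd_imp_degree_le[OF _ r0] r n by fastforce
qed

end

text \<open>Row 0 is kept free: different choices of \<open>w\<close> produce the coefficients of
  \<open>q\<close> and those of \<open>p\<close> from the same cofactors. The shift by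
  \<open>d\<close> makes index \<open>d + k\<close> belong to \<open>X^(-k)\<close>.\<close>

definition hankel_mat :: "nat \<Rightarrow> (nat \<Rightarrow> 'a::zero) \<Rightarrow> (nat \<Rightarrow> 'a) \<Rightarrow> nat \<Rightarrow> 'a mat" where
  "hankel_mat n w t d = Matrix.mat (Suc n) (Suc n) (\<lambda>(i,j). if i = 0 then w j else t (d + i + j))"

lemma hankel_mat_carrier: "hankel_mat n w t d \<in> carrier_mat (Suc n) (Suc n)"
  unfolding hankel_mat_def by simp

lemma hankel_mat_index: "i \<le> n \<Longrightarrow> j \<le> n \<Longrightarrow> hankel_mat n w t d $$ (i,j) = (if i = 0 then w j else t (d + i + j))"
  unfolding hankel_mat_def by simp

text \<open>The cofactors of row 0 solve the Hankel system, because a repeated row gives determinant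
  0. Solutions of degree at most \<open>n\<close> form a line spanned by \<open>q\<close>, and the
  last cofactor is not 0, so the cofactors are a nonzero multiple of \<open>q\<close>.\<close>

lemma (in cf_approx) det_hankel_mat:
  assumes \<gamma>: "\<gamma> \<noteq> 0" and t: "\<And>k. k \<ge> 1 \<Longrightarrow> fls_nth s (int k) = \<gamma> * t (d + k)"
  obtains \<mu> where "\<mu> \<noteq> 0" "\<And>w. Determinant.det (hankel_mat n w t d) = \<mu> * (\<Sum>j\<le>n. w j * coeff q j)"
proof -
  define M where "M j = mat_delete (hankel_mat n (\<lambda>_. 0) t d) 0 j" for j
  define c where "c j = (-1) ^ j * Determinant.det (M j)" for j
  have M: "mat_delete (hankel_mat n w t d) 0 j = M j" for w j
    unfolding M_def mat_delete_def by (rule eq_matI) (auto simp: hankel_mat_def)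
  have det: "Determinant.det (hankel_mat n w t d) = (\<Sum>j\<le>n. w j * c j)" for w
  proof -
    have "Determinant.det (hankel_mat n w t d) =
        (\<Sum>j<Suc n. hankel_mat n w t d $$ (0,j) * cofactor (hankel_mat n w t d) 0 j)"
      by (rule laplace_expansion_row[OF hankel_mat_carrier]) simp
    also have "\<dots> = (\<Sum>j\<le>n. w j * c j)"
      unfolding lessThan_Suc_atMost by (intro sum.cong) (auto simp: hankel_mat_index cofactor_def M c_def)
    finally show ?thesis .
  qed
  have ker: "(\<Sum>j\<le>n. f j * fls_nth s (int k + int j)) = \<gamma> * (\<Sum>j\<le>n. t (d + k + j) * f j)" if "1 \<le> k" for f k
  proof -
    have "fls_nth s (int k + int j) = \<gamma> * t (d + k + j)" for j
      using t[of "k + j"] that by (simp add: add.assoc)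
    then show ?thesis by (simp add: sum_distrib_left mult_ac)
  qed
  have cker: "(\<Sum>j\<le>n. c j * fls_nth s (int k + int j)) = 0" if k: "1 \<le> k" "k \<le> n" for k
  proof -
    let ?A = "hankel_mat n (\<lambda>j. t (d + k + j)) t d"
    have "Determinant.det ?A = 0"
    proof (rule Determinant.det_identical_rows[OF hankel_mat_carrier, of 0 k])
      show "Matrix.row ?A 0 = Matrix.row ?A k"
        using k by (intro eq_vecI) (auto simp: hankel_mat_def)
    qed (use k in auto)
    then show ?thesis unfolding ker[OF k(1)] det by simp
  qed
  \<comment> \<open>This cofactor is the determinant of the system restricted to degree below
    \<open>n\<close>; a null vector would be a forbidden small solution.\<close>
  have cn: "c n \<noteq> 0"
  proof
    assume "c n = 0"
    then have "Determinant.det (M n) = 0" unfolding c_def by simp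
    moreover have Mc: "M n \<in> carrier_mat n n" unfolding M_def mat_delete_def by (simp add: hankel_mat_def)
    ultimately obtain v where v: "v \<in> carrier_vec n" "v \<noteq> 0\<^sub>v n" "M n *\<^sub>v v = 0\<^sub>v n"
      using det_0_iff_vec_prod_zero by blast
    define r where "r = (\<Sum>j<n. monom (vec_index v j) j)"
    have cr: "coeff r j = (if j < n then vec_index v j else 0)" for j
      unfolding r_def by (simp add: coeff_sum)
    obtain i where i: "i < n" "vec_index v i \<noteq> 0"
      using v(1,2) by (metis carrier_vecD eq_vecI index_zero_vec(1) index_zero_vec(2))
    have dr: "degree r < n"
    proof (rule ccontr)
      assume "\<not> degree r < n"
      then have "lead_coeff r = 0" using cr by simp
      then have "coeff r i = 0" by simp
      then show False using i cr by simp
    qed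
    have "r = 0"
    proof (rule kernel_unique[OF dr])
      fix k assume k: "1 \<le> k" "k \<le> n"
      have "(\<Sum>j\<le>n. t (d + k + j) * coeff r j) = (\<Sum>j<n. t (d + k + j) * vec_index v j)"
        unfolding cr by (simp add: lessThan_Suc_atMost[symmetric])
      also have "\<dots> = vec_index (M n *\<^sub>v v) (k - 1)"
        using k v(1) unfolding M_def mat_delete_def
        by (simp add: hankel_mat_def scalar_prod_def atLeast0LessThan)
      also have "\<dots> = 0" unfolding v(3) using k by simp
      finally show "(\<Sum>j\<le>n. coeff r j * fls_nth s (int k + int j)) = 0" using ker[OF k(1)] by simp
    qed
    then show False using i cr[of i] by simp
  qed
  \<comment> \<open>Chosen to cancel the coefficient of \<open>X^n\<close>, so that uniqueness in
    smaller degree applies to the difference.\<close>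
  define \<mu> where "\<mu> = c n / coeff q n"
  have qn: "coeff q n \<noteq> 0" using q0 n by simp
  define r where "r = (\<Sum>j\<le>n. monom (c j) j) - Polynomial.smult \<mu> q"
  have cr: "coeff r j = (if j \<le> n then c j else 0) - \<mu> * coeff q j" for j
    unfolding r_def by (simp add: coeff_sum)
  have "r = 0"
  proof (rule ccontr)
    assume "r \<noteq> 0"
    have "coeff r j = 0" if "j \<ge> n" for j
      using that qn n by (auto simp: cr \<mu>_def coeff_eq_0 le_less)
    then have "degree r < n" using \<open>r \<noteq> 0\<close> by (metis leading_coeff_0_iff not_le)
    moreover have "(\<Sum>j\<le>n. coeff r j * fls_nth s (int k + int j)) = 0" if k: "1 \<le> k" "k \<le> n" for k
    proof -
      have "(\<Sum>j\<le>n. coeff r j * fls_nth s (int k + int j)) =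
        (\<Sum>j\<le>n. c j * fls_nth s (int k + int j)) - \<mu> * (\<Sum>j\<le>n. coeff q j * fls_nth s (int k + int j))"
        by (simp add: cr left_diff_distrib sum_subtractf sum_distrib_left mult.assoc)
      then show ?thesis using cker[OF k] kernel[OF k] by simp
    qed
    ultimately have "r = 0" by (rule kernel_unique)
    then show False using \<open>r \<noteq> 0\<close> by contradiction
  qed
  then have "c j = \<mu> * coeff q j" if "j \<le> n" for j using cr[of j] that by simp
  then have "Determinant.det (hankel_mat n w t d) = \<mu> * (\<Sum>j\<le>n. w j * coeff q j)" for w
    unfolding det sum_distrib_left by (intro sum.cong) auto
  moreover have "\<mu> \<noteq> 0" unfolding \<mu>_def using cn qn by simp
  ultimately show ?thesis using that by blast
qed

lemma cf_approx_convergent: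
  fixes D :: "'a::field poly"
  assumes nsq: "\<not> (\<exists>g. D = g ^ 2)" and s: "s ^ 2 = poly_to_fls D"
  shows "cf_approx s (cf_p s (Suc m)) (cf_q s (Suc m)) (degree (cf_q s (Suc m)))"
proof
  show "cf_q s (Suc m) \<noteq> 0" using cf_degree_q[of m s] cf_frac_nonzero[OF nsq s] by blast
  show "\<exists>u v. u * cf_p s (Suc m) + v * cf_q s (Suc m) = 1" by (rule cf_bezout)
  fix k assume "k \<le> int (degree (cf_q s (Suc m)))"
  then show "fls_nth (poly_to_fls (cf_q s (Suc m)) * s - poly_to_fls (cf_p s (Suc m))) k = 0"
    using cf_err_small[OF nsq s, of m] unfolding cf_err_def by (intro fls_eq0_below_subdegree) simp
qed simp

section \<open>The height bound\<close>

text \<open>The pairs \<open>(i, r - i)\<close> are distinct and lie in the square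
  \<open>{1..R} \<times> {1..R}\<close>, over which the sum is the product.\<close>

lemma sum_nested_le_square:
  fixes f :: "nat \<Rightarrow> real"
  assumes "\<And>i. f i \<ge> 0"
  shows "(\<Sum>r=1..Suc R. \<Sum>i\<in>{1..<r}. f i * f (r - i)) \<le> (\<Sum>i=1..R. f i)\<^sup>2"
proof -
  have "(\<Sum>r=1..Suc R. \<Sum>i\<in>{1..<r}. f i * f (r - i)) = (\<Sum>(r,i)\<in>(SIGMA r:{1..Suc R}. {1..<r}). f i * f (r - i))"
    by (rule sum.Sigma) auto
  also have "\<dots> = (\<Sum>(i,j)\<in>(\<lambda>(r,i). (i, r - i)) ` (SIGMA r:{1..Suc R}. {1..<r}). f i * f j)"
    by (subst sum.reindex) (auto simp: inj_on_def split_def)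
  also have "\<dots> \<le> (\<Sum>(i,j)\<in>{1..R} \<times> {1..R}. f i * f j)"
    by (rule sum_mono2) (auto intro!: mult_nonneg_nonneg assms)
  also have "\<dots> = (\<Sum>i=1..R. f i)\<^sup>2"
    by (simp add: power2_eq_square sum_product sum.cartesian_product)
  finally show ?thesis .
qed

text \<open>
  With \<open>z = 1/(dA)\<close> the recursion bounds every partial sum of \<open>\<Sum> \<tau>\<^sub>r z^r\<close> by 1: the linear terms contribute at most 1
  and the convolution at most the square of the previous partial sum.
\<close>

lemma sqrt_coeffs_growth:
  fixes \<tau> a :: "nat \<Rightarrow> real"
  assumes pos: "\<And>r. \<tau> r \<ge> 0" and A: "A > 0" and d: "d \<ge> 1"
    and rec: "\<And>r. r \<ge> 1 \<Longrightarrow> 2 * \<tau> r \<le> a r + (\<Sum>i\<in>{1..<r}. \<tau> i * \<tau> (r - i))"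
    and a: "\<And>r. r \<ge> 1 \<Longrightarrow> a r \<le> (if r \<le> d then A ^ r else 0)" and r: "r \<ge> 1"
  shows "\<tau> r \<le> (real d * A) ^ r"
proof -
  define K where "K = real d * A"
  have K: "K > 0" unfolding K_def using A d by simp
  define f where "f r = \<tau> r / K ^ r" for r
  have f0: "f r \<ge> 0" for r unfolding f_def using pos K by simp
  have frec: "2 * f r \<le> a r / K ^ r + (\<Sum>i\<in>{1..<r}. f i * f (r - i))" if "r \<ge> 1" for r
  proof -
    have "2 * f r \<le> (a r + (\<Sum>i\<in>{1..<r}. \<tau> i * \<tau> (r - i))) / K ^ r"
      unfolding f_def using rec[OF that] K by (simp add: divide_right_mono)
    also have "\<dots> = a r / K ^ r + (\<Sum>i\<in>{1..<r}. f i * f (r - i))"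
      unfolding add_divide_distrib sum_divide_distrib f_def
      by (intro arg_cong2[where f = "(+)"] sum.cong) (auto simp: power_add[symmetric])
    finally show ?thesis .
  qed
  have aK: "a r / K ^ r \<le> (if r \<le> d then 1 / real d else 0)" if r: "r \<ge> 1" for r
  proof (cases "r \<le> d")
    case True
    have "real d \<le> real d ^ r" using d r by (simp add: self_le_power)
    have "a r / K ^ r \<le> A ^ r / K ^ r" using a[OF r] True K by (intro divide_right_mono) auto
    also have "\<dots> = 1 / real d ^ r" unfolding K_def using A by (simp add: power_mult_distrib)
    also have "\<dots> \<le> 1 / real d" using \<open>real d \<le> real d ^ r\<close> d by (intro divide_left_mono) auto
    finally show ?thesis using True by simp
  next
    case False
    then show ?thesis using a[OF r] K by (simp add: divide_nonpos_pos)
  qed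
  have S: "(\<Sum>r=1..R. f r) \<le> 1" for R
  proof (induction R)
    case (Suc R)
    have "2 * (\<Sum>r=1..Suc R. f r) = (\<Sum>r=1..Suc R. 2 * f r)" by (rule sum_distrib_left)
    also have "\<dots> \<le> (\<Sum>r=1..Suc R. a r / K ^ r + (\<Sum>i\<in>{1..<r}. f i * f (r - i)))"
      by (intro sum_mono frec) simp
    also have "\<dots> = (\<Sum>r=1..Suc R. a r / K ^ r) + (\<Sum>r=1..Suc R. \<Sum>i\<in>{1..<r}. f i * f (r - i))"
      by (rule sum.distrib)
    also have "(\<Sum>r=1..Suc R. a r / K ^ r) \<le> (\<Sum>r=1..Suc R. if r \<le> d then 1 / real d else 0)"
      by (intro sum_mono aK) simp
    also have "\<dots> = (\<Sum>r\<in>{1..Suc R} \<inter> {..d}. 1 / real d)"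
      by (subst sum.inter_restrict) auto
    also have "\<dots> \<le> (\<Sum>r\<in>{1..d}. 1 / real d)"
      by (rule sum_mono2) auto
    also have "\<dots> = 1" using d by simp
    also have "(\<Sum>r=1..Suc R. \<Sum>i\<in>{1..<r}. f i * f (r - i)) \<le> (\<Sum>i=1..R. f i)\<^sup>2"
      by (rule sum_nested_le_square) (rule f0)
    also have "\<dots> \<le> 1\<^sup>2" using Suc by (intro power_mono sum_nonneg f0)
    finally show ?case by simp
  qed simp
  have "f r \<le> (\<Sum>r=1..r. f r)" using r f0 by (intro member_le_sum) auto
  then have "f r \<le> 1" using S[of r] by linarith
  then show ?thesis unfolding f_def K_def[symmetric] using K by (simp add: field_simps)
qed

locale height_ideal =
  fixes xs :: "'a::field_char_0 list" and b :: 'a and d :: nat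
  assumes nf: "number_field TYPE('a)" and int: "\<And>y. y \<in> set xs \<Longrightarrow> alg_int y"
    and b: "b \<in> set xs" "b \<noteq> 0" and d: "d \<ge> 1"
begin

abbreviation "I \<equiv> gen_ideal xs"

text \<open>A coefficient of weight \<open>e\<close>: scaling by \<open>(4b)^e\<close> controls it at all places simultaneously.\<close>

definition good :: "nat \<Rightarrow> 'a \<Rightarrow> bool" where
  "good e x \<longleftrightarrow> (4 * b) ^ e * x \<in> mod_pow I e \<and>
     (\<forall>\<sigma>\<in>complex_embeddings. cmod (\<sigma> ((4 * b) ^ e * x)) \<le> (8 * real d * emb_max \<sigma> xs) ^ e)"

lemma emb_max_pos_xs: "\<sigma> \<in> complex_embeddings \<Longrightarrow> emb_max \<sigma> xs > 0"
  by (rule emb_max_pos[OF _ b])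

lemma good_0: "good 0 0" and good_1: "good 0 1"
  unfolding good_def by (auto simp: OK_0 OK_1 emb_0 emb_1)

lemma good_mult:
  assumes "good e x" "good f y" shows "good (e + f) (x * y)"
proof -
  have eq: "(4 * b) ^ (e + f) * (x * y) = ((4 * b) ^ e * x) * ((4 * b) ^ f * y)"
    by (simp add: power_add mult_ac)
  show ?thesis unfolding good_def eq
  proof (intro conjI ballI)
    show "((4 * b) ^ e * x) * ((4 * b) ^ f * y) \<in> mod_pow I (e + f)"
      using assms unfolding good_def by (intro mod_pow_mult) auto
    fix \<sigma> :: "'a \<Rightarrow> complex" assume s: "\<sigma> \<in> complex_embeddings"
    have "cmod (\<sigma> ((4 * b) ^ e * x)) * cmod (\<sigma> ((4 * b) ^ f * y)) \<le>
        (8 * real d * emb_max \<sigma> xs) ^ e * (8 * real d * emb_max \<sigma> xs) ^ f"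
      using assms s emb_max_pos_xs[OF s] unfolding good_def by (intro mult_mono) auto
    then show "cmod (\<sigma> (((4 * b) ^ e * x) * ((4 * b) ^ f * y))) \<le> (8 * real d * emb_max \<sigma> xs) ^ (e + f)"
      by (simp only: emb_mult[OF s, of "(4 * b) ^ e * x" "(4 * b) ^ f * y"] norm_mult power_add)
  qed
qed

text \<open>Allows padding: a quantity of smaller weight may be raised to any larger one, because
  \<open>4 * b\<close> lies in the ideal and is small enough at every embedding.\<close>

lemma good_one: "good k 1"
  unfolding good_def mult_1_right
proof (intro conjI ballI)
  have "4 * b \<in> I"
    using ok_module_mult[OF ok_module_gen_ideal OK_of_int[of 4] gen_ideal_base[OF b(1)]] by simp
  then show "(4 * b) ^ k \<in> mod_pow I k" by (rule mod_pow_power)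
  fix \<sigma> :: "'a \<Rightarrow> complex" assume s: "\<sigma> \<in> complex_embeddings"
  have "cmod (\<sigma> (4 * b)) = 4 * cmod (\<sigma> b)"
    using emb_of_int[OF s, of 4] by (simp add: emb_mult[OF s] norm_mult)
  also have "\<dots> \<le> 4 * emb_max \<sigma> xs" using emb_max_ge[OF b(1), of \<sigma>] by simp
  also have "\<dots> \<le> 8 * real d * emb_max \<sigma> xs" using emb_max_pos_xs[OF s] d by simp
  finally have "cmod (\<sigma> (4 * b)) ^ k \<le> (8 * real d * emb_max \<sigma> xs) ^ k" by (intro power_mono) auto
  then show "cmod (\<sigma> ((4 * b) ^ k)) \<le> (8 * real d * emb_max \<sigma> xs) ^ k"
    by (simp only: emb_power[OF s] norm_power)
qed

lemma good_mono: assumes "good e x" "e \<le> M" shows "good M x"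
  using good_mult[OF assms(1) good_one[of "M - e"]] assms(2) by simp

lemma good_prod: "finite S \<Longrightarrow> (\<And>i. i \<in> S \<Longrightarrow> good (e i) (f i)) \<Longrightarrow> good (\<Sum>i\<in>S. e i) (\<Prod>i\<in>S. f i)"
  by (induction S rule: finite_induct) (auto simp: good_1 good_mult)

text \<open>Every Leibniz term has weight at most \<open>M\<close> and can be padded to
  \<open>M\<close>; the factorial counts the terms.\<close>

lemma good_det:
  assumes A: "A \<in> carrier_mat (Suc n) (Suc n)"
    and e: "\<And>i j. i \<le> n \<Longrightarrow> j \<le> n \<Longrightarrow> good (e i j) (A $$ (i,j))"
    and M: "\<And>\<pi>. \<pi> permutes {0..<Suc n} \<Longrightarrow> (\<Sum>i=0..<Suc n. e i (\<pi> i)) \<le> M"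
  shows "(4 * b) ^ M * Determinant.det A \<in> mod_pow I M"
    "\<sigma> \<in> complex_embeddings \<Longrightarrow> cmod (\<sigma> ((4 * b) ^ M * Determinant.det A)) \<le> fact (Suc n) * (8 * real d * emb_max \<sigma> xs) ^ M"
proof -
  let ?P = "{\<pi>. \<pi> permutes {0..<Suc n}}"
  let ?f = "\<lambda>\<pi>. (4 * b) ^ M * (\<Prod>i=0..<Suc n. A $$ (i, \<pi> i))"
  have g: "good M (\<Prod>i=0..<Suc n. A $$ (i, \<pi> i))" if \<pi>: "\<pi> permutes {0..<Suc n}" for \<pi>
  proof (rule good_mono[OF good_prod M[OF \<pi>]])
    fix i assume i: "i \<in> {0..<Suc n}"
    then have "\<pi> i \<in> {0..<Suc n}" using permutes_in_image[OF \<pi>] by simp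
    then show "good (e i (\<pi> i)) (A $$ (i, \<pi> i))" using e i by simp
  qed simp
  have det: "(4 * b) ^ M * Determinant.det A = (\<Sum>\<pi>\<in>?P. of_int (sign \<pi>) * ?f \<pi>)"
    unfolding det_def'[OF A] sum_distrib_left by (simp only: mult.left_commute)
  have sgn: "sign \<pi> = 1 \<or> sign \<pi> = -1" for \<pi> :: "nat \<Rightarrow> nat" by (simp add: sign_def)
  show "(4 * b) ^ M * Determinant.det A \<in> mod_pow I M"
    unfolding det
  proof (rule ok_module_sum[OF ok_module_mod_pow])
    fix \<pi> assume "\<pi> \<in> ?P"
    then have "?f \<pi> \<in> mod_pow I M" using g unfolding good_def by blast
    then show "of_int (sign \<pi>) * ?f \<pi> \<in> mod_pow I M" by (rule ok_module_mult[OF ok_module_mod_pow OK_of_int])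
  qed
  assume s: "\<sigma> \<in> complex_embeddings"
  have "cmod (\<sigma> ((4 * b) ^ M * Determinant.det A)) \<le> (\<Sum>\<pi>\<in>?P. cmod (\<sigma> (of_int (sign \<pi>) * ?f \<pi>)))"
    unfolding det emb_sum[OF s] by (rule norm_sum)
  also have "\<dots> \<le> (\<Sum>\<pi>\<in>?P. (8 * real d * emb_max \<sigma> xs) ^ M)"
  proof (rule sum_mono)
    fix \<pi> assume "\<pi> \<in> ?P"
    then have "cmod (\<sigma> (?f \<pi>)) \<le> (8 * real d * emb_max \<sigma> xs) ^ M" using g s unfolding good_def by blast
    moreover have "cmod (\<sigma> (of_int (sign \<pi>) * ?f \<pi>)) = cmod (\<sigma> (?f \<pi>))"
      using sgn[of \<pi>] by (auto simp only: emb_mult[OF s, of "of_int _"] emb_of_int[OF s] norm_mult) auto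
    ultimately show "cmod (\<sigma> (of_int (sign \<pi>) * ?f \<pi>)) \<le> (8 * real d * emb_max \<sigma> xs) ^ M" by simp
  qed
  also have "\<dots> = fact (Suc n) * (8 * real d * emb_max \<sigma> xs) ^ M"
  proof -
    have "card ?P = fact (Suc n)" by (rule card_permutations) auto
    then show ?thesis by (simp del: fact_Suc)
  qed
  finally show "cmod (\<sigma> ((4 * b) ^ M * Determinant.det A)) \<le> fact (Suc n) * (8 * real d * emb_max \<sigma> xs) ^ M" .
qed

text \<open>
  Integrality holds because \<open>W\<^sub>r = (4b)^r t\<^sub>r / 2\<close> satisfies a recursion without denominators.
\<close>

lemma good_sqrt_coeffs:
  assumes t0: "t 0 = 1"
    and rec: "\<And>r. r \<ge> 1 \<Longrightarrow> b * (\<Sum>i\<le>r. t i * t (r - i)) = (if r \<le> 2 * d then u r else 0)"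
    and u: "\<And>r. 1 \<le> r \<Longrightarrow> r \<le> 2 * d \<Longrightarrow> u r \<in> set xs \<or> u r = 0"
  shows "good r (t r)"
proof -
  define v where "v r = (if r \<le> 2 * d then u r else 0)" for r
  have rec': "2 * (b * t r) = v r - b * (\<Sum>i\<in>{1..<r}. t i * t (r - i))" if r: "r \<ge> 1" for r
  proof -
    have "{..r} = insert 0 (insert r {1..<r})" using r by auto
    then have "(\<Sum>i\<le>r. t i * t (r - i)) = t r + (t r + (\<Sum>i\<in>{1..<r}. t i * t (r - i)))"
      using r t0 by simp
    then show ?thesis using rec[OF r] unfolding v_def[symmetric] by (simp add: algebra_simps)
  qed
  have vI: "v r \<in> I" if "r \<ge> 1" for r
    unfolding v_def using u[OF that] gen_ideal_base[of "u r" xs] ok_module_0[OF ok_module_gen_ideal] by auto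
  define W where "W r = (4 * b) ^ r * t r / 2" for r
  have WI: "W r \<in> mod_pow I r" if "r \<ge> 1" for r
    using that
  proof (induction r rule: less_induct)
    case (less r)
    obtain k where k: "r = Suc k" using less.prems by (cases r) auto
    \<comment> \<open>This is \<open>rec'\<close> multiplied by \<open>(4 b)^k\<close> with
      \<open>k = r - 1\<close>. The two halves in \<open>W i * W (r - i)\<close> give precisely the
      factor 1/4 left over in \<open>(4 b)^k b = (4 b)^r / 4\<close>.\<close>
    have eq: "W r = of_int (4 ^ k) * (v r * b ^ k) - (\<Sum>i\<in>{1..<r}. W i * W (r - i))"
    proof -
      have "(\<Sum>i\<in>{1..<r}. W i * W (r - i)) = (\<Sum>i\<in>{1..<r}. (4 * b) ^ r / 4 * (t i * t (r - i)))"
      proof (rule sum.cong[OF refl])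
        fix i assume "i \<in> {1..<r}"
        then have "r = i + (r - i)" by simp
        then have "(4 * b) ^ r = (4 * b) ^ i * (4 * b) ^ (r - i)" by (metis power_add)
        then show "W i * W (r - i) = (4 * b) ^ r / 4 * (t i * t (r - i))" unfolding W_def by simp
      qed
      also have "\<dots> = (4 * b) ^ r / 4 * (\<Sum>i\<in>{1..<r}. t i * t (r - i))" by (rule sum_distrib_left[symmetric])
      also have "\<dots> = (4 * b) ^ k * (v r - 2 * (b * t r))" using rec'[OF less.prems] unfolding k by (simp add: mult_ac)
      also have "\<dots> = of_int (4 ^ k) * (v r * b ^ k) - W r"
        unfolding W_def k by (simp add: power_mult_distrib algebra_simps)
      finally show ?thesis by simp
    qed
    have 1: "v r * b ^ k \<in> mod_pow I r"
      using mod_pow_mult[OF mod_pow_1[OF vI[OF less.prems]] mod_pow_power[OF gen_ideal_base[OF b(1)], of k]] k by simp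
    have 2: "(\<Sum>i\<in>{1..<r}. W i * W (r - i)) \<in> mod_pow I r"
    proof (rule ok_module_sum[OF ok_module_mod_pow])
      fix i assume i: "i \<in> {1..<r}"
      then have "W i * W (r - i) \<in> mod_pow I (i + (r - i))" by (intro mod_pow_mult less.IH) auto
      then show "W i * W (r - i) \<in> mod_pow I r" using i by simp
    qed
    show ?case unfolding eq
      by (rule ok_module_diff[OF ok_module_mod_pow ok_module_mult[OF ok_module_mod_pow OK_of_int 1] 2])
  qed
  show ?thesis
  proof (cases "r = 0")
    case True
    then show ?thesis using good_1 t0 by simp
  next
    case False
    then have r: "r \<ge> 1" by simp
    show ?thesis unfolding good_def
    proof (intro conjI ballI)
      have "of_int 2 * W r \<in> mod_pow I r" by (rule ok_module_mult[OF ok_module_mod_pow OK_of_int WI[OF r]])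
      then show "(4 * b) ^ r * t r \<in> mod_pow I r" unfolding W_def by simp
      fix \<sigma> :: "'a \<Rightarrow> complex" assume s: "\<sigma> \<in> complex_embeddings"
      define A where "A = emb_max \<sigma> xs"
      have A: "A > 0" unfolding A_def by (rule emb_max_pos_xs[OF s])
      define \<tau> where "\<tau> r = cmod (\<sigma> (b ^ r * t r))" for r
      define a where "a r = cmod (\<sigma> (b ^ (r - 1) * v r))" for r
      \<comment> \<open>The growth lemma is used with \<open>2 d\<close> in place of
        \<open>d\<close>, since \<open>D\<close> has that many coefficients below the leading one;
        the power of 4 added afterwards gives the base \<open>8 d\<close>.\<close>
      have "\<tau> r \<le> (real (2 * d) * A) ^ r"
      proof (rule sqrt_coeffs_growth[OF _ A _ _ _ r])
        show "\<tau> r \<ge> 0" for r unfolding \<tau>_def by simp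
        show "1 \<le> 2 * d" using d by simp
        fix r :: nat assume r: "r \<ge> 1"
        then obtain k where k: "r = Suc k" by (cases r) auto
        have "2 * (b ^ r * t r) = b ^ k * (2 * (b * t r))" unfolding k by simp
        also have "\<dots> = b ^ (r - 1) * v r - (\<Sum>i\<in>{1..<r}. b ^ r * (t i * t (r - i)))"
          unfolding rec'[OF r] by (simp add: k algebra_simps sum_distrib_left)
        also have "(\<Sum>i\<in>{1..<r}. b ^ r * (t i * t (r - i))) = (\<Sum>i\<in>{1..<r}. (b ^ i * t i) * (b ^ (r - i) * t (r - i)))"
        proof (rule sum.cong[OF refl])
          fix i assume "i \<in> {1..<r}"
          then have "b ^ r = b ^ i * b ^ (r - i)" by (simp add: power_add[symmetric])
          then show "b ^ r * (t i * t (r - i)) = (b ^ i * t i) * (b ^ (r - i) * t (r - i))" by (simp add: mult_ac)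
        qed
        finally have fin: "\<sigma> (of_int 2 * (b ^ r * t r)) = \<sigma> (b ^ (r - 1) * v r - (\<Sum>i\<in>{1..<r}. (b ^ i * t i) * (b ^ (r - i) * t (r - i))))"
          by simp
        have two: "\<sigma> (of_int 2 * (b ^ r * t r)) = 2 * \<sigma> (b ^ r * t r)"
          unfolding emb_mult[OF s, of "of_int 2"] emb_of_int[OF s] by simp
        have prod: "\<sigma> ((b ^ i * t i) * (b ^ (r - i) * t (r - i))) = \<sigma> (b ^ i * t i) * \<sigma> (b ^ (r - i) * t (r - i))" for i
          by (rule emb_mult[OF s])
        have "2 * \<sigma> (b ^ r * t r) = \<sigma> (b ^ (r - 1) * v r) - (\<Sum>i\<in>{1..<r}. \<sigma> (b ^ i * t i) * \<sigma> (b ^ (r - i) * t (r - i)))"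
          using fin unfolding two emb_diff[OF s] emb_sum[OF s] prod .
        then have "2 * \<tau> r = cmod (\<sigma> (b ^ (r - 1) * v r) - (\<Sum>i\<in>{1..<r}. \<sigma> (b ^ i * t i) * \<sigma> (b ^ (r - i) * t (r - i))))"
          unfolding \<tau>_def by (metis norm_mult norm_numeral)
        also have "\<dots> \<le> a r + cmod (\<Sum>i\<in>{1..<r}. \<sigma> (b ^ i * t i) * \<sigma> (b ^ (r - i) * t (r - i)))"
          unfolding a_def by (rule norm_triangle_ineq4)
        also have "cmod (\<Sum>i\<in>{1..<r}. \<sigma> (b ^ i * t i) * \<sigma> (b ^ (r - i) * t (r - i))) \<le> (\<Sum>i\<in>{1..<r}. \<tau> i * \<tau> (r - i))"
          unfolding \<tau>_def norm_mult[symmetric] by (rule norm_sum)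
        finally show "2 * \<tau> r \<le> a r + (\<Sum>i\<in>{1..<r}. \<tau> i * \<tau> (r - i))" by simp
        show "a r \<le> (if r \<le> 2 * d then A ^ r else 0)"
        proof (cases "r \<le> 2 * d")
          case True
          have "cmod (\<sigma> (v r)) \<le> A"
            using u[OF r True] emb_max_ge[of "u r" xs \<sigma>] A True unfolding v_def A_def by (auto simp: emb_0[OF s])
          moreover have "cmod (\<sigma> b) ^ k \<le> A ^ k" using emb_max_ge[OF b(1), of \<sigma>] unfolding A_def by (intro power_mono) auto
          ultimately have "cmod (\<sigma> b) ^ k * cmod (\<sigma> (v r)) \<le> A ^ k * A" using A by (intro mult_mono) auto
          then show ?thesis using True unfolding a_def k by (simp add: emb_mult[OF s] emb_power[OF s] norm_mult norm_power mult.commute)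
        next
          case False
          then show ?thesis unfolding a_def v_def by (simp add: emb_0[OF s])
        qed
      qed
      moreover have "cmod (\<sigma> ((4 * b) ^ r * t r)) = 4 ^ r * \<tau> r"
      proof -
        have "\<sigma> ((4 * b) ^ r * t r) = \<sigma> (of_int (4 ^ r) * (b ^ r * t r))" by (simp add: power_mult_distrib mult_ac)
        also have "\<dots> = of_int (4 ^ r) * \<sigma> (b ^ r * t r)" by (simp only: emb_mult[OF s, of "of_int _"] emb_of_int[OF s])
        finally show ?thesis unfolding \<tau>_def by (simp add: norm_mult norm_power)
      qed
      ultimately have "cmod (\<sigma> ((4 * b) ^ r * t r)) \<le> 4 ^ r * (real (2 * d) * A) ^ r" by simp
      also have "\<dots> = (4 * (real (2 * d) * A)) ^ r" by (rule power_mult_distrib[symmetric])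
      also have "4 * (real (2 * d) * A) = 8 * real d * A" by simp
      finally show "cmod (\<sigma> ((4 * b) ^ r * t r)) \<le> (8 * real d * emb_max \<sigma> xs) ^ r" unfolding A_def .
    qed
  qed
qed

text \<open>The height sees the coefficients of \<open>f\<close> only up to a common factor, here
  \<open>(4 b)^M \<kappa>\<close>, so integral multiples of determinants may stand for the
  coefficients.\<close>

lemma proj_height_coeffs_le:
  assumes f: "f \<noteq> 0" and \<kappa>: "\<kappa> \<noteq> 0"
    and good: "\<And>l. (4 * b) ^ M * (\<kappa> * coeff f l) \<in> mod_pow I M"
    and bound: "\<And>\<sigma> l. \<sigma> \<in> complex_embeddings \<Longrightarrow>
      cmod (\<sigma> ((4 * b) ^ M * (\<kappa> * coeff f l))) \<le> fact (Suc n) * (8 * real d * emb_max \<sigma> xs) ^ M"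
  shows "h_proj f \<le> ln (fact (Suc n)) + real M * (ln (8 * real d) + height_integral xs)"
proof -
  define c where "c = (4 * b) ^ M * \<kappa>"
  define ys where "ys = map ((*) c) (coeffs f)"
  have c0: "c \<noteq> 0" unfolding c_def using b(2) \<kappa> by simp
  have lead: "lead_coeff f \<in> set (coeffs f)" "lead_coeff f \<noteq> 0" using f by (auto intro: coeff_in_coeffs)
  have ys: "\<exists>l. y = (4 * b) ^ M * (\<kappa> * coeff f l)" if "y \<in> set ys" for y
    using that unfolding ys_def c_def by (auto simp: coeffs_def mult.assoc split: if_splits)
  have mem: "set ys \<subseteq> mod_pow I M" using ys good by blast
  have "alg_int y" if "y \<in> set ys" for y
    using mem mod_pow_subset_OK[OF gen_ideal_subset_OK[OF int]] that unfolding ring_of_integers_def by blast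
  then have "proj_height (coeffs f) = height_integral ys"
    unfolding ys_def by (intro proj_height_eq_height_integral[OF nf lead c0]) auto
  also have "\<dots> \<le> ln (fact (Suc n)) + real M * (ln (8 * real d) + height_integral xs)"
  proof (rule height_integral_le_if_mem_mod_pow[OF nf int b _ _ mem])
    show "c * lead_coeff f \<in> set ys" "c * lead_coeff f \<noteq> 0" unfolding ys_def using lead c0 by auto
    show "cmod (\<sigma> y) \<le> fact (Suc n) * (8 * real d * emb_max \<sigma> xs) ^ M"
      if "\<sigma> \<in> complex_embeddings" "y \<in> set ys" for \<sigma> y
      using ys[OF that(2)] bound[OF that(1)] by auto
  qed (use d in auto)
  finally show ?thesis unfolding h_proj_def .
qed

end

section \<open>Weights of permutations, factorials, and the expansion of the square root\<close>

lemma sum_permutes_index: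
  assumes "\<pi> permutes {0..<Suc n}"
  shows "(\<Sum>i=0..<Suc n. i + \<pi> i) = n * n + n"
proof -
  have "(\<Sum>i=0..<Suc n. \<pi> i) = (\<Sum>i=0..<Suc n. i)"
    using sum.permute[OF assms, of "\<lambda>i. i"] by simp
  moreover have "2 * (\<Sum>i=0..<Suc n. i) = n * n + n" by (induction n) auto
  ultimately show ?thesis by (simp only: sum.distrib)
qed

text \<open>The exponent \<open>n^2 + n\<close> grows by \<open>2 n + 2\<close> at each step, and
  \<open>n + 2 \<le> 2^(2 n + 2)\<close>. It is chosen to match the weight contributed by the
  indices of the determinant.\<close>

lemma fact_Suc_le_power: "fact (Suc n) \<le> (2::real) ^ (n * n + n)"
proof (induction n)
  case (Suc n)
  have "real (Suc (Suc n)) \<le> 2 ^ Suc (Suc n)" using less_exp[of "Suc (Suc n)"] by (metis less_imp_le of_nat_le_iff of_nat_numeral of_nat_power)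
  also have "\<dots> \<le> 2 ^ (2 * n + 2)" by (rule power_increasing) auto
  finally have "real (Suc (Suc n)) * fact (Suc n) \<le> 2 ^ (2 * n + 2) * 2 ^ (n * n + n)"
    using Suc by (intro mult_mono) auto
  also have "\<dots> = (2::real) ^ (Suc n * Suc n + Suc n)" unfolding power_add[symmetric] by (rule arg_cong[where f = "\<lambda>k. 2 ^ k"]) simp
  finally show ?case by simp
qed simp

lemma ln_fact_Suc_le: "ln (fact (Suc n)) \<le> real (n * n + n) * ln 2"
proof -
  have "ln (fact (Suc n)) \<le> ln ((2::real) ^ (n * n + n))" using fact_Suc_le_power[of n] by simp
  then show ?thesis by (simp add: ln_realpow)
qed

lemma sqrt_subdegree:
  fixes D :: "'a::field poly"
  assumes D: "D \<noteq> 0" "degree D = 2 * d" and s: "s ^ 2 = poly_to_fls D"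
  shows "fls_subdegree s = - int d" "s \<noteq> 0"
proof -
  show s0: "s \<noteq> 0" using s D poly_to_fls_eq_0_iff[of D] by auto
  have "2 * fls_subdegree s = fls_subdegree (s ^ 2)" using s0 by (simp add: power2_eq_square)
  then show "fls_subdegree s = - int d" unfolding s poly_to_fls_subdegree[OF D(1)] D(2) by simp
qed

lemma sqrt_coeff_convolution:
  fixes D :: "'a::field poly"
  assumes D: "D \<noteq> 0" "degree D = 2 * d" and s: "s ^ 2 = poly_to_fls D"
  shows "(\<Sum>i\<le>r. fls_nth s (int i - int d) * fls_nth s (int (r - i) - int d)) =
    (if r \<le> 2 * d then coeff D (2 * d - r) else 0)"
proof -
  note sub = sqrt_subdegree(1)[OF assms]
  have "fls_nth (s * s) (int r - 2 * int d) =
      (\<Sum>i=- int d + - int d..int r - 2 * int d. fls_nth s (i - - int d) * fls_nth s (- int d + (int r - 2 * int d) - i))"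
    by (subst fls_times_nth(1)) (simp add: sub)
  also have "\<dots> = (\<Sum>i\<le>r. fls_nth s (int i - int d) * fls_nth s (int (r - i) - int d))"
    by (rule sum.reindex_bij_witness[of _ "\<lambda>i. int i - 2 * int d" "\<lambda>i. nat (i + 2 * int d)"])
      (auto simp: of_nat_diff algebra_simps)
  finally have "(\<Sum>i\<le>r. fls_nth s (int i - int d) * fls_nth s (int (r - i) - int d)) = fls_nth (poly_to_fls D) (int r - 2 * int d)"
    using s by (simp add: power2_eq_square)
  also have "\<dots> = (if r \<le> 2 * d then coeff D (2 * d - r) else 0)"
    by (auto simp: poly_to_fls_nth nat_diff_distrib intro!: arg_cong[where f = "coeff D"])
  finally show ?thesis .
qed

theorem mainTheorem7:
  fixes D :: "'a::field_char_0 poly" and s :: "'a fls" and d m :: nat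
  assumes "number_field TYPE('a)"
    and "\<not> (\<exists>g. D = g ^ 2)"
    and "degree D = 2 * d"
    and "\<exists>c. lead_coeff D = c ^ 2"
    and "s ^ 2 = poly_to_fls D"
  shows "h_proj (cf_p s (Suc m)) \<le>
           (real ((degree (cf_q s (Suc m)) + 1) * d)
              + 3 / 2 * real ((degree (cf_q s (Suc m)))\<^sup>2 + degree (cf_q s (Suc m))))
           * (ln 4 + 2 * ln (2 * real d) + h_proj D)
       \<and> h_proj (cf_q s (Suc m)) \<le>
           (real (degree (cf_q s (Suc m)) * d)
              + 1 / 2 * real (3 * (degree (cf_q s (Suc m)))\<^sup>2 + degree (cf_q s (Suc m))))
           * (ln 4 + 2 * ln (2 * real d) + h_proj D)"
proof -
  note nf = assms(1) and nsq = assms(2) and deg = assms(3) and s2 = assms(5)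
  have D0: "D \<noteq> 0" using nsq by (metis zero_power2)
  \<comment> \<open>A constant \<open>D\<close> equals its leading coefficient and would be a
    square.\<close>
  have d: "d \<ge> 1"
  proof (rule ccontr)
    assume "\<not> d \<ge> 1"
    then have "degree D = 0" using deg by simp
    then obtain a where a: "D = [:a:]" by (rule degree_eq_zeroE)
    obtain c where "lead_coeff D = c ^ 2" using assms(4) by blast
    then have "D = [:c:] ^ 2" using a by (simp add: power2_eq_square)
    then show False using nsq by blast
  qed
  obtain N :: int where N: "N > 0" "\<And>y. y \<in> set (coeffs D) \<Longrightarrow> alg_int (of_int N * y)"
    using common_alg_int_multiple[OF nf, of "set (coeffs D)"] by auto
  define c :: 'a where "c = of_int N"
  have c0: "c \<noteq> 0" unfolding c_def using N(1) by simp
  define xs where "xs = map ((*) c) (coeffs D)"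
  define b where "b = c * lead_coeff D"
  have lead: "lead_coeff D \<in> set (coeffs D)" "lead_coeff D \<noteq> 0" using D0 by (auto intro: coeff_in_coeffs)
  interpret height_ideal xs b d
  proof
    show "alg_int y" if "y \<in> set xs" for y using that N(2) unfolding xs_def c_def by auto
  qed (use nf lead c0 d in \<open>auto simp: xs_def b_def\<close>)
  have hD: "h_proj D = height_integral xs"
    unfolding h_proj_def xs_def using N(2) by (intro proj_height_eq_height_integral[OF nf lead c0]) (simp add: c_def)
  note sub = sqrt_subdegree[OF D0 deg s2]
  define \<gamma> where "\<gamma> = fls_nth s (- int d)"
  have \<gamma>0: "\<gamma> \<noteq> 0" unfolding \<gamma>_def using nth_fls_subdegree_nonzero[OF sub(2)] sub(1) by simp
  \<comment> \<open>Normalised and shifted so that \<open>t 0 = 1\<close>; since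
    \<open>\<gamma>^2\<close> is the leading coefficient of \<open>D\<close>, the convolution
    identity becomes the recursion with \<open>b = c \<gamma>^2\<close>.\<close>
  define t where "t r = fls_nth s (int r - int d) / \<gamma>" for r :: nat
  have t0: "t 0 = 1" unfolding t_def using \<gamma>0 by (simp add: \<gamma>_def)
  have conv: "\<gamma>\<^sup>2 * (\<Sum>i\<le>r. t i * t (r - i)) = (if r \<le> 2 * d then coeff D (2 * d - r) else 0)" for r
    unfolding sqrt_coeff_convolution[OF D0 deg s2, symmetric] t_def sum_distrib_left
    using \<gamma>0 by (intro sum.cong) (auto simp: power2_eq_square)
  have \<gamma>2: "\<gamma>\<^sup>2 = lead_coeff D" using conv[of 0] t0 deg by simp
  have goodt: "good r (t r)" for r
  proof (rule good_sqrt_coeffs[where t = t and u = "\<lambda>r. c * coeff D (2 * d - r)"])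
    show "t 0 = 1" by (rule t0)
    fix r :: nat
    show "b * (\<Sum>i\<le>r. t i * t (r - i)) = (if r \<le> 2 * d then c * coeff D (2 * d - r) else 0)"
      using conv[of r] unfolding b_def \<gamma>2[symmetric] by (simp add: mult.assoc)
    show "c * coeff D (2 * d - r) \<in> set xs \<or> c * coeff D (2 * d - r) = 0"
      unfolding xs_def using D0 deg by (auto intro!: imageI coeff_in_coeffs)
  qed
  define n where "n = degree (cf_q s (Suc m))"
  define p where "p = cf_p s (Suc m)"
  define q where "q = cf_q s (Suc m)"
  interpret cf_approx s p q n unfolding p_def q_def n_def by (rule cf_approx_convergent[OF nsq s2])
  have st: "fls_nth s (int k) = \<gamma> * t (d + k)" for k unfolding t_def using \<gamma>0 by simp
  obtain \<mu> where \<mu>: "\<mu> \<noteq> 0" "\<And>w. Determinant.det (hankel_mat n w t d) = \<mu> * (\<Sum>j\<le>n. w j * coeff q j)"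
    using det_hankel_mat[OF \<gamma>0, of t d] st by metis
  define L where "L = ln 4 + 2 * ln (2 * real d) + h_proj D"
  have hD0: "h_proj D \<ge> 0" unfolding hD by (rule height_integral_nonneg[OF nf int b])
  have ln2d: "ln (2 * real d) \<ge> ln 2" using d by simp
  have ln4: "ln 4 = 2 * ln (2::real)" using ln_realpow[of 2 2] by simp
  have ln2: "ln (2::real) \<ge> 0" by simp
  have ln8d: "ln (8 * real d) + h_proj D = L - ln (2 * real d)"
  proof -
    have "ln (8 * real d) = ln (4 * (2 * real d))" by simp
    also have "\<dots> = ln 4 + ln (2 * real d)" using d by (subst ln_mult) auto
    finally show ?thesis unfolding L_def by simp
  qed
  have hq: "h_proj q \<le> ln (fact (Suc n)) + real (n * d + (n * n + n)) * (ln (8 * real d) + height_integral xs)"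
  proof -
    \<comment> \<open>A unit vector in row 0 singles out the coefficient of \<open>X^l\<close> in
      \<open>q\<close>; this row has weight 0.\<close>
    define w where "w l j = (if j = l then 1 else 0 :: 'a)" for l j :: nat
    define e where "e i j = (if i = 0 then 0 else d + i + j)" for i j :: nat
    have det: "Determinant.det (hankel_mat n (w l) t d) = \<mu> * coeff q l" for l
    proof -
      have "(\<Sum>j\<le>n. w l j * coeff q j) = (\<Sum>j\<le>n. if j = l then coeff q j else 0)"
        unfolding w_def by (intro sum.cong) auto
      also have "\<dots> = coeff q l" using n by (simp add: coeff_eq_0)
      finally show ?thesis using \<mu>(2) by simp
    qed
    have ge: "good (e i j) (hankel_mat n (w l) t d $$ (i,j))" if "i \<le> n" "j \<le> n" for i j l
      using that goodt good_0 good_1 unfolding e_def w_def by (simp add: hankel_mat_index)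
    \<comment> \<open>The \<open>n\<close> Hankel rows contribute \<open>d\<close> each, and the
      indices contribute \<open>n^2 + n\<close> for every permutation.\<close>
    have Me: "(\<Sum>i=0..<Suc n. e i (\<pi> i)) \<le> n * d + (n * n + n)" if "\<pi> permutes {0..<Suc n}" for \<pi>
    proof -
      have "(\<Sum>i=0..<Suc n. e i (\<pi> i)) \<le> (\<Sum>i=0..<Suc n. (if i = 0 then 0 else d) + (i + \<pi> i))"
        unfolding e_def by (intro sum_mono) auto
      also have "\<dots> = (\<Sum>i=0..<Suc n. if i = 0 then 0 else d) + (n * n + n)"
        unfolding sum.distrib[of "\<lambda>i. if i = 0 then 0 else d"] sum_permutes_index[OF that] ..
      also have "(\<Sum>i=0..<Suc n. if i = 0 then 0 else d) = n * d"
        by (subst sum.atLeast_Suc_lessThan) auto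
      finally show ?thesis .
    qed
    note gd = good_det[OF hankel_mat_carrier ge Me, unfolded det]
    show ?thesis by (rule proj_height_coeffs_le[OF q0 \<mu>(1) gd])
  qed
  have hp: "h_proj p \<le> ln (fact (Suc n)) + real ((n + 1) * d + (n * n + n)) * (ln (8 * real d) + height_integral xs)"
  proof -
    \<comment> \<open>Row 0 now consists of the coefficients of \<open>s / \<gamma>\<close> that
      produce \<open>X^l\<close> in \<open>q s\<close>. For \<open>l > d + j\<close> the entry is 0,
      and the truncated subtraction in \<open>e\<close> assigns it weight 0.\<close>
    define w where "w l j = (if l \<le> d + j then t (d + j - l) else 0)" for l j :: nat
    define e where "e l i j = (if i = 0 then d + j - l else d + i + j)" for l i j :: nat
    define \<kappa> where "\<kappa> = \<mu> / \<gamma>"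
    have \<kappa>0: "\<kappa> \<noteq> 0" unfolding \<kappa>_def using \<mu>(1) \<gamma>0 by simp
    have det: "Determinant.det (hankel_mat n (w l) t d) = \<kappa> * coeff p l" for l
    proof -
      have summand: "coeff q j * fls_nth s (int j - int l) = \<gamma> * (w l j * coeff q j)" for j
      proof (cases "l \<le> d + j")
        case True
        then have "fls_nth s (int j - int l) = \<gamma> * t (d + j - l)"
          unfolding t_def using \<gamma>0 by (simp add: of_nat_diff algebra_simps)
        then show ?thesis using True unfolding w_def by simp
      next
        case False
        then show ?thesis unfolding w_def using sub(1) by simp
      qed
      have "coeff p l = \<gamma> * (\<Sum>j\<le>n. w l j * coeff q j)"
        unfolding coeff_p summand sum_distrib_left ..
      then show ?thesis unfolding \<mu>(2) \<kappa>_def using \<gamma>0 by simp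
    qed
    have ge: "good (e l i j) (hankel_mat n (w l) t d $$ (i,j))" if "i \<le> n" "j \<le> n" for i j l
      using that goodt good_0 unfolding e_def w_def by (simp add: hankel_mat_index)
    have Me: "(\<Sum>i=0..<Suc n. e l i (\<pi> i)) \<le> (n + 1) * d + (n * n + n)" if "\<pi> permutes {0..<Suc n}" for \<pi> l
    proof -
      have "(\<Sum>i=0..<Suc n. e l i (\<pi> i)) \<le> (\<Sum>i=0..<Suc n. d + (i + \<pi> i))"
        unfolding e_def by (intro sum_mono) auto
      also have "\<dots> = (n + 1) * d + (n * n + n)"
        unfolding sum.distrib[of "\<lambda>i. d"] sum_permutes_index[OF that] by simp
      finally show ?thesis .
    qed
    have p0: "p \<noteq> 0"
    proof
      assume "p = 0"
      \<comment> \<open>The top coefficient of \<open>p\<close> is the product of those of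
        \<open>q\<close> and \<open>s\<close>; in all other summands the index lies below the order
        of \<open>s\<close>.\<close>
      have "coeff p (n + d) = (\<Sum>j\<le>n. if j = n then coeff q n * \<gamma> else 0)"
        unfolding coeff_p by (intro sum.cong) (auto simp: \<gamma>_def sub(1))
      then show False using \<open>p = 0\<close> \<gamma>0 q0 n by simp
    qed
    note gd = good_det[OF hankel_mat_carrier ge Me, unfolded det]
    show ?thesis by (rule proj_height_coeffs_le[OF p0 \<kappa>0 gd])
  qed
  have L0: "L \<ge> ln 4 + 2 * ln 2" unfolding L_def using hD0 ln2d by simp
  have L2: "ln 2 \<le> L / 2" "0 \<le> L" "0 \<le> ln (2 * real d)" using L0 ln2 ln4 ln2d by linarith+
  have F: "ln (fact (Suc n)) \<le> real (n * n + n) * ln 2" by (rule ln_fact_Suc_le)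
  have "h_proj p \<le> (real ((n + 1) * d) + 3 / 2 * real (n\<^sup>2 + n)) * L"
  proof -
    have "h_proj p \<le> real (n * n + n) * ln 2 + real ((n + 1) * d + (n * n + n)) * (L - ln (2 * real d))"
      using hp F unfolding hD[symmetric] ln8d by linarith
    \<comment> \<open>Half of \<open>L\<close> absorbs the factorial, by
      \<open>ln 4 = 2 ln 2\<close>; this is where 3/2 comes from. The surplus
      \<open>ln (2 d)\<close> is dropped.\<close>
    also have "\<dots> \<le> real (n * n + n) * (L / 2) + real ((n + 1) * d + (n * n + n)) * L"
      using L2 by (intro add_mono mult_left_mono) auto
    also have "\<dots> = (real ((n + 1) * d) + 3 / 2 * real (n\<^sup>2 + n)) * L"
      by (simp add: power2_eq_square algebra_simps)
    finally show ?thesis .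
  qed
  moreover have "h_proj q \<le> (real (n * d) + 1 / 2 * real (3 * n\<^sup>2 + n)) * L"
  proof -
    have n2: "real n \<le> real n * real n" by (cases n) auto
    \<comment> \<open>Here the surplus \<open>ln (2 d) \<ge> ln 2\<close> in \<open>L\<close>
      absorbs the factorial, giving the coefficient \<open>n d + n^2 + n\<close>, which is at most
      the claimed one by \<open>n \<le> n^2\<close>.\<close>
    have "real (n * n + n) * ln 2 \<le> real (n * d + (n * n + n)) * ln (2 * real d)"
      using ln2 ln2d L2 by (intro mult_mono) auto
    then have "h_proj q \<le> real (n * d + (n * n + n)) * L"
      using hq F unfolding hD[symmetric] ln8d by (simp add: right_diff_distrib)
    also have "\<dots> \<le> (real (n * d) + 1 / 2 * real (3 * n\<^sup>2 + n)) * L"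
      using L2 n2 by (intro mult_right_mono) (auto simp: power2_eq_square)
    finally show ?thesis .
  qed
  ultimately show ?thesis unfolding p_def q_def n_def L_def by blast
qed

end
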